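(* Let $G$ be an (infinite, connected, locally finite) 1-ended quasi-transitive graph admitting a basis $\mathcal{P}$ of its cycle space all cycles of which are triangles. Then $p_{\mathbb{C}}\le 1-p_c$ for both site and bond percolation on $G$. In particular, we have $p_c\le 1/2$ (for both site and bond percolation).
   Context: $G$ is quasi-transitive if its automorphism group has finitely many orbits on $V(G)$. The edge space of $G$ is $\bigoplus_{e\in E(G)}\mathbb{Z}_2$, and the cycle space is its subspace spanned by the edge sets of cycles of $G$; a basis here means a set of cycles whose edge sets span the cycle space. In Bernoulli bond (site) percolation with parameter $p$ each edge (vertex) is independently occupied with probability $p$ and vacant otherwise; $\Pr_p$ is the law. For a fixed vertex $o$, $C(o)$ is the connected component of $o$ in the subgraph spanned by the occupied edges (induced by the occupied vertices), $\theta_o(p):=\Pr_p(|C(o)|=\infty)$, $p_c:=\sup\{p : \theta_o(p)=0\}$ (independent of $o$), and $p_{\mathbb{C}}:=\inf\{p\le 1 : \theta_o \text{ is analytic in } (p,1]\}$; in each of the two cases (site, bond), $p_c$ and $p_{\mathbb{C}}$ refer to the same percolation model. A function $f$ is analytic on an interval $I\subset\mathbb{R}$ if every $x\in I$ is the centre of an open disc $D\subset\mathbb{C}$ on which there is a holomorphic function agreeing with $f$ on $D\cap I$. *)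

theory Defs
  imports
    "HOL-Probability.Probability"
    "HOL-Complex_Analysis.Complex_Analysis"
    "HOL-Library.Poly_Mapping"
    "HOL-Library.Z2"
begin

section \<open>Graphs\<close>

text \<open>A graph is given by a vertex set \<open>V\<close> and a set \<open>E\<close> of edges, an edge being the
  two-element set of its endvertices.\<close>

definition simple_graph :: "'a set \<Rightarrow> 'a set set \<Rightarrow> bool" where
  "simple_graph V E \<longleftrightarrow> (\<forall>e\<in>E. e \<subseteq> V \<and> card e = 2)"

definition locally_finite_graph :: "'a set \<Rightarrow> 'a set set \<Rightarrow> bool" where
  "locally_finite_graph V E \<longleftrightarrow> (\<forall>v\<in>V. finite {e\<in>E. v \<in> e})"

definition adjacency :: "'a set set \<Rightarrow> 'a rel" where
  "adjacency E = {(u, v). {u, v} \<in> E}"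

text \<open>The vertex set of the component of \<open>x\<close>; it is empty if \<open>x\<close> is not a vertex.\<close>

definition component :: "'a set \<Rightarrow> 'a set set \<Rightarrow> 'a \<Rightarrow> 'a set" where
  "component V E x = (if x \<in> V then {v. (x, v) \<in> (adjacency E)\<^sup>*} else {})"

definition connected_graph :: "'a set \<Rightarrow> 'a set set \<Rightarrow> bool" where
  "connected_graph V E \<longleftrightarrow> (\<forall>u\<in>V. \<forall>v\<in>V. v \<in> component V E u)"

definition induced_edges :: "'a set set \<Rightarrow> 'a set \<Rightarrow> 'a set set" where
  "induced_edges E W = {e\<in>E. e \<subseteq> W}"

definition graph_automorphisms :: "'a set \<Rightarrow> 'a set set \<Rightarrow> ('a \<Rightarrow> 'a) set" where
  "graph_automorphisms V E =
     {f. bij_betw f V V \<and> (\<forall>u\<in>V. \<forall>v\<in>V. {f u, f v} \<in> E \<longleftrightarrow> {u, v} \<in> E)}"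

definition vertex_orbit :: "'a set \<Rightarrow> 'a set set \<Rightarrow> 'a \<Rightarrow> 'a set" where
  "vertex_orbit V E v = (\<lambda>f. f v) ` graph_automorphisms V E"

definition quasi_transitive :: "'a set \<Rightarrow> 'a set set \<Rightarrow> bool" where
  "quasi_transitive V E \<longleftrightarrow> finite (vertex_orbit V E ` V)"


section \<open>Ends\<close>

definition rays :: "'a set \<Rightarrow> 'a set set \<Rightarrow> (nat \<Rightarrow> 'a) set" where
  "rays V E = {r. inj r \<and> range r \<subseteq> V \<and> (\<forall>n. {r n, r (Suc n)} \<in> E)}"

text \<open>Two rays are equivalent if, for every finite vertex set \<open>S\<close>, both have a tail in the same
  component of \<open>G - S\<close>.\<close>

definition ray_equiv :: "'a set \<Rightarrow> 'a set set \<Rightarrow> (nat \<Rightarrow> 'a) rel" where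
  "ray_equiv V E = {(r, s). r \<in> rays V E \<and> s \<in> rays V E \<and>
     (\<forall>S. finite S \<and> S \<subseteq> V \<longrightarrow>
        (\<exists>x\<in>V - S. \<exists>m. \<forall>n\<ge>m.
           r n \<in> component (V - S) (induced_edges E (V - S)) x \<and>
           s n \<in> component (V - S) (induced_edges E (V - S)) x))}"

definition graph_ends :: "'a set \<Rightarrow> 'a set set \<Rightarrow> (nat \<Rightarrow> 'a) set set" where
  "graph_ends V E = rays V E // ray_equiv V E"

definition one_ended :: "'a set \<Rightarrow> 'a set set \<Rightarrow> bool" where
  "one_ended V E \<longleftrightarrow> card (graph_ends V E) = 1"


section \<open>The cycle space\<close>

text \<open>The edge space, the direct sum of copies of \<open>\<int>\<^sub>2\<close> over the edges, consists of
  the finitely supported functions from edges to \<^typ>\<open>bit\<close>, the field with two elements.\<close>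

global_interpretation edge_space: vector_space
  "\<lambda>(c::bit) (f :: 'e \<Rightarrow>\<^sub>0 bit). Poly_Mapping.map ((*) c) f"
  by standard
    (auto intro!: poly_mapping_eqI simp: map.rep_eq lookup_add algebra_simps when_def)

definition edge_vector :: "'e set \<Rightarrow> 'e \<Rightarrow>\<^sub>0 bit" where
  "edge_vector F = (\<Sum>e\<in>F. Poly_Mapping.single e 1)"

text \<open>A cycle is represented by its edge set, which determines it.\<close>

definition closed_walk_edges :: "'a list \<Rightarrow> 'a set set" where
  "closed_walk_edges vs = {{vs ! i, vs ! (Suc i mod length vs)} | i. i < length vs}"

definition cycles :: "'a set \<Rightarrow> 'a set set \<Rightarrow> 'a set set set" where
  "cycles V E = {closed_walk_edges vs | vs.
     3 \<le> length vs \<and> distinct vs \<and> set vs \<subseteq> V \<and> closed_walk_edges vs \<subseteq> E}"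

definition cycle_space :: "'a set \<Rightarrow> 'a set set \<Rightarrow> ('a set \<Rightarrow>\<^sub>0 bit) set" where
  "cycle_space V E = edge_space.span (edge_vector ` cycles V E)"

text \<open>Linear independence is not required of a basis here.\<close>

definition cycle_basis :: "'a set \<Rightarrow> 'a set set \<Rightarrow> 'a set set set \<Rightarrow> bool" where
  "cycle_basis V E P \<longleftrightarrow>
     P \<subseteq> cycles V E \<and> edge_space.span (edge_vector ` P) = cycle_space V E"

definition triangles :: "'a set \<Rightarrow> 'a set set \<Rightarrow> 'a set set set" where
  "triangles V E = {C \<in> cycles V E. card C = 3}"


section \<open>Bernoulli percolation\<close>

text \<open>\<open>True\<close> means occupied; \<open>I\<close> is the set of edges (bond) or of vertices (site).\<close>

definition bernoulli_percolation :: "'i set \<Rightarrow> real \<Rightarrow> ('i \<Rightarrow> bool) measure" where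
  "bernoulli_percolation I p = (\<Pi>\<^sub>M i\<in>I. measure_pmf (bernoulli_pmf p))"

definition bond_cluster :: "'a set \<Rightarrow> 'a set set \<Rightarrow> 'a \<Rightarrow> ('a set \<Rightarrow> bool) \<Rightarrow> 'a set" where
  "bond_cluster V E x \<omega> = component V {e\<in>E. \<omega> e} x"

definition site_cluster :: "'a set \<Rightarrow> 'a set set \<Rightarrow> 'a \<Rightarrow> ('a \<Rightarrow> bool) \<Rightarrow> 'a set" where
  "site_cluster V E x \<omega> = component {v\<in>V. \<omega> v} (induced_edges E {v\<in>V. \<omega> v}) x"

definition bond_theta :: "'a set \<Rightarrow> 'a set set \<Rightarrow> 'a \<Rightarrow> real \<Rightarrow> real" where
  "bond_theta V E x p = measure (bernoulli_percolation E p)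
     {\<omega> \<in> space (bernoulli_percolation E p). infinite (bond_cluster V E x \<omega>)}"

definition site_theta :: "'a set \<Rightarrow> 'a set set \<Rightarrow> 'a \<Rightarrow> real \<Rightarrow> real" where
  "site_theta V E x p = measure (bernoulli_percolation V p)
     {\<omega> \<in> space (bernoulli_percolation V p). infinite (site_cluster V E x \<omega>)}"

definition real_analytic_on :: "(real \<Rightarrow> real) \<Rightarrow> real set \<Rightarrow> bool" where
  "real_analytic_on f I \<longleftrightarrow> (\<forall>x\<in>I. \<exists>r>0. \<exists>g.
     g holomorphic_on ball (complex_of_real x) r \<and>
     (\<forall>y\<in>I. complex_of_real y \<in> ball (complex_of_real x) r \<longrightarrow>
        g (complex_of_real y) = complex_of_real (f y)))"

text \<open>The percolation parameter ranges over the unit interval only; outside it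
  \<^const>\<open>bernoulli_pmf\<close> truncates its argument.\<close>

definition critical_parameter :: "(real \<Rightarrow> real) \<Rightarrow> real" where
  "critical_parameter \<theta> = Sup {p\<in>{0..1}. \<theta> p = 0}"

definition analyticity_threshold :: "(real \<Rightarrow> real) \<Rightarrow> real" where
  "analyticity_threshold \<theta> = Inf {p\<in>{0..1}. real_analytic_on \<theta> {p<..1}}"

definition bond_pc :: "'a set \<Rightarrow> 'a set set \<Rightarrow> 'a \<Rightarrow> real" where
  "bond_pc V E x = critical_parameter (bond_theta V E x)"

definition site_pc :: "'a set \<Rightarrow> 'a set set \<Rightarrow> 'a \<Rightarrow> real" where
  "site_pc V E x = critical_parameter (site_theta V E x)"

definition bond_p_analytic :: "'a set \<Rightarrow> 'a set set \<Rightarrow> 'a \<Rightarrow> real" where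
  "bond_p_analytic V E x = analyticity_threshold (bond_theta V E x)"

definition site_p_analytic :: "'a set \<Rightarrow> 'a set set \<Rightarrow> 'a \<Rightarrow> real" where
  "site_p_analytic V E x = analyticity_threshold (site_theta V E x)"

end

theory Submission
  imports Defs
begin

text \<open>Both models are treated as site percolation on a graph: bond percolation on \<open>G\<close> is site
percolation on its line graph. Fix \<open>p > 1 - p\<^sub>c\<close>, so that the vacant sites, which have density
\<open>1 - p\<close>, form a subcritical percolation process.

The geometric input is that a finite cluster of \<open>x\<close> is enclosed by a \<^emph>\<open>connected\<close> vacant contour. Let
\<open>S\<close> be the cluster together with the finite components of its complement; since \<open>G\<close> is one-ended, \<open>S\<close>
is finite and its complement is connected. If the edge cut around \<open>S\<close> were the disjoint union of two
nonempty parts such that no triangle meets both, then every triangle would meet each part in an even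
number of edges, hence so would every cycle, because the triangles span the cycle space. But a cycle
that crosses the cut once in either part exists (\<open>cycle_through_cut\<close>, \<open>cut_linked\<close>). The contour
crosses a fixed geodesic ray \<open>\<gamma>\<close> from \<open>x\<close>, and if it does so at \<open>\<gamma> j\<close>, then it has at least about
\<open>j / 2\<close> sites: by quasi-transitivity some vertex at bounded distance of \<open>x\<close> is the midpoint of
arbitrarily long geodesics, and the contour has to cross both halves (\<open>separator_close\<close>).

Hence whether the cluster of \<open>x\<close> is finite can be found out by revealing the vacant clusters of
\<open>\<gamma> 0\<close>, \<open>\<gamma> 1\<close>, and so on, until they separate \<open>x\<close> from infinity. The event that this happens at stage
\<open>k\<close> with revealed vacant set \<open>L\<close> and revealed occupied boundary \<open>b\<close> has probability
\<open>(1 - p) ^ card L * p ^ card b\<close>, and the sum of these polynomials over all \<open>(k, L)\<close> is \<open>1 - \<theta> p\<close>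
(\<open>prob_finite_contours\<close>). Stopping at stage \<open>k\<close> forces the vacant cluster of \<open>\<gamma> k\<close> to be of size of
order \<open>k\<close>, which has exponentially small probability, while the number of revealed sites has an
exponential moment that grows with \<open>k\<close> at an arbitrarily small rate. Replacing \<open>p\<close> by a nearby complex
number multiplies a term by at most \<open>\<rho> ^ n\<close>, where \<open>n\<close> is the number of revealed sites and \<open>\<rho>\<close> is close
to 1; so the series converges uniformly near \<open>p\<close> and its sum is holomorphic (\<open>barrier_bound\<close>,
\<open>analytic_above\<close>).

That subcritical clusters have exponential moments is sharpness of the phase transition, proved here by
the method of Duminil-Copin and Tassion. If every finite set \<open>S\<close> containing \<open>v\<close> has at least one expected
neighbour outside \<open>S\<close> of the cluster of \<open>v\<close> inside \<open>S\<close>, a differential inequality shows that at every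
larger parameter \<open>v\<close> percolates (\<open>reach_lower_bound\<close>). Otherwise each \<open>v\<close> has some \<open>S\<close> with
expectation below 1, and exploring a cluster in such blocks compares it with a subcritical branching
process (\<open>exponential_moments\<close>).

Finally \<open>p\<^sub>c \<le> 1/2\<close>: otherwise \<open>\<theta>\<close> would be analytic on \<open>(1/2, 1]\<close> and vanish on \<open>(1/2, p\<^sub>c)\<close>, hence
vanish at 1, where it equals 1 (\<open>threshold_duality\<close>).\<close>

section \<open>Bernoulli configurations on a finite set of sites\<close>

text \<open>The expectation of \<open>f\<close> when each site of the finite set \<open>R\<close> is open with probability \<open>p\<close>. All estimates
are made on finite sets, where they need no measurability; the product measure enters only through
cylinder events.\<close>

definition bexp :: "real \<Rightarrow> 'i set \<Rightarrow> ('i set \<Rightarrow> real) \<Rightarrow> real" where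
  "bexp p R f = (\<Sum>\<omega>\<in>Pow R. p ^ card \<omega> * (1 - p) ^ card (R - \<omega>) * f \<omega>)"

lemma bexp_empty [simp]: "bexp p {} f = f {}"
  by (simp add: bexp_def)

lemma bexp_cong:
  "(\<And>\<omega>. \<omega> \<subseteq> R \<Longrightarrow> f \<omega> = g \<omega>) \<Longrightarrow> bexp p R f = bexp p R g"
  unfolding bexp_def by (rule sum.cong) auto

lemma bexp_insert:
  assumes "finite R" "a \<notin> R"
  shows "bexp p (insert a R) f = p * bexp p R (\<lambda>\<omega>. f (insert a \<omega>)) + (1 - p) * bexp p R f"
proof -
  let ?w = "\<lambda>\<omega>. p ^ card \<omega> * (1 - p) ^ card (insert a R - \<omega>) * f \<omega>"
  have "bexp p (insert a R) f = sum ?w (Pow R) + sum ?w (insert a ` Pow R)"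
    unfolding bexp_def Pow_insert using assms by (intro sum.union_disjoint) auto
  moreover have "sum ?w (Pow R) = (1 - p) * bexp p R f"
    unfolding bexp_def sum_distrib_left
  proof (rule sum.cong)
    fix \<omega> assume "\<omega> \<in> Pow R"
    then have "insert a R - \<omega> = insert a (R - \<omega>)" "a \<notin> R - \<omega>" "finite (R - \<omega>)" using assms by auto
    then show "?w \<omega> = (1 - p) * (p ^ card \<omega> * (1 - p) ^ card (R - \<omega>) * f \<omega>)" by simp
  qed simp
  moreover have "sum ?w (insert a ` Pow R) = (\<Sum>\<omega>\<in>Pow R. ?w (insert a \<omega>))"
    using assms by (subst sum.reindex) (auto simp: inj_on_def)
  moreover have "(\<Sum>\<omega>\<in>Pow R. ?w (insert a \<omega>)) = p * bexp p R (\<lambda>\<omega>. f (insert a \<omega>))"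
    unfolding bexp_def sum_distrib_left
  proof (rule sum.cong)
    fix \<omega> assume "\<omega> \<in> Pow R"
    then have "insert a R - insert a \<omega> = R - \<omega>" "a \<notin> \<omega>" "finite \<omega>" using assms finite_subset by auto
    then show "?w (insert a \<omega>) = p * (p ^ card \<omega> * (1 - p) ^ card (R - \<omega>) * f (insert a \<omega>))" by simp
  qed simp
  ultimately show ?thesis by simp
qed

lemma bexp_const [simp]: "finite R \<Longrightarrow> bexp p R (\<lambda>_. c) = c"
  by (induction R rule: finite_induct) (simp_all add: bexp_insert algebra_simps)

lemma bexp_add: "bexp p R (\<lambda>\<omega>. f \<omega> + g \<omega>) = bexp p R f + bexp p R g"
  by (simp add: bexp_def distrib_left sum.distrib)

lemma bexp_diff: "bexp p R (\<lambda>\<omega>. f \<omega> - g \<omega>) = bexp p R f - bexp p R g"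
  by (simp add: bexp_def right_diff_distrib sum_subtractf)

lemma bexp_cmult: "bexp p R (\<lambda>\<omega>. c * f \<omega>) = c * bexp p R f"
  by (simp add: bexp_def sum_distrib_left mult_ac)

lemma bexp_sum: "bexp p R (\<lambda>\<omega>. \<Sum>x\<in>A. f x \<omega>) = (\<Sum>x\<in>A. bexp p R (f x))"
  unfolding bexp_def sum_distrib_left by (rule sum.swap)

lemma bexp_mono:
  assumes "0 \<le> p" "p \<le> 1" "\<And>\<omega>. \<omega> \<subseteq> R \<Longrightarrow> f \<omega> \<le> g \<omega>"
  shows "bexp p R f \<le> bexp p R g"
  unfolding bexp_def using assms by (intro sum_mono mult_left_mono) auto

lemma bexp_Un:
  assumes "finite A" "finite B" "A \<inter> B = {}"
  shows "bexp p (A \<union> B) f = bexp p A (\<lambda>\<omega>. bexp p B (\<lambda>\<eta>. f (\<omega> \<union> \<eta>)))"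
  using assms(1,3)
proof (induction A arbitrary: f rule: finite_induct)
  case (insert a A)
  have "bexp p (insert a A \<union> B) f =
      p * bexp p (A \<union> B) (\<lambda>\<omega>. f (insert a \<omega>)) + (1 - p) * bexp p (A \<union> B) f"
    using insert.prems insert.hyps assms(2) by (simp add: bexp_insert)
  also have "\<dots> = p * bexp p A (\<lambda>\<omega>. bexp p B (\<lambda>\<eta>. f (insert a (\<omega> \<union> \<eta>))))
      + (1 - p) * bexp p A (\<lambda>\<omega>. bexp p B (\<lambda>\<eta>. f (\<omega> \<union> \<eta>)))"
    using insert.prems by (simp add: insert.IH)
  finally show ?case using insert.hyps by (simp add: bexp_insert)
qed simp

text \<open>Condition on one site at a time: opening it increases the function.\<close>

lemma bexp_mono_param:
  assumes "finite R" "0 \<le> p" "p \<le> p'" "p' \<le> 1"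
    and "\<And>\<omega> \<omega>'. \<omega> \<subseteq> \<omega>' \<Longrightarrow> \<omega>' \<subseteq> R \<Longrightarrow> f \<omega> \<le> f \<omega>'"
  shows "bexp p R f \<le> bexp p' R f"
  using assms(1,5)
proof (induction R arbitrary: f rule: finite_induct)
  case (insert a R)
  let ?f = "\<lambda>\<omega>. f (insert a \<omega>)"
  have up: "bexp p R f \<le> bexp p R ?f"
    using assms by (intro bexp_mono insert.prems) auto
  have IH1: "bexp p R ?f \<le> bexp p' R ?f"
    by (rule insert.IH) (use insert.prems in \<open>auto intro!: insert.prems\<close>)
  have IH2: "bexp p R f \<le> bexp p' R f"
    by (rule insert.IH) (use insert.prems in \<open>auto intro!: insert.prems\<close>)
  have "p * bexp p R ?f + (1 - p) * bexp p R f \<le> p' * bexp p R ?f + (1 - p') * bexp p R f"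
  proof -
    have "0 \<le> (p' - p) * (bexp p R ?f - bexp p R f)" using up assms by simp
    then show ?thesis by (simp add: algebra_simps)
  qed
  also have "\<dots> \<le> p' * bexp p' R ?f + (1 - p') * bexp p' R f"
    using IH1 IH2 assms by (intro add_mono mult_left_mono) auto
  finally show ?case using insert.hyps by (simp add: bexp_insert)
qed simp

lemma bexp_mono_region:
  assumes "finite R" "S \<subseteq> R" "0 \<le> p" "p \<le> 1"
    and "\<And>\<omega> \<omega>'. \<omega> \<subseteq> \<omega>' \<Longrightarrow> \<omega>' \<subseteq> R \<Longrightarrow> f \<omega> \<le> f \<omega>'"
  shows "bexp p S f \<le> bexp p R f"
proof -
  have fin: "finite S" "finite (R - S)" using assms finite_subset by auto
  have "bexp p S f = bexp p S (\<lambda>\<omega>. bexp p (R - S) (\<lambda>\<eta>. f \<omega>))" using fin by simp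
  also have "\<dots> \<le> bexp p S (\<lambda>\<omega>. bexp p (R - S) (\<lambda>\<eta>. f (\<omega> \<union> \<eta>)))"
    using assms by (intro bexp_mono assms(5)) auto
  also have "\<dots> = bexp p (S \<union> (R - S)) f" by (rule bexp_Un[symmetric]) (use fin in auto)
  finally show ?thesis using assms(2) by (simp add: Un_absorb1)
qed

lemma bexp_restrict:
  assumes "finite R"
  shows "bexp p R (\<lambda>\<omega>. f (\<omega> \<inter> S)) = bexp p (R \<inter> S) f"
proof -
  have "bexp p ((R \<inter> S) \<union> (R - S)) (\<lambda>\<omega>. f (\<omega> \<inter> S)) =
      bexp p (R \<inter> S) (\<lambda>\<omega>. bexp p (R - S) (\<lambda>\<eta>. f ((\<omega> \<union> \<eta>) \<inter> S)))"
    by (rule bexp_Un) (use assms in auto)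
  also have "\<dots> = bexp p (R \<inter> S) (\<lambda>\<omega>. bexp p (R - S) (\<lambda>\<eta>. f \<omega>))"
  proof (intro bexp_cong)
    fix \<omega> \<eta> assume "\<omega> \<subseteq> R \<inter> S" "\<eta> \<subseteq> R - S"
    then have "(\<omega> \<union> \<eta>) \<inter> S = \<omega>" by auto
    then show "f ((\<omega> \<union> \<eta>) \<inter> S) = f \<omega>" by simp
  qed
  finally show ?thesis using assms by (simp add: Int_Diff_Un)
qed

lemma bexp_cylinder:
  assumes "finite R" "A \<subseteq> R" "B \<subseteq> R" "A \<inter> B = {}"
  shows "bexp p R (\<lambda>\<omega>. of_bool (A \<subseteq> \<omega> \<and> B \<inter> \<omega> = {})) = p ^ card A * (1 - p) ^ card B"
  using assms
proof (induction R arbitrary: A B rule: finite_induct)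
  case (insert a R)
  consider "a \<in> A" | "a \<in> B" | "a \<notin> A" "a \<notin> B" by auto
  then show ?case
  proof cases
    case 1
    then have nB: "a \<notin> B" using insert.prems by auto
    have fA: "finite A" using insert.prems insert.hyps finite_subset by blast
    have "bexp p R (\<lambda>\<omega>. of_bool (A \<subseteq> insert a \<omega> \<and> B \<inter> insert a \<omega> = {}))
        = bexp p R (\<lambda>\<omega>. of_bool (A - {a} \<subseteq> \<omega> \<and> B \<inter> \<omega> = {}))"
      by (intro bexp_cong arg_cong[of _ _ of_bool]) (use 1 nB in auto)
    also have "\<dots> = p ^ card (A - {a}) * (1 - p) ^ card B"
      by (rule insert.IH) (use insert.prems 1 nB in auto)
    finally have 2: "bexp p R (\<lambda>\<omega>. of_bool (A \<subseteq> insert a \<omega> \<and> B \<inter> insert a \<omega> = {})) =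
      p ^ card (A - {a}) * (1 - p) ^ card B" .
    have "bexp p R (\<lambda>\<omega>. of_bool (A \<subseteq> \<omega> \<and> B \<inter> \<omega> = {})) = bexp p R (\<lambda>\<omega>. 0)"
      by (intro bexp_cong) (use 1 insert.hyps in auto)
    then show ?thesis using 2 1 fA insert.hyps card_Suc_Diff1[OF fA 1]
      by (simp add: bexp_insert flip: power_Suc mult.assoc)
  next
    case 2
    then have nA: "a \<notin> A" using insert.prems by auto
    have fB: "finite B" using insert.prems insert.hyps finite_subset by blast
    have "bexp p R (\<lambda>\<omega>. of_bool (A \<subseteq> \<omega> \<and> B \<inter> \<omega> = {}))
        = bexp p R (\<lambda>\<omega>. of_bool (A \<subseteq> \<omega> \<and> (B - {a}) \<inter> \<omega> = {}))"
      by (intro bexp_cong arg_cong[of _ _ of_bool]) (use 2 nA insert.hyps in auto)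
    also have "\<dots> = p ^ card A * (1 - p) ^ card (B - {a})"
      by (rule insert.IH) (use insert.prems 2 nA in auto)
    finally have 3: "bexp p R (\<lambda>\<omega>. of_bool (A \<subseteq> \<omega> \<and> B \<inter> \<omega> = {})) =
      p ^ card A * (1 - p) ^ card (B - {a})" .
    have "bexp p R (\<lambda>\<omega>. of_bool (A \<subseteq> insert a \<omega> \<and> B \<inter> insert a \<omega> = {})) = bexp p R (\<lambda>\<omega>. 0)"
      by (intro bexp_cong) (use 2 insert.hyps in auto)
    then show ?thesis using 2 3 fB insert.hyps card_Suc_Diff1[OF fB 2]
      by (simp add: bexp_insert mult.left_commute flip: power_Suc)
  next
    case 3
    have "bexp p R (\<lambda>\<omega>. of_bool (A \<subseteq> insert a \<omega> \<and> B \<inter> insert a \<omega> = {}))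
        = bexp p R (\<lambda>\<omega>. of_bool (A \<subseteq> \<omega> \<and> B \<inter> \<omega> = {}))"
      by (intro bexp_cong arg_cong[of _ _ of_bool]) (use 3 in auto)
    moreover have "bexp p R (\<lambda>\<omega>. of_bool (A \<subseteq> \<omega> \<and> B \<inter> \<omega> = {})) = p ^ card A * (1 - p) ^ card B"
      by (rule insert.IH) (use insert.prems 3 in auto)
    ultimately show ?thesis using insert.hyps by (simp add: bexp_insert algebra_simps)
  qed
qed simp

text \<open>The strong Markov property. A set \<open>D \<omega>\<close> that is determined by the configuration inside it can be revealed
by an exploration, after which the other sites are still independent and can be resampled. Swapping the
configuration outside \<open>D \<omega>\<close> with the resampled one is a weight-preserving involution on the pairs, which
proves the identity without any conditioning.\<close>

lemma bexp_stopping_set: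
  fixes R :: "'i set" and D :: "'i set \<Rightarrow> 'i set"
  assumes "finite R" and sub: "\<And>\<omega>. \<omega> \<subseteq> R \<Longrightarrow> D \<omega> \<subseteq> R"
    and stop: "\<And>\<omega> \<omega>'. \<omega> \<subseteq> R \<Longrightarrow> \<omega>' \<subseteq> R \<Longrightarrow> \<omega> \<inter> D \<omega> = \<omega>' \<inter> D \<omega> \<Longrightarrow> D \<omega>' = D \<omega>"
  shows "bexp p R f = bexp p R (\<lambda>\<omega>. bexp p (R - D \<omega>) (\<lambda>\<eta>. f (\<omega> \<inter> D \<omega> \<union> \<eta>)))"
proof -
  define w where "w S \<omega> = p ^ card \<omega> * (1 - p) ^ card (S - \<omega>)" for S \<omega> :: "'i set"
  define X where "X = (SIGMA \<omega>:Pow R. Pow (R - D \<omega>))"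
  \<comment> \<open>The involution that exchanges the configuration outside \<open>D \<omega>\<close> with the resampled one.\<close>
  define s where "s = (\<lambda>(\<omega>, \<eta>). (\<omega> \<inter> D \<omega> \<union> \<eta>, \<omega> - D \<omega>))"
  have D: "D (\<omega> \<inter> D \<omega> \<union> \<eta>) = D \<omega>" if "\<omega> \<subseteq> R" "\<eta> \<subseteq> R - D \<omega>" for \<omega> \<eta>
    by (rule stop) (use that in auto)
  have sX: "s x \<in> X" and ss: "s (s x) = x" if "x \<in> X" for x
    using that D unfolding X_def s_def by (auto simp: D)
  have fin: "finite T" if "T \<subseteq> R" for T using that assms(1) finite_subset by blast
  have split: "w R \<omega> = w (D \<omega>) (\<omega> \<inter> D \<omega>) * w (R - D \<omega>) (\<omega> - D \<omega>)" if "\<omega> \<subseteq> R" for \<omega>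
  proof -
    have "card \<omega> = card (\<omega> \<inter> D \<omega>) + card (\<omega> - D \<omega>)"
      using fin[OF that] by (subst card_Un_disjoint[symmetric]) (auto intro: arg_cong[of _ _ card])
    moreover have "card (R - \<omega>) = card (D \<omega> - \<omega> \<inter> D \<omega>) + card ((R - D \<omega>) - (\<omega> - D \<omega>))"
      using sub[OF that] fin by (subst card_Un_disjoint[symmetric]) (auto intro!: arg_cong[of _ _ card])
    ultimately show ?thesis by (simp add: w_def power_add)
  qed
  have wt: "w R (fst (s x)) * w (R - D (fst (s x))) (snd (s x)) = w R (fst x) * w (R - D (fst x)) (snd x)"
    if "x \<in> X" for x
  proof -
    obtain \<omega> \<eta> where x: "x = (\<omega>, \<eta>)" by (cases x)
    have o: "\<omega> \<subseteq> R" and e: "\<eta> \<subseteq> R - D \<omega>" using that by (auto simp: x X_def)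
    have o': "\<omega> \<inter> D \<omega> \<union> \<eta> \<subseteq> R" using o e by auto
    have "(\<omega> \<inter> D \<omega> \<union> \<eta>) \<inter> D \<omega> = \<omega> \<inter> D \<omega>" "(\<omega> \<inter> D \<omega> \<union> \<eta>) - D \<omega> = \<eta>" using e by auto
    then show ?thesis using split[OF o] split[OF o'] D[OF o e] by (simp add: x s_def)
  qed
  have finX: "finite X" unfolding X_def using assms(1) by auto
  have "bexp p R (\<lambda>\<omega>. bexp p (R - D \<omega>) (\<lambda>\<eta>. f (\<omega> \<inter> D \<omega> \<union> \<eta>))) =
      (\<Sum>\<omega>\<in>Pow R. \<Sum>\<eta>\<in>Pow (R - D \<omega>). w R \<omega> * w (R - D \<omega>) \<eta> * f (\<omega> \<inter> D \<omega> \<union> \<eta>))"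
    unfolding bexp_def w_def sum_distrib_left by (simp add: mult_ac)
  also have "\<dots> = (\<Sum>x\<in>X. w R (fst x) * w (R - D (fst x)) (snd x) * f (fst (s x)))"
    unfolding X_def by (subst sum.Sigma) (use assms(1) in \<open>auto simp: s_def intro!: sum.cong\<close>)
  also have "\<dots> = (\<Sum>x\<in>X. w R (fst (s x)) * w (R - D (fst (s x))) (snd (s x)) * f (fst (s x)))"
    by (rule sum.cong) (auto simp: wt)
  also have "\<dots> = (\<Sum>x\<in>X. w R (fst x) * w (R - D (fst x)) (snd x) * f (fst x))"
    by (rule sum.reindex_bij_witness[where i = s and j = s]) (auto simp: sX ss)
  also have "\<dots> = (\<Sum>\<omega>\<in>Pow R. \<Sum>\<eta>\<in>Pow (R - D \<omega>). w R \<omega> * w (R - D \<omega>) \<eta> * f \<omega>)"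
    unfolding X_def by (subst sum.Sigma) (use assms(1) in \<open>auto intro!: sum.cong\<close>)
  also have "\<dots> = bexp p R (\<lambda>\<omega>. bexp p (R - D \<omega>) (\<lambda>\<eta>. f \<omega>))"
    unfolding bexp_def w_def sum_distrib_left by (simp add: mult_ac)
  also have "\<dots> = bexp p R f"
    using assms(1) by (intro bexp_cong) simp
  finally show ?thesis by simp
qed

text \<open>Russo's formula.\<close>

lemma bexp_has_derivative:
  assumes "finite R"
  shows "((\<lambda>p. bexp p R f) has_real_derivative
           (\<Sum>a\<in>R. bexp p R (\<lambda>\<omega>. f (insert a \<omega>) - f (\<omega> - {a})))) (at p)"
  using assms
proof (induction R arbitrary: f rule: finite_induct)
  case (insert a R)
  let ?d = "\<lambda>R f. \<Sum>b\<in>R. bexp p R (\<lambda>\<omega>. f (insert b \<omega>) - f (\<omega> - {b}))"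
  have "((\<lambda>p. p * bexp p R (\<lambda>\<omega>. f (insert a \<omega>)) + (1 - p) * bexp p R f) has_real_derivative
      bexp p R (\<lambda>\<omega>. f (insert a \<omega>)) - bexp p R f
      + (p * ?d R (\<lambda>\<omega>. f (insert a \<omega>)) + (1 - p) * ?d R f)) (at p)"
    by (rule derivative_eq_intros refl insert.IH)+ simp
  moreover have "?d (insert a R) f = bexp p R (\<lambda>\<omega>. f (insert a \<omega>)) - bexp p R f
      + (p * ?d R (\<lambda>\<omega>. f (insert a \<omega>)) + (1 - p) * ?d R f)"
  proof -
    have 1: "bexp p (insert a R) (\<lambda>\<omega>. f (insert a \<omega>) - f (\<omega> - {a})) =
        bexp p R (\<lambda>\<omega>. f (insert a \<omega>)) - bexp p R f"
    proof -
      have *: "bexp p R (\<lambda>\<omega>. f (\<omega> - {a})) = bexp p R f"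
        "bexp p R (\<lambda>\<omega>. f (insert a \<omega> - {a})) = bexp p R f"
        using insert.hyps by (auto intro!: bexp_cong arg_cong[of _ _ f])
      show ?thesis using insert.hyps
        by (simp add: bexp_insert bexp_diff * del: insert_Diff_single) (simp add: algebra_simps)
    qed
    have 2: "bexp p (insert a R) (\<lambda>\<omega>. f (insert b \<omega>) - f (\<omega> - {b})) =
        p * bexp p R (\<lambda>\<omega>. f (insert a (insert b \<omega>)) - f (insert a (\<omega> - {b}))) +
        (1 - p) * bexp p R (\<lambda>\<omega>. f (insert b \<omega>) - f (\<omega> - {b}))" if "b \<in> R" for b
    proof -
      have "a \<noteq> b" using that insert.hyps by auto
      then have "bexp p R (\<lambda>\<omega>. f (insert b (insert a \<omega>)) - f (insert a \<omega> - {b})) =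
        bexp p R (\<lambda>\<omega>. f (insert a (insert b \<omega>)) - f (insert a (\<omega> - {b})))"
        by (simp add: insert_commute insert_Diff_if)
      then show ?thesis using insert.hyps by (simp add: bexp_insert)
    qed
    show ?thesis using insert.hyps by (simp add: 1 2 sum.distrib sum_distrib_left)
  qed
  ultimately show ?case using insert.hyps by (simp add: bexp_insert)
qed simp

section \<open>Clusters and their exploration\<close>

text \<open>The union of the open clusters of the sources \<open>Y\<close> when \<open>\<omega>\<close> is the set of open sites. A source that is
not open contributes nothing.\<close>

definition cl :: "'i rel \<Rightarrow> 'i set \<Rightarrow> 'i set \<Rightarrow> 'i set" where
  "cl r Y \<omega> = (r \<inter> \<omega> \<times> \<omega>)\<^sup>* `` (Y \<inter> \<omega>)"

text \<open>The sites that are seen to be closed when the cluster \<open>L\<close> of the sources \<open>Y\<close> has been explored: closed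
sources as well as closed neighbours.\<close>

definition bd :: "'i rel \<Rightarrow> 'i set \<Rightarrow> 'i set \<Rightarrow> 'i set" where
  "bd r Y L = (Y \<union> r `` L) - L"

lemma cl_source: "y \<in> Y \<Longrightarrow> y \<in> \<omega> \<Longrightarrow> y \<in> cl r Y \<omega>"
  unfolding cl_def by blast

lemma cl_induct [consumes 1, case_names source step]:
  assumes "z \<in> cl r Y \<omega>"
    and "\<And>y. y \<in> Y \<Longrightarrow> y \<in> \<omega> \<Longrightarrow> Q y"
    and "\<And>z w. z \<in> cl r Y \<omega> \<Longrightarrow> Q z \<Longrightarrow> (z, w) \<in> r \<Longrightarrow> w \<in> \<omega> \<Longrightarrow> Q w"
  shows "Q z"
proof -
  obtain y where y: "y \<in> Y" "y \<in> \<omega>" "(y, z) \<in> (r \<inter> \<omega> \<times> \<omega>)\<^sup>*" using assms(1) by (auto simp: cl_def)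
  from y(3) show ?thesis
  proof (induction rule: rtrancl_induct)
    case (step u w)
    have "u \<in> cl r Y \<omega>" using step(1) y by (auto simp: cl_def)
    then show ?case using step assms(3) by blast
  qed (use y assms(2) in auto)
qed

lemma cl_subset: "cl r Y \<omega> \<subseteq> \<omega>"
proof
  fix z assume "z \<in> cl r Y \<omega>" then show "z \<in> \<omega>" by (induction rule: cl_induct) auto
qed

lemma cl_step: "z \<in> cl r Y \<omega> \<Longrightarrow> (z, w) \<in> r \<Longrightarrow> w \<in> \<omega> \<Longrightarrow> w \<in> cl r Y \<omega>"
  using cl_subset[of r Y \<omega>] unfolding cl_def by (auto intro: rtrancl_into_rtrancl)

lemma cl_least:
  assumes "Y \<inter> \<omega> \<subseteq> L" "\<And>z w. z \<in> L \<Longrightarrow> (z, w) \<in> r \<Longrightarrow> w \<in> \<omega> \<Longrightarrow> w \<in> L"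
  shows "cl r Y \<omega> \<subseteq> L"
proof
  fix z assume "z \<in> cl r Y \<omega>" then show "z \<in> L" by (induction rule: cl_induct) (use assms in auto)
qed

lemma cl_mono: "Y \<subseteq> Y' \<Longrightarrow> \<omega> \<subseteq> \<omega>' \<Longrightarrow> cl r Y \<omega> \<subseteq> cl r Y' \<omega>'"
proof
  fix z assume "Y \<subseteq> Y'" "\<omega> \<subseteq> \<omega>'" "z \<in> cl r Y \<omega>"
  from this(3,1,2) show "z \<in> cl r Y' \<omega>'"
    by (induction rule: cl_induct) (auto intro: cl_source cl_step)
qed

lemma cl_trans:
  assumes "\<And>y. y \<in> Y' \<Longrightarrow> y \<in> \<omega>' \<Longrightarrow> y \<in> cl r Y \<omega>" "\<omega>' \<subseteq> \<omega>"
  shows "cl r Y' \<omega>' \<subseteq> cl r Y \<omega>"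
  by (rule cl_least) (use assms in \<open>auto intro: cl_step\<close>)

lemma cl_Un: "cl r (Y \<union> Y') \<omega> = cl r Y \<omega> \<union> cl r Y' \<omega>"
  by (auto simp: cl_def)

lemma cl_cl: "cl r Y (cl r Y \<omega>) = cl r Y \<omega>"
proof
  show "cl r Y \<omega> \<subseteq> cl r Y (cl r Y \<omega>)"
  proof
    fix z assume "z \<in> cl r Y \<omega>" then show "z \<in> cl r Y (cl r Y \<omega>)"
      by (induction rule: cl_induct) (auto intro: cl_source cl_step)
  qed
qed (rule cl_subset)

lemma bd_cl: "bd r Y (cl r Y \<omega>) \<inter> \<omega> = {}"
  by (auto simp: bd_def intro: cl_source cl_step)

lemma cl_eqI:
  assumes "cl r Y L = L" "L \<subseteq> \<omega>" "bd r Y L \<inter> \<omega> = {}"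
  shows "cl r Y \<omega> = L"
proof
  show "cl r Y \<omega> \<subseteq> L" by (rule cl_least) (use assms(3) in \<open>auto simp: bd_def\<close>)
  show "L \<subseteq> cl r Y \<omega>" using cl_mono[of Y Y L \<omega> r] assms by auto
qed

text \<open>The event that the cluster is \<open>L\<close> is a cylinder event: \<open>L\<close> is open and its boundary is closed.\<close>

lemma cl_eq_iff:
  "cl r Y \<omega> = L \<longleftrightarrow> cl r Y L = L \<and> L \<subseteq> \<omega> \<and> bd r Y L \<inter> \<omega> = {}"
  using cl_eqI[of r Y L \<omega>] cl_cl[of r Y \<omega>] cl_subset[of r Y \<omega>] bd_cl[of r Y \<omega>] by auto

lemma cl_sym:
  assumes "sym r" "x \<in> cl r {y} \<omega>" shows "y \<in> cl r {x} \<omega>"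
  using assms(2)
proof (induction rule: cl_induct)
  case (step z w)
  have "z \<in> cl r {w} \<omega>"
    using step assms(1) cl_subset[of r "{y}" \<omega>] by (auto intro: cl_step[of w] cl_source dest: symD)
  then have "cl r {z} \<omega> \<subseteq> cl r {w} \<omega>" by (intro cl_trans) auto
  then show ?case using step by auto
qed (auto intro: cl_source)

lemma cl_UN: "cl r Y \<omega> = (\<Union>y\<in>Y. cl r {y} \<omega>)"
  by (auto simp: cl_def)

lemma cl_sym_iff:
  assumes "sym r" shows "x \<in> cl r X \<omega> \<longleftrightarrow> cl r {x} \<omega> \<inter> X \<noteq> {}"
  using cl_sym[OF assms] by (subst cl_UN) blast

text \<open>The sites whose state is revealed when the cluster of \<open>Y\<close> inside \<open>S\<close> is explored.\<close>

definition explored :: "'i rel \<Rightarrow> 'i set \<Rightarrow> 'i set \<Rightarrow> 'i set \<Rightarrow> 'i set" where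
  "explored r Y S \<omega> = S \<inter> (Y \<union> cl r Y (\<omega> \<inter> S) \<union> r `` cl r Y (\<omega> \<inter> S))"

lemma explored_Int: "\<omega> \<inter> explored r Y S \<omega> = cl r Y (\<omega> \<inter> S)"
  using cl_subset[of r Y "\<omega> \<inter> S"] cl_source[of _ Y "\<omega> \<inter> S" r] cl_step[of _ r Y "\<omega> \<inter> S"]
  unfolding explored_def by blast

lemma cl_explored:
  assumes "\<omega> \<inter> explored r Y S \<omega> = \<omega>' \<inter> explored r Y S \<omega>"
  shows "cl r Y (\<omega>' \<inter> S) = cl r Y (\<omega> \<inter> S)"
proof (rule cl_eqI)
  show "cl r Y (cl r Y (\<omega> \<inter> S)) = cl r Y (\<omega> \<inter> S)" by (rule cl_cl)
  show "cl r Y (\<omega> \<inter> S) \<subseteq> \<omega>' \<inter> S"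
    using assms explored_Int[of \<omega> r Y S] cl_subset[of r Y "\<omega> \<inter> S"] by auto
  show "bd r Y (cl r Y (\<omega> \<inter> S)) \<inter> (\<omega>' \<inter> S) = {}"
    using assms bd_cl[of r Y "\<omega> \<inter> S"] unfolding explored_def bd_def by blast
qed

lemma bexp_explore:
  assumes "finite R" "S \<subseteq> R"
  shows "bexp p R f = bexp p R (\<lambda>\<omega>. bexp p (R - explored r Y S \<omega>) (\<lambda>\<eta>. f (cl r Y (\<omega> \<inter> S) \<union> \<eta>)))"
proof -
  have "bexp p R f = bexp p R (\<lambda>\<omega>. bexp p (R - explored r Y S \<omega>) (\<lambda>\<eta>. f (\<omega> \<inter> explored r Y S \<omega> \<union> \<eta>)))"
  proof (rule bexp_stopping_set)
    fix \<omega> \<omega>' assume "\<omega> \<inter> explored r Y S \<omega> = \<omega>' \<inter> explored r Y S \<omega>"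
    from cl_explored[OF this] show "explored r Y S \<omega>' = explored r Y S \<omega>" by (simp add: explored_def)
  qed (use assms in \<open>auto simp: explored_def\<close>)
  then show ?thesis by (simp add: explored_Int)
qed

section \<open>A differential inequality for the probability of reaching the boundary\<close>

text \<open>A cluster contained in \<open>R\<close> that contains none of these sites is a complete cluster of the whole graph.\<close>

definition exits :: "'i rel \<Rightarrow> 'i set \<Rightarrow> 'i set" where
  "exits r R = {z \<in> R. \<not> r `` {z} \<subseteq> R}"

text \<open>The quantity whose comparison with 1 decides between the two phases: the expected number of neighbours
outside \<open>S\<close> of the cluster of \<open>x\<close> inside \<open>S\<close>. In the branching comparison these neighbours are the children
of \<open>x\<close>.\<close>

definition offspring :: "'i rel \<Rightarrow> real \<Rightarrow> 'i set \<Rightarrow> 'i \<Rightarrow> real" where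
  "offspring r p S x = bexp p S (\<lambda>\<omega>. real (card (r `` cl r {x} \<omega> - S)))"

definition reach :: "'i rel \<Rightarrow> 'i set \<Rightarrow> 'i \<Rightarrow> 'i set \<Rightarrow> real" where
  "reach r R x \<omega> = of_bool (x \<in> cl r (exits r R) \<omega>)"

text \<open>Whether a site is pivotal does not depend on its own state, so counting only the closed pivotal sites
multiplies the expected number by \<open>1 - p\<close>.\<close>

lemma bexp_closed_pivotal:
  assumes "finite R" "a \<in> R"
  shows "bexp p R (\<lambda>\<omega>. of_bool (a \<notin> \<omega>) * (f (insert a \<omega>) - f \<omega>)) =
    (1 - p) * bexp p R (\<lambda>\<omega>. f (insert a \<omega>) - f (\<omega> - {a}))"
proof -
  define S where "S = R - {a}"
  have S: "finite S" "a \<notin> S" "R = insert a S" using assms by (auto simp: S_def)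
  have "bexp p S (\<lambda>\<omega>. f (insert a \<omega> - {a})) = bexp p S f" "bexp p S (\<lambda>\<omega>. f (\<omega> - {a})) = bexp p S f"
    "bexp p S (\<lambda>\<omega>. of_bool (a \<notin> \<omega>) * (f (insert a \<omega>) - f \<omega>)) = bexp p S (\<lambda>\<omega>. f (insert a \<omega>) - f \<omega>)"
    using S by (auto intro!: bexp_cong arg_cong[of _ _ f])
  then show ?thesis using S by (simp add: bexp_insert bexp_diff del: insert_Diff_single) (simp add: algebra_simps)
qed

lemma reach_mono: "\<omega> \<subseteq> \<omega>' \<Longrightarrow> reach r R x \<omega> \<le> reach r R x \<omega>'"
  using cl_mono[of "exits r R" "exits r R" \<omega> \<omega>' r] by (auto simp: reach_def)

text \<open>Explore from outside everything that is joined to the exits, giving an open set \<open>L\<close> and a revealed set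
\<open>D\<close>. If \<open>x\<close> is itself revealed and closed, it is pivotal. If \<open>x\<close> is not revealed, every neighbour outside
\<open>R - D\<close> of its cluster inside \<open>R - D\<close> is a revealed closed site next to \<open>L\<close> (or an exit), so it is pivotal;
the expected number of such sites is \<open>offspring r p (R - D) x\<close>, which is at least 1.\<close>

lemma pivotal_expectation:
  assumes fin: "finite R" and "sym r" and x: "x \<in> R" and p: "0 \<le> p" "p \<le> 1"
    and ge: "\<And>S. S \<subseteq> R \<Longrightarrow> x \<in> S \<Longrightarrow> 1 \<le> offspring r p S x"
  shows "1 - bexp p R (reach r R x) \<le>
    (1 - p) * (\<Sum>a\<in>R. bexp p R (\<lambda>\<omega>. reach r R x (insert a \<omega>) - reach r R x (\<omega> - {a})))"
proof -
  define X where "X = exits r R"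
  have XR: "X \<subseteq> R" by (auto simp: X_def exits_def)
  define g where "g = reach r R x"
  have g: "g \<omega> = of_bool (x \<in> cl r X \<omega>)" for \<omega> by (simp add: g_def reach_def X_def)
  define N where "N = (\<lambda>\<omega>. \<Sum>a\<in>R. of_bool (a \<notin> \<omega>) * (g (insert a \<omega>) - g \<omega>))"
  have N_ge: "N \<omega> \<ge> real (card A)"
    if A: "A \<subseteq> R - \<omega>" "\<And>a. a \<in> A \<Longrightarrow> x \<in> cl r X (insert a \<omega>)" and x: "A = {} \<or> x \<notin> cl r X \<omega>" for A \<omega>
  proof -
    have "real (card A) = (\<Sum>a\<in>A. of_bool (a \<notin> \<omega>) * (g (insert a \<omega>) - g \<omega>))"
      using A x by (cases "A = {}") (auto simp: g subset_eq)
    also have "\<dots> \<le> N \<omega>" unfolding N_def g_def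
      using A(1) fin reach_mono[of _ "insert _ _" r R x] by (intro sum_mono2) auto
    finally show ?thesis .
  qed
  have "1 - bexp p R g = bexp p R (\<lambda>\<omega>. 1 - g \<omega>)" using fin by (simp add: bexp_diff)
  also have "\<dots> \<le> bexp p R (\<lambda>\<omega>. bexp p (R - explored r X R \<omega>) (\<lambda>\<eta>. N (cl r X (\<omega> \<inter> R) \<union> \<eta>)))"
  proof (intro bexp_mono p)
    fix \<omega> assume "\<omega> \<subseteq> R"
    then have oR: "\<omega> \<inter> R = \<omega>" by auto
    define L where "L = cl r X \<omega>"
    define D where "D = explored r X R \<omega>"
    have D: "D = R \<inter> (X \<union> L \<union> r `` L)" by (simp add: D_def explored_def oR L_def)
    have LR: "L \<subseteq> R" using cl_subset[of r X \<omega>] \<open>\<omega> \<subseteq> R\<close> by (auto simp: L_def)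
    have clL: "cl r X L = L" by (simp add: L_def cl_cl)
    have fD: "finite (R - D)" using fin by auto
    have cl': "cl r X (L \<union> \<eta>) = L" if "\<eta> \<subseteq> R - D" for \<eta>
      by (rule cl_eqI[OF clL]) (use that D in \<open>auto simp: bd_def\<close>)
    have near: "a \<in> cl r X (insert a (L \<union> \<eta>))" if a: "a \<in> D - L" for a \<eta>
    proof (cases "a \<in> X")
      case True then show ?thesis by (auto intro: cl_source)
    next
      case False
      then obtain t where t: "t \<in> L" "(t, a) \<in> r" using a by (auto simp: D)
      have "t \<in> cl r X (insert a (L \<union> \<eta>))" using t(1) cl_mono[of X X L "insert a (L \<union> \<eta>)" r] clL by auto
      then show ?thesis using t(2) by (rule cl_step) simp
    qed
    have "1 - g \<omega> \<le> bexp p (R - D) (\<lambda>\<eta>. N (L \<union> \<eta>))"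
    proof -
      consider "x \<in> L" | "x \<in> D - L" | "x \<in> R - D" using x by (auto simp: D)
      then show ?thesis
      proof cases
        case 1
        have "0 = bexp p (R - D) (\<lambda>\<eta>. 0)" using fD by simp
        also have "\<dots> \<le> bexp p (R - D) (\<lambda>\<eta>. N (L \<union> \<eta>))" using N_ge[of "{}"] by (intro bexp_mono p) auto
        finally show ?thesis using 1 by (simp add: g L_def)
      next
        case 2
        have "1 = bexp p (R - D) (\<lambda>\<eta>. 1)" using fD by simp
        also have "\<dots> \<le> bexp p (R - D) (\<lambda>\<eta>. N (L \<union> \<eta>))"
        proof (intro bexp_mono p)
          fix \<eta> assume e: "\<eta> \<subseteq> R - D"
          have "real (card {x}) \<le> N (L \<union> \<eta>)"
            by (rule N_ge) (use e 2 x near cl'[OF e] in auto)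
          then show "1 \<le> N (L \<union> \<eta>)" by simp
        qed
        finally show ?thesis by (simp add: g)
      next
        case 3
        have "1 \<le> offspring r p (R - D) x" using 3 by (intro ge) auto
        also have "\<dots> \<le> bexp p (R - D) (\<lambda>\<eta>. N (L \<union> \<eta>))" unfolding offspring_def
        proof (intro bexp_mono p N_ge)
          fix \<eta> assume e: "\<eta> \<subseteq> R - D"
          define C where "C = cl r {x} \<eta>"
          have C: "C \<subseteq> \<eta>" by (simp add: C_def cl_subset)
          have *: "a \<in> D - L" if a: "a \<in> r `` C - (R - D)" for a
          proof -
            obtain c where c: "c \<in> C" "(c, a) \<in> r" using a by auto
            have "c \<in> R - D" using c C e by auto
            then have "c \<notin> X" "c \<in> R" using XR by (auto simp: D)
            then have "a \<in> R" using c by (auto simp: X_def exits_def)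
            moreover have "a \<notin> L"
            proof
              assume "a \<in> L"
              then have "c \<in> r `` L" using c(2) \<open>sym r\<close> by (auto dest: symD)
              then show False using \<open>c \<in> R - D\<close> by (auto simp: D)
            qed
            ultimately show ?thesis using a by auto
          qed
          show "r `` cl r {x} \<eta> - (R - D) \<subseteq> R - (L \<union> \<eta>)"
            using * e D by (fold C_def) auto
          show "x \<in> cl r X (insert a (L \<union> \<eta>))" if a: "a \<in> r `` cl r {x} \<eta> - (R - D)" for a
          proof -
            obtain c where c: "c \<in> C" "(c, a) \<in> r" using a by (auto simp: C_def)
            have "a \<in> cl r X (insert a (L \<union> \<eta>))" using near * a by (auto simp: C_def)
            then have "c \<in> cl r X (insert a (L \<union> \<eta>))"
              by (rule cl_step) (use c C \<open>sym r\<close> in \<open>auto dest: symD\<close>)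
            then have "cl r {c} \<eta> \<subseteq> cl r X (insert a (L \<union> \<eta>))" by (intro cl_trans) auto
            moreover have "x \<in> cl r {c} \<eta>" using cl_sym[OF \<open>sym r\<close>] c(1) by (auto simp: C_def)
            ultimately show ?thesis by auto
          qed
          show "r `` cl r {x} \<eta> - (R - D) = {} \<or> x \<notin> cl r X (L \<union> \<eta>)"
            using 3 by (simp add: cl'[OF e]) (auto simp: D)
        qed
        finally show ?thesis by (simp add: g)
      qed
    qed
    then show "1 - g \<omega> \<le> bexp p (R - explored r X R \<omega>) (\<lambda>\<eta>. N (cl r X (\<omega> \<inter> R) \<union> \<eta>))"
      by (simp add: oR L_def D_def)
  qed
  also have "\<dots> = bexp p R N" by (rule bexp_explore[symmetric]) (use fin in auto)
  also have "\<dots> = (1 - p) * (\<Sum>a\<in>R. bexp p R (\<lambda>\<omega>. g (insert a \<omega>) - g (\<omega> - {a})))"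
    unfolding N_def bexp_sum sum_distrib_left by (intro sum.cong refl bexp_closed_pivotal fin)
  finally show ?thesis by (simp add: g_def)
qed

lemma offspring_mono:
  assumes "finite S" "\<And>i. i \<in> S \<Longrightarrow> finite (r `` {i})" "0 \<le> p" "p \<le> p'" "p' \<le> 1"
  shows "offspring r p S x \<le> offspring r p' S x"
  unfolding offspring_def
proof (intro bexp_mono_param assms)
  fix \<omega> \<omega>' assume o: "\<omega> \<subseteq> \<omega>'" "\<omega>' \<subseteq> S"
  have "finite (r `` cl r {x} \<omega>')"
    using assms(1,2) o cl_subset[of r "{x}" \<omega>'] finite_subset[of "cl r {x} \<omega>'" S]
    by (subst Image_eq_UN) auto
  then show "real (card (r `` cl r {x} \<omega> - S)) \<le> real (card (r `` cl r {x} \<omega>' - S))"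
    using cl_mono[OF order_refl o(1), of r "{x}"] by (auto intro!: card_mono)
qed

text \<open>By Russo's formula the previous estimate says that the probability \<open>f\<close> of reaching the exits satisfies
\<open>f' \<ge> 1 - f\<close>, so \<open>(1 - f q) * exp q\<close> is decreasing in \<open>q\<close>. The bound does not depend on \<open>R\<close>.\<close>

lemma reach_lower_bound:
  assumes fin: "finite R" and "sym r" and x: "x \<in> R" and lf: "\<And>i. i \<in> R \<Longrightarrow> finite (r `` {i})"
    and p: "0 \<le> p" "p \<le> p'" "p' \<le> 1"
    and ge: "\<And>S. S \<subseteq> R \<Longrightarrow> x \<in> S \<Longrightarrow> 1 \<le> offspring r p S x"
  shows "1 - exp (p - p') \<le> bexp p' R (reach r R x)"
proof -
  define f where "f q = bexp q R (reach r R x)" for q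
  define f' where "f' q = (\<Sum>a\<in>R. bexp q R (\<lambda>\<omega>. reach r R x (insert a \<omega>) - reach r R x (\<omega> - {a})))" for q
  have der: "(f has_real_derivative f' q) (at q)" for q
    unfolding f_def f'_def by (rule bexp_has_derivative[OF fin])
  have ineq: "1 - f q \<le> f' q" if q: "p \<le> q" "q \<le> p'" for q
  proof -
    have "1 - f q \<le> (1 - q) * f' q" unfolding f_def f'_def
    proof (rule pivotal_expectation[OF fin \<open>sym r\<close> x])
      fix S assume S: "S \<subseteq> R" "x \<in> S"
      have "1 \<le> offspring r p S x" using ge S by auto
      also have "\<dots> \<le> offspring r q S x"
        using S q p fin lf finite_subset by (intro offspring_mono) auto
      finally show "1 \<le> offspring r q S x" .
    qed (use q p in auto)
    also have "\<dots> \<le> 1 * f' q"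
    proof (intro mult_right_mono)
      have "bexp q R (\<lambda>\<omega>. 0) \<le> bexp q R (\<lambda>\<omega>. reach r R x (insert a \<omega>) - reach r R x (\<omega> - {a}))" for a
        using q p by (intro bexp_mono) (auto intro!: reach_mono)
      then show "0 \<le> f' q" unfolding f'_def using fin by (intro sum_nonneg) simp
    qed (use q p in auto)
    finally show ?thesis by simp
  qed
  have "(1 - f p') * exp p' \<le> (1 - f p) * exp p"
  proof (rule DERIV_nonpos_imp_nonincreasing[OF p(2)])
    fix q assume q: "p \<le> q" "q \<le> p'"
    have "((\<lambda>q. (1 - f q) * exp q) has_real_derivative (1 - f q - f' q) * exp q) (at q)"
      by (auto intro!: derivative_eq_intros der simp: algebra_simps)
    moreover have "(1 - f q - f' q) * exp q \<le> 0" using ineq[OF q] by (intro mult_nonpos_nonneg) auto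
    ultimately show "\<exists>y. ((\<lambda>q. (1 - f q) * exp q) has_real_derivative y) (at q) \<and> y \<le> 0" by blast
  qed
  also have "\<dots> \<le> 1 * exp p"
  proof (intro mult_right_mono)
    have "bexp p R (\<lambda>\<omega>. 0) \<le> f p" unfolding f_def using p by (intro bexp_mono) (auto simp: reach_def)
    then show "1 - f p \<le> 1" using fin by simp
  qed auto
  finally have "(1 - f p') * exp p' \<le> exp p" by simp
  then have "(1 - f p') * exp p' * exp (- p') \<le> exp p * exp (- p')" by (intro mult_right_mono) auto
  then have "1 - f p' \<le> exp (p - p')" by (simp add: mult.assoc flip: exp_add)
  then show ?thesis by (simp add: f_def)
qed

section \<open>Subcritical clusters have exponential moments\<close>

lemma power_le_linear:
  fixes e :: real assumes "0 \<le> e" "k \<le> B"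
  shows "(1 + e) ^ k \<le> 1 + e * (1 + e) ^ B * real k"
  using assms(2)
proof (induction k)
  case (Suc k)
  have "(1 + e) ^ Suc k = (1 + e) ^ k + e * (1 + e) ^ k" by (simp add: algebra_simps)
  also have "\<dots> \<le> (1 + e * (1 + e) ^ B * real k) + e * (1 + e) ^ B"
    using Suc assms(1) by (intro add_mono mult_left_mono power_increasing) auto
  finally show ?case by (simp add: algebra_simps)
qed simp

text \<open>The instance of positive association that is needed: forcing the sites of \<open>Q\<close> to be open can only help
an increasing function.\<close>

lemma bexp_all_open:
  assumes "finite R" "Q \<subseteq> R" "0 \<le> p" "p \<le> 1"
    and "\<And>\<omega> \<omega>'. \<omega> \<subseteq> \<omega>' \<Longrightarrow> \<omega>' \<subseteq> R \<Longrightarrow> g \<omega> \<le> g \<omega>'"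
  shows "p ^ card Q * bexp p R g \<le> bexp p R (\<lambda>\<omega>. of_bool (Q \<subseteq> \<omega>) * g \<omega>)"
proof -
  have fin: "finite Q" "finite (R - Q)" and R: "(R - Q) \<union> Q = R" using assms finite_subset by auto
  have split: "bexp p R f = bexp p (R - Q) (\<lambda>\<omega>. bexp p Q (\<lambda>\<eta>. f (\<omega> \<union> \<eta>)))" for f
    using bexp_Un[of "R - Q" Q p f] fin R by auto
  have "bexp p R g \<le> bexp p (R - Q) (\<lambda>\<omega>. bexp p Q (\<lambda>\<eta>. g (\<omega> \<union> Q)))"
    unfolding split[of g] using assms(2) by (intro bexp_mono assms) auto
  also have "\<dots> = bexp p (R - Q) (\<lambda>\<omega>. g (\<omega> \<union> Q))" using fin by simp
  finally have "p ^ card Q * bexp p R g \<le> p ^ card Q * bexp p (R - Q) (\<lambda>\<omega>. g (\<omega> \<union> Q))"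
    using assms by (intro mult_left_mono) auto
  also have "\<dots> = bexp p (R - Q) (\<lambda>\<omega>. g (\<omega> \<union> Q) * bexp p Q (\<lambda>\<eta>. of_bool (Q \<subseteq> \<eta> \<and> {} \<inter> \<eta> = {})))"
  proof -
    have "bexp p Q (\<lambda>\<eta>. of_bool (Q \<subseteq> \<eta> \<and> {} \<inter> \<eta> = {})) = p ^ card Q"
      using bexp_cylinder[of Q Q "{}" p] fin by simp
    then show ?thesis by (simp only: mult.commute[of _ "p ^ card Q"] bexp_cmult)
  qed
  also have "\<dots> = bexp p (R - Q) (\<lambda>\<omega>. bexp p Q (\<lambda>\<eta>. of_bool (Q \<subseteq> \<omega> \<union> \<eta>) * g (\<omega> \<union> \<eta>)))"
    unfolding bexp_cmult[symmetric, where R = Q]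
  proof (intro bexp_cong)
    fix \<omega> \<eta> assume o: "\<omega> \<subseteq> R - Q" "\<eta> \<subseteq> Q"
    have "Q \<subseteq> \<omega> \<union> \<eta> \<longleftrightarrow> \<eta> = Q" using o by auto
    then show "g (\<omega> \<union> Q) * of_bool (Q \<subseteq> \<eta> \<and> {} \<inter> \<eta> = {}) = of_bool (Q \<subseteq> \<omega> \<union> \<eta>) * g (\<omega> \<union> \<eta>)"
      using o by auto
  qed
  also have "\<dots> = bexp p R (\<lambda>\<omega>. of_bool (Q \<subseteq> \<omega>) * g \<omega>)" by (rule split[symmetric])
  finally show ?thesis .
qed

lemma bexp_image:
  assumes "inj_on f S"
  shows "bexp p (f ` S) g = bexp p S (\<lambda>\<omega>. g (f ` \<omega>))"
  unfolding bexp_def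
proof (rule sum.reindex_cong[of "image f"])
  show "inj_on (image f) (Pow S)" using assms by (rule inj_on_image_Pow)
  show "Pow (f ` S) = image f ` Pow S" by (rule image_Pow_surj[OF refl, symmetric])
next
  fix \<omega> assume "\<omega> \<in> Pow S"
  then have o: "\<omega> \<subseteq> S" by auto
  have "f ` S - f ` \<omega> = f ` (S - \<omega>)" using inj_on_image_set_diff[OF assms, of S \<omega>] o by auto
  moreover have "card (f ` \<omega>) = card \<omega>" "card (f ` (S - \<omega>)) = card (S - \<omega>)"
    using assms o by (auto intro!: card_image intro: inj_on_subset)
  ultimately show "p ^ card (f ` \<omega>) * (1 - p) ^ card (f ` S - f ` \<omega>) * g (f ` \<omega>) =
    p ^ card \<omega> * (1 - p) ^ card (S - \<omega>) * g (f ` \<omega>)" by simp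
qed

locale site_graph =
  fixes I :: "'i set" and r :: "'i rel"
  assumes r_sub: "r \<subseteq> I \<times> I" and r_sym: "sym r"
    and r_fin: "i \<in> I \<Longrightarrow> finite (r `` {i})"
begin

lemma finite_nbrs: "finite S \<Longrightarrow> finite (r `` S)"
proof -
  assume "finite S"
  have "r `` S = (\<Union>i\<in>S \<inter> I. r `` {i})" using r_sub by auto
  then show ?thesis using \<open>finite S\<close> r_fin by auto
qed

text \<open>Induction on the region \<open>R\<close>. Reveal the cluster \<open>C\<close> of one source \<open>v\<close> inside its block \<open>S v\<close>; at most \<open>M\<close>
sites are gained, \<open>v\<close> is replaced by the \<open>Z\<close> neighbours of \<open>C\<close> outside the block as new sources, and the
exploration goes on in a strictly smaller region. Since \<open>Z \<le> B\<close> has expectation at most \<open>\<phi> < 1\<close>, the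
expectation of \<open>(1 + d) ^ Z\<close> is at most \<open>1 + d * (1 + d) ^ B * \<phi>\<close>, which is less than \<open>1 + d\<close> for small \<open>d\<close>.
The gap between the two pays for the factor \<open>\<rho> ^ M\<close>.\<close>

lemma exponential_moments:
  assumes p: "0 \<le> p" "p \<le> 1"
    and S: "\<And>v. v \<in> I \<Longrightarrow> finite (S v) \<and> v \<in> S v \<and> S v \<subseteq> I \<and> card (S v) \<le> M
        \<and> card (r `` S v) \<le> B \<and> offspring r p (S v) v \<le> \<phi>"
    and \<phi>: "0 \<le> \<phi>" "\<phi> < 1" and e: "0 < e"
  shows "\<exists>\<rho>>1. \<forall>R Y. finite R \<and> R \<subseteq> I \<and> finite Y \<longrightarrow>
    bexp p R (\<lambda>\<omega>. \<rho> ^ card (cl r Y \<omega>)) \<le> (1 + e) ^ card Y"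
proof -
  have "((\<lambda>d. \<phi> * (1 + d) ^ B) \<longlongrightarrow> \<phi> * (1 + 0) ^ B) (at_right (0::real))"
    by (intro tendsto_intros)
  then have "\<forall>\<^sub>F d in at_right (0::real). \<phi> * (1 + d) ^ B < 1"
    using \<phi> by (auto dest: order_tendstoD(2))
  moreover have "\<forall>\<^sub>F d in at_right (0::real). d < e" using e by (rule eventually_at_right_real[THEN eventually_mono]) simp
  moreover have "\<forall>\<^sub>F d in at_right (0::real). 0 < d" by (rule eventually_at_right_less)
  ultimately have "\<forall>\<^sub>F d in at_right (0::real). 0 < d \<and> d < e \<and> \<phi> * (1 + d) ^ B < 1"
    by eventually_elim auto
  then obtain d where d: "0 < d" "d < e" "\<phi> * (1 + d) ^ B < 1"
    using eventually_happens'[OF trivial_limit_at_right_real] by blast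
  define t where "t = 1 + d"
  define u where "u = 1 + d * t ^ B * \<phi>"
  have t: "1 < t" and u: "1 \<le> u" "u < t" using d \<phi> by (auto simp: t_def u_def mult_ac)
  define \<rho> where "\<rho> = root (Suc M) (t / u)"
  have \<rho>1: "1 < \<rho>" using u by (simp add: \<rho>_def)
  have \<rho>M: "\<rho> ^ Suc M = t / u" unfolding \<rho>_def using u t by (intro real_root_pow_pos2) auto
  have "bexp p R (\<lambda>\<omega>. \<rho> ^ card (cl r Y \<omega>)) \<le> t ^ card Y" if "finite R" "R \<subseteq> I" "finite Y" for R Y
    using that
  proof (induction R arbitrary: Y rule: finite_psubset_induct)
    case (psubset R)
    show ?case
    proof (cases "Y \<inter> R = {}")
      case True
      have "bexp p R (\<lambda>\<omega>. \<rho> ^ card (cl r Y \<omega>)) = bexp p R (\<lambda>\<omega>. 1)"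
      proof (intro bexp_cong)
        fix \<omega> assume "\<omega> \<subseteq> R"
        then have "cl r Y \<omega> = {}" using True by (auto simp: cl_def)
        then show "\<rho> ^ card (cl r Y \<omega>) = 1" by simp
      qed
      then show ?thesis using psubset.hyps t by simp
    next
      case False
      then obtain v where v: "v \<in> Y" "v \<in> R" by auto
      then have vI: "v \<in> I" using psubset.prems by auto
      note Sv = S[OF vI]
      define S' where "S' = S v \<inter> R"
      define C where "C \<omega> = cl r {v} (\<omega> \<inter> S')" for \<omega>
      define D where "D \<omega> = explored r {v} S' \<omega>" for \<omega>
      define h where "h \<omega> = t ^ card (r `` cl r {v} \<omega> - S v)" for \<omega>
      have CS: "C \<omega> \<subseteq> S'" for \<omega> using cl_subset[of r "{v}" "\<omega> \<inter> S'"] by (auto simp: C_def)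
      have finC: "finite (C \<omega>)" for \<omega> using CS Sv finite_subset by (fastforce simp: S'_def)
      have finZ: "finite (r `` C \<omega> - S v)" for \<omega> using finite_nbrs[OF finC] by auto
      have vD: "v \<in> D \<omega>" for \<omega> using v Sv by (auto simp: D_def explored_def S'_def)
      have "bexp p R (\<lambda>\<omega>. \<rho> ^ card (cl r Y \<omega>)) =
          bexp p R (\<lambda>\<omega>. bexp p (R - D \<omega>) (\<lambda>\<eta>. \<rho> ^ card (cl r Y (C \<omega> \<union> \<eta>))))"
        unfolding D_def C_def by (rule bexp_explore) (use psubset.hyps in \<open>auto simp: S'_def\<close>)
      also have "\<dots> \<le> bexp p R (\<lambda>\<omega>. \<rho> ^ M * t ^ (card Y - 1) * h (\<omega> \<inter> S'))"
      proof (intro bexp_mono p)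
        fix \<omega> assume "\<omega> \<subseteq> R"
        define Y' where "Y' = (Y - {v}) \<union> (r `` C \<omega> - S v)"
        have finY': "finite Y'" using psubset.prems finZ by (auto simp: Y'_def)
        have sub: "cl r Y (C \<omega> \<union> \<eta>) \<subseteq> C \<omega> \<union> cl r Y' \<eta>" if eta: "\<eta> \<subseteq> R - D \<omega>" for \<eta>
        proof (rule cl_least)
          show "Y \<inter> (C \<omega> \<union> \<eta>) \<subseteq> C \<omega> \<union> cl r Y' \<eta>"
            using vD eta by (auto simp: Y'_def intro!: cl_source)
        next
          fix z w assume z: "z \<in> C \<omega> \<union> cl r Y' \<eta>" "(z, w) \<in> r" "w \<in> C \<omega> \<union> \<eta>"
          show "w \<in> C \<omega> \<union> cl r Y' \<eta>"
          proof (cases "w \<in> C \<omega> \<or> z \<in> cl r Y' \<eta>")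
            case True then show ?thesis using z by (auto intro: cl_step)
          next
            case False
            then have "w \<in> \<eta>" "z \<in> C \<omega>" using z by auto
            then have "w \<in> r `` C \<omega>" "w \<in> R" "w \<notin> D \<omega>" using z eta by auto
            then have "w \<notin> S v" by (auto simp: D_def explored_def C_def S'_def)
            then show ?thesis using \<open>w \<in> \<eta>\<close> \<open>w \<in> r `` C \<omega>\<close> by (auto simp: Y'_def intro!: cl_source)
          qed
        qed
        have "bexp p (R - D \<omega>) (\<lambda>\<eta>. \<rho> ^ card (cl r Y (C \<omega> \<union> \<eta>)))
            \<le> bexp p (R - D \<omega>) (\<lambda>\<eta>. \<rho> ^ M * \<rho> ^ card (cl r Y' \<eta>))"
        proof (intro bexp_mono p)
          fix \<eta> assume eta: "\<eta> \<subseteq> R - D \<omega>"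
          have fe: "finite (cl r Y' \<eta>)"
            using cl_subset[of r Y' \<eta>] eta psubset.hyps by (meson finite_Diff finite_subset)
          have "card (cl r Y (C \<omega> \<union> \<eta>)) \<le> card (C \<omega> \<union> cl r Y' \<eta>)"
            using sub[OF eta] finC fe by (intro card_mono) auto
          also have "\<dots> \<le> card (C \<omega>) + card (cl r Y' \<eta>)" by (rule card_Un_le)
          also have "card (C \<omega>) \<le> card (S v)" using CS Sv by (intro card_mono) (auto simp: S'_def)
          finally have "card (cl r Y (C \<omega> \<union> \<eta>)) \<le> M + card (cl r Y' \<eta>)" using Sv by auto
          then show "\<rho> ^ card (cl r Y (C \<omega> \<union> \<eta>)) \<le> \<rho> ^ M * \<rho> ^ card (cl r Y' \<eta>)"
            using \<rho>1 by (simp flip: power_add)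
        qed
        also have "\<dots> = \<rho> ^ M * bexp p (R - D \<omega>) (\<lambda>\<eta>. \<rho> ^ card (cl r Y' \<eta>))" by (rule bexp_cmult)
        also have "\<dots> \<le> \<rho> ^ M * t ^ card Y'"
          using vD v psubset.prems finY' \<rho>1 by (intro mult_left_mono psubset.IH) auto
        also have "\<dots> \<le> \<rho> ^ M * t ^ ((card Y - 1) + card (r `` C \<omega> - S v))"
        proof (intro mult_left_mono power_increasing)
          have "card Y' \<le> card (Y - {v}) + card (r `` C \<omega> - S v)" unfolding Y'_def by (rule card_Un_le)
          then show "card Y' \<le> card Y - 1 + card (r `` C \<omega> - S v)" using v psubset.prems by simp
        qed (use t \<rho>1 in auto)
        finally show "bexp p (R - D \<omega>) (\<lambda>\<eta>. \<rho> ^ card (cl r Y (C \<omega> \<union> \<eta>))) \<le>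
            \<rho> ^ M * t ^ (card Y - 1) * h (\<omega> \<inter> S')" by (simp add: h_def C_def power_add)
      qed
      also have "\<dots> = \<rho> ^ M * t ^ (card Y - 1) * bexp p S' h"
        using bexp_restrict[OF psubset.hyps, of p h S'] by (simp add: bexp_cmult S'_def Int_commute Int_left_commute)
      also have "bexp p S' h \<le> bexp p (S v) h"
      proof (intro bexp_mono_region p)
        fix \<omega> \<omega>' assume o: "\<omega> \<subseteq> \<omega>'" "\<omega>' \<subseteq> S v"
        have "finite (cl r {v} \<omega>')" using cl_subset[of r "{v}" \<omega>'] o Sv by (meson finite_subset)
        then show "h \<omega> \<le> h \<omega>'" unfolding h_def
          using cl_mono[OF order_refl o(1), of r "{v}"] finite_nbrs t
          by (intro power_increasing card_mono) auto
      qed (use Sv in \<open>auto simp: S'_def\<close>)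
      also have "bexp p (S v) h \<le> bexp p (S v) (\<lambda>\<omega>. 1 + d * t ^ B * real (card (r `` cl r {v} \<omega> - S v)))"
      proof (intro bexp_mono p)
        fix \<omega> assume "\<omega> \<subseteq> S v"
        then have "cl r {v} \<omega> \<subseteq> S v" using cl_subset[of r "{v}" \<omega>] by auto
        then have "card (r `` cl r {v} \<omega> - S v) \<le> card (r `` S v)"
          using Sv finite_nbrs by (intro card_mono) auto
        then show "h \<omega> \<le> 1 + d * t ^ B * real (card (r `` cl r {v} \<omega> - S v))"
          unfolding h_def t_def using d Sv by (intro power_le_linear) auto
      qed
      also have "\<dots> = 1 + d * t ^ B * offspring r p (S v) v"
        using Sv by (simp add: bexp_add bexp_cmult offspring_def)
      also have "\<dots> \<le> u" unfolding u_def using Sv d t by (intro add_left_mono mult_left_mono) auto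
      finally have "bexp p R (\<lambda>\<omega>. \<rho> ^ card (cl r Y \<omega>)) \<le> \<rho> ^ M * t ^ (card Y - 1) * u"
        using \<rho>1 t by simp
      also have "\<dots> \<le> \<rho> ^ Suc M * t ^ (card Y - 1) * u" using \<rho>1 t u by (intro mult_right_mono) auto
      also have "\<dots> = t * t ^ (card Y - 1)" using u by (simp only: \<rho>M) simp
      also have "\<dots> = t ^ card Y" using v psubset.prems by (cases "card Y") auto
      finally show ?thesis .
    qed
  qed
  moreover have "t ^ card Y \<le> (1 + e) ^ card Y" for Y :: "'i set"
    using d t by (intro power_mono) (auto simp: t_def)
  ultimately have "\<forall>R Y. finite R \<and> R \<subseteq> I \<and> finite Y \<longrightarrow>
      bexp p R (\<lambda>\<omega>. \<rho> ^ card (cl r Y \<omega>)) \<le> (1 + e) ^ card Y"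
    by (metis order_trans)
  then show ?thesis using \<rho>1 by blast
qed

definition site_automorphism :: "('i \<Rightarrow> 'i) \<Rightarrow> bool" where
  "site_automorphism f \<longleftrightarrow> bij_betw f I I \<and> (\<forall>i\<in>I. \<forall>j\<in>I. (f i, f j) \<in> r \<longleftrightarrow> (i, j) \<in> r)"

lemma automorphism_nbrs:
  assumes "site_automorphism f" "C \<subseteq> I" shows "r `` (f ` C) = f ` (r `` C)"
proof -
  have f: "f ` I = I" "\<And>i j. i \<in> I \<Longrightarrow> j \<in> I \<Longrightarrow> (f i, f j) \<in> r \<longleftrightarrow> (i, j) \<in> r"
    using assms by (auto simp: site_automorphism_def bij_betw_def)
  show ?thesis
  proof (intro equalityI subsetI)
    fix z assume "z \<in> r `` (f ` C)"
    then obtain c where c: "c \<in> C" "(f c, z) \<in> r" by auto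
    then have "z \<in> f ` I" using r_sub f(1) by auto
    then obtain w where w: "w \<in> I" "z = f w" by auto
    then have "(c, w) \<in> r" using c f(2)[of c w] assms(2) by auto
    then show "z \<in> f ` (r `` C)" using c(1) w(2) by auto
  next
    fix z assume "z \<in> f ` (r `` C)"
    then obtain c w where c: "c \<in> C" "(c, w) \<in> r" "z = f w" by auto
    then have "(f c, f w) \<in> r" using f(2)[of c w] assms(2) r_sub by auto
    then show "z \<in> r `` (f ` C)" using c by auto
  qed
qed

lemma automorphism_cl:
  assumes "site_automorphism f" "\<omega> \<subseteq> I" "v \<in> I"
  shows "cl r {f v} (f ` \<omega>) = f ` cl r {v} \<omega>"
proof (rule cl_eqI)
  have f: "inj_on f I" "\<And>i j. i \<in> I \<Longrightarrow> j \<in> I \<Longrightarrow> (f i, f j) \<in> r \<longleftrightarrow> (i, j) \<in> r"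
    using assms by (auto simp: site_automorphism_def bij_betw_def)
  let ?C = "cl r {v} \<omega>"
  have C: "?C \<subseteq> I" using cl_subset[of r "{v}" \<omega>] assms by auto
  show "f ` ?C \<subseteq> f ` \<omega>" using cl_subset[of r "{v}" \<omega>] by auto
  have "f z \<in> cl r {f v} (f ` ?C)" if "z \<in> ?C" for z using that
  proof (induction rule: cl_induct)
    case (source y) then show ?case by (auto intro!: cl_source)
  next
    case (step z w)
    have w: "w \<in> ?C" by (rule cl_step[of z]) (use step in auto)
    have "(f z, f w) \<in> r" using f(2)[of z w] step C w by blast
    then show ?case by (rule cl_step[rotated]) (use step w in auto)
  qed
  then show "cl r {f v} (f ` ?C) = f ` ?C" using cl_subset[of r "{f v}" "f ` ?C"] by auto
  have "bd r {f v} (f ` ?C) = f ` bd r {v} ?C"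
    unfolding bd_def automorphism_nbrs[OF assms(1) C]
    using inj_on_image_set_diff[OF f(1), of "{v} \<union> r `` ?C" ?C] C assms(3) r_sub by auto
  moreover have "f ` bd r {v} ?C \<inter> f ` \<omega> = f ` (bd r {v} ?C \<inter> \<omega>)"
    using assms r_sub by (intro inj_on_image_Int[OF f(1), symmetric]) (auto simp: bd_def)
  ultimately show "bd r {f v} (f ` ?C) \<inter> f ` \<omega> = {}" by (simp add: bd_cl)
qed

lemma automorphism_offspring:
  assumes f: "site_automorphism f" and S: "S \<subseteq> I" "v \<in> I"
  shows "offspring r p (f ` S) (f v) = offspring r p S v"
proof -
  have inj: "inj_on f I" using f by (simp add: site_automorphism_def bij_betw_def)
  have "bexp p (f ` S) (\<lambda>\<omega>. real (card (r `` cl r {f v} \<omega> - f ` S))) =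
    bexp p S (\<lambda>\<omega>. real (card (r `` cl r {f v} (f ` \<omega>) - f ` S)))"
    using inj S by (intro bexp_image) (rule inj_on_subset)
  also have "\<dots> = bexp p S (\<lambda>\<omega>. real (card (r `` cl r {v} \<omega> - S)))"
  proof (intro bexp_cong)
    fix \<omega> assume o: "\<omega> \<subseteq> S"
    let ?C = "cl r {v} \<omega>"
    have C: "?C \<subseteq> I" using o S cl_subset[of r "{v}" \<omega>] by auto
    have "r `` cl r {f v} (f ` \<omega>) - f ` S = f ` (r `` ?C) - f ` S"
      using automorphism_cl[OF f _ S(2), of \<omega>] o S automorphism_nbrs[OF f C] by auto
    also have "\<dots> = f ` (r `` ?C - S)"
      using inj_on_image_set_diff[OF inj, of "r `` ?C" S] r_sub S by auto
    also have "card \<dots> = card (r `` ?C - S)"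
      by (intro card_image inj_on_subset[OF inj]) (use r_sub in auto)
    finally show "real (card (r `` cl r {f v} (f ` \<omega>) - f ` S)) = real (card (r `` ?C - S))" by simp
  qed
  finally show ?thesis by (simp add: offspring_def)
qed

lemma bounded_degree:
  assumes T: "finite T" "T \<subseteq> I" "\<And>i. i \<in> I \<Longrightarrow> \<exists>t\<in>T. \<exists>f. site_automorphism f \<and> f t = i"
  shows "\<exists>\<Delta>. \<forall>i\<in>I. card (r `` {i}) \<le> \<Delta>"
proof (intro exI ballI)
  fix i assume i: "i \<in> I"
  obtain t f where t: "t \<in> T" "site_automorphism f" "f t = i" using T(3)[OF i] by blast
  have "r `` {i} = f ` (r `` {t})" using automorphism_nbrs[OF t(2), of "{t}"] t T(2) by auto
  then have "card (r `` {i}) \<le> card (r `` {t})"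
    using r_fin[of t] t T(2) by (auto intro: card_image_le)
  also have "\<dots> \<le> (\<Sum>t\<in>T. card (r `` {t}))" using t(1) T(1)
    by (intro member_le_sum[of t T "\<lambda>t. card (r `` {t})"]) auto
  finally show "card (r `` {i}) \<le> (\<Sum>t\<in>T. card (r `` {t}))" .
qed

text \<open>The statement \<open>\<theta> p = 0\<close> for the sources \<open>Y\<close>, in terms of finite regions.\<close>

definition vanishing :: "real \<Rightarrow> 'i set \<Rightarrow> bool" where
  "vanishing p Y \<longleftrightarrow> (\<forall>\<delta>>0. \<exists>R\<^sub>0. finite R\<^sub>0 \<and> R\<^sub>0 \<subseteq> I \<and> (\<forall>R. finite R \<and> R\<^sub>0 \<subseteq> R \<and> R \<subseteq> I \<longrightarrow>
     bexp p R (\<lambda>\<omega>. of_bool (cl r Y \<omega> \<inter> exits r R \<noteq> {})) \<le> \<delta>))"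

lemma reach_set_mono:
  assumes "Y \<subseteq> Y'" "\<omega> \<subseteq> \<omega>'"
  shows "(of_bool (cl r Y \<omega> \<inter> X \<noteq> {}) :: real) \<le> of_bool (cl r Y' \<omega>' \<inter> X \<noteq> {})"
proof -
  have "cl r Y \<omega> \<inter> X \<noteq> {} \<Longrightarrow> cl r Y' \<omega>' \<inter> X \<noteq> {}" using cl_mono[OF assms, of r] by fast
  then show ?thesis by (cases "cl r Y \<omega> \<inter> X = {}") simp_all
qed

lemma vanishingE:
  assumes "vanishing p Y" "0 < \<delta>"
  obtains R\<^sub>0 where "finite R\<^sub>0" "R\<^sub>0 \<subseteq> I"
    "\<And>R. finite R \<Longrightarrow> R\<^sub>0 \<subseteq> R \<Longrightarrow> R \<subseteq> I \<Longrightarrow>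
      bexp p R (\<lambda>\<omega>. of_bool (cl r Y \<omega> \<inter> exits r R \<noteq> {})) \<le> \<delta>"
proof -
  obtain R\<^sub>0 where R\<^sub>0: "finite R\<^sub>0 \<and> R\<^sub>0 \<subseteq> I \<and> (\<forall>R. finite R \<and> R\<^sub>0 \<subseteq> R \<and> R \<subseteq> I \<longrightarrow>
      bexp p R (\<lambda>\<omega>. of_bool (cl r Y \<omega> \<inter> exits r R \<noteq> {})) \<le> \<delta>)"
    using assms(1)[unfolded vanishing_def, THEN spec, THEN mp, OF assms(2)] by (rule exE)
  show ?thesis using R\<^sub>0 by (intro that[of R\<^sub>0]) auto
qed

lemma vanishingI:
  assumes "\<And>\<delta>. 0 < \<delta> \<Longrightarrow> \<exists>R\<^sub>0. finite R\<^sub>0 \<and> R\<^sub>0 \<subseteq> I \<and> (\<forall>R. finite R \<longrightarrow> R\<^sub>0 \<subseteq> R \<longrightarrow> R \<subseteq> I \<longrightarrow>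
      bexp p R (\<lambda>\<omega>. of_bool (cl r Y \<omega> \<inter> exits r R \<noteq> {})) \<le> \<delta>)"
  shows "vanishing p Y"
  unfolding vanishing_def imp_conjL by (intro allI impI assms)

lemma vanishing_mono_param:
  assumes "vanishing p' Y" "0 \<le> p" "p \<le> p'" "p' \<le> 1"
  shows "vanishing p Y"
proof (rule vanishingI)
  fix \<delta> :: real assume d: "0 < \<delta>"
  obtain R\<^sub>0 where R\<^sub>0: "finite R\<^sub>0" "R\<^sub>0 \<subseteq> I" "\<And>R. finite R \<Longrightarrow> R\<^sub>0 \<subseteq> R \<Longrightarrow> R \<subseteq> I \<Longrightarrow>
     bexp p' R (\<lambda>\<omega>. of_bool (cl r Y \<omega> \<inter> exits r R \<noteq> {})) \<le> \<delta>"
    using vanishingE[OF assms(1) d] by metis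
  have "bexp p R (\<lambda>\<omega>. of_bool (cl r Y \<omega> \<inter> exits r R \<noteq> {})) \<le> \<delta>"
    if R: "finite R" "R\<^sub>0 \<subseteq> R" "R \<subseteq> I" for R
  proof (rule order_trans[OF _ R\<^sub>0(3)[OF R]])
    show "bexp p R (\<lambda>\<omega>. of_bool (cl r Y \<omega> \<inter> exits r R \<noteq> {}))
        \<le> bexp p' R (\<lambda>\<omega>. of_bool (cl r Y \<omega> \<inter> exits r R \<noteq> {}))"
      by (rule bexp_mono_param[OF R(1) assms(2-4)]) (rule reach_set_mono[OF order_refl])
  qed
  then show "\<exists>R\<^sub>0. finite R\<^sub>0 \<and> R\<^sub>0 \<subseteq> I \<and> (\<forall>R. finite R \<longrightarrow> R\<^sub>0 \<subseteq> R \<longrightarrow> R \<subseteq> I \<longrightarrow>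
     bexp p R (\<lambda>\<omega>. of_bool (cl r Y \<omega> \<inter> exits r R \<noteq> {})) \<le> \<delta>)" using R\<^sub>0(1,2) by (intro exI[of _ R\<^sub>0]) auto
qed

end

locale connected_site_graph = site_graph I r for I :: "'i set" and r +
  assumes conn: "i \<in> I \<Longrightarrow> j \<in> I \<Longrightarrow> (i, j) \<in> r\<^sup>*"
begin

lemma finite_connection:
  assumes "y \<in> I" "x \<in> I"
  shows "\<exists>Q. finite Q \<and> Q \<subseteq> I \<and> x \<in> cl r {y} Q"
  using conn[OF assms]
proof (induction rule: rtrancl_induct)
  case base
  show ?case by (intro exI[of _ "{y}"]) (use assms in \<open>auto intro: cl_source\<close>)
next
  case (step u w)
  then obtain Q where Q: "finite Q" "Q \<subseteq> I" "u \<in> cl r {y} Q" by auto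
  then have "u \<in> cl r {y} (insert w Q)" using cl_mono[of "{y}" "{y}" Q "insert w Q" r] by auto
  then have "w \<in> cl r {y} (insert w Q)" by (rule cl_step[OF _ step(2)]) simp
  then show ?case using Q step r_sub by (intro exI[of _ "insert w Q"]) auto
qed

text \<open>If the sites \<open>Q\<close> of a path from \<open>Y\<close> to \<open>x\<close> are open, then the cluster of \<open>x\<close> is part of that of \<open>Y\<close>; this
costs only the constant factor \<open>p ^ card Q\<close>.\<close>

lemma vanishing_site:
  assumes v: "vanishing p Y" and p: "0 < p" "p \<le> 1" and Y: "Y \<subseteq> I" "Y \<noteq> {}" and x: "x \<in> I"
  shows "vanishing p {x}"
proof (rule vanishingI)
  fix \<delta> :: real assume d: "0 < \<delta>"
  obtain y where y: "y \<in> Y" "y \<in> I" using Y by auto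
  obtain Q where Q: "finite Q" "Q \<subseteq> I" "x \<in> cl r {y} Q" using finite_connection[OF y(2) x] by auto
  have d': "p ^ card Q * \<delta> > 0" using p d by simp
  obtain R\<^sub>0 where R\<^sub>0: "finite R\<^sub>0" "R\<^sub>0 \<subseteq> I" "\<And>R. finite R \<Longrightarrow> R\<^sub>0 \<subseteq> R \<Longrightarrow> R \<subseteq> I \<Longrightarrow>
     bexp p R (\<lambda>\<omega>. of_bool (cl r Y \<omega> \<inter> exits r R \<noteq> {})) \<le> p ^ card Q * \<delta>"
    using vanishingE[OF v d'] by metis
  have "bexp p R (\<lambda>\<omega>. of_bool (cl r {x} \<omega> \<inter> exits r R \<noteq> {})) \<le> \<delta>"
    if R: "finite R" "R\<^sub>0 \<union> Q \<subseteq> R" "R \<subseteq> I" for R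
  proof -
    let ?g = "\<lambda>\<omega>. of_bool (cl r {x} \<omega> \<inter> exits r R \<noteq> {}) :: real"
    have "p ^ card Q * bexp p R ?g \<le> bexp p R (\<lambda>\<omega>. of_bool (Q \<subseteq> \<omega>) * ?g \<omega>)"
      using R p reach_set_mono[of "{x}" "{x}"] by (intro bexp_all_open) auto
    also have "\<dots> \<le> bexp p R (\<lambda>\<omega>. of_bool (cl r Y \<omega> \<inter> exits r R \<noteq> {}))"
    proof (intro bexp_mono)
      fix \<omega>
      have "cl r {x} \<omega> \<subseteq> cl r Y \<omega>" if "Q \<subseteq> \<omega>"
        using Q(3) cl_mono[of "{y}" Y Q \<omega> r] y that by (intro cl_trans) auto
      then show "of_bool (Q \<subseteq> \<omega>) * ?g \<omega> \<le> of_bool (cl r Y \<omega> \<inter> exits r R \<noteq> {})" by auto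
    qed (use p in auto)
    also have "\<dots> \<le> p ^ card Q * \<delta>" using R by (intro R\<^sub>0) auto
    finally show ?thesis using p by simp
  qed
  then show "\<exists>R\<^sub>0. finite R\<^sub>0 \<and> R\<^sub>0 \<subseteq> I \<and> (\<forall>R. finite R \<longrightarrow> R\<^sub>0 \<subseteq> R \<longrightarrow> R \<subseteq> I \<longrightarrow>
     bexp p R (\<lambda>\<omega>. of_bool (cl r {x} \<omega> \<inter> exits r R \<noteq> {})) \<le> \<delta>)"
    using R\<^sub>0 Q by (intro exI[of _ "R\<^sub>0 \<union> Q"]) auto
qed

lemma vanishing_finite:
  assumes v: "vanishing p Y" and p: "0 < p" "p \<le> 1" and Y: "Y \<subseteq> I" "Y \<noteq> {}"
    and W: "finite W" "W \<subseteq> I"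
  shows "vanishing p W"
  using W
proof (induction W rule: finite_induct)
  case empty
  show ?case
    by (intro vanishingI exI[of _ "{}"]) (auto simp: cl_def)
next
  case (insert x W)
  have vx: "vanishing p {x}" using vanishing_site[OF v p Y] insert by auto
  have vW: "vanishing p W" using insert by auto
  show ?case
  proof (rule vanishingI)
    fix \<delta> :: real assume "\<delta> > 0"
    then have d: "\<delta> / 2 > 0" by simp
    obtain R\<^sub>1 where R\<^sub>1: "finite R\<^sub>1" "R\<^sub>1 \<subseteq> I" "\<And>R. finite R \<Longrightarrow> R\<^sub>1 \<subseteq> R \<Longrightarrow> R \<subseteq> I \<Longrightarrow>
       bexp p R (\<lambda>\<omega>. of_bool (cl r {x} \<omega> \<inter> exits r R \<noteq> {})) \<le> \<delta> / 2"
      using vanishingE[OF vx d] by metis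
    obtain R\<^sub>2 where R\<^sub>2: "finite R\<^sub>2" "R\<^sub>2 \<subseteq> I" "\<And>R. finite R \<Longrightarrow> R\<^sub>2 \<subseteq> R \<Longrightarrow> R \<subseteq> I \<Longrightarrow>
       bexp p R (\<lambda>\<omega>. of_bool (cl r W \<omega> \<inter> exits r R \<noteq> {})) \<le> \<delta> / 2"
      using vanishingE[OF vW d] by metis
    have "bexp p R (\<lambda>\<omega>. of_bool (cl r (insert x W) \<omega> \<inter> exits r R \<noteq> {})) \<le> \<delta>"
      if R: "finite R" "R\<^sub>1 \<union> R\<^sub>2 \<subseteq> R" "R \<subseteq> I" for R
    proof -
      have "bexp p R (\<lambda>\<omega>. of_bool (cl r (insert x W) \<omega> \<inter> exits r R \<noteq> {})) \<le>
        bexp p R (\<lambda>\<omega>. of_bool (cl r {x} \<omega> \<inter> exits r R \<noteq> {}) + of_bool (cl r W \<omega> \<inter> exits r R \<noteq> {}))"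
        using p cl_Un[of r "{x}" W] by (intro bexp_mono) auto
      also have "\<dots> \<le> \<delta> / 2 + \<delta> / 2" unfolding bexp_add
        using R by (intro add_mono R\<^sub>1 R\<^sub>2) auto
      finally show ?thesis by simp
    qed
    then show "\<exists>R\<^sub>0. finite R\<^sub>0 \<and> R\<^sub>0 \<subseteq> I \<and> (\<forall>R. finite R \<longrightarrow> R\<^sub>0 \<subseteq> R \<longrightarrow> R \<subseteq> I \<longrightarrow>
      bexp p R (\<lambda>\<omega>. of_bool (cl r (insert x W) \<omega> \<inter> exits r R \<noteq> {})) \<le> \<delta>)"
      using R\<^sub>1 R\<^sub>2 by (intro exI[of _ "R\<^sub>1 \<union> R\<^sub>2"]) auto
  qed
qed

lemma offspring_less_one:
  assumes v: "vanishing p' Y" and p: "0 \<le> p" "p < p'" "p' \<le> 1" and Y: "Y \<subseteq> I" "Y \<noteq> {}"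
    and x: "x \<in> I"
  shows "\<exists>S. finite S \<and> S \<subseteq> I \<and> x \<in> S \<and> offspring r p S x < 1"
proof (rule ccontr)
  assume "\<not> ?thesis"
  then have ge: "1 \<le> offspring r p S x" if "finite S" "S \<subseteq> I" "x \<in> S" for S using that by force
  have vx: "vanishing p' {x}" using vanishing_site[OF v _ _ Y x] p by auto
  have d: "(1 - exp (p - p')) / 2 > 0" using p by simp
  obtain R\<^sub>0 where R\<^sub>0: "finite R\<^sub>0" "R\<^sub>0 \<subseteq> I" "\<And>R. finite R \<Longrightarrow> R\<^sub>0 \<subseteq> R \<Longrightarrow> R \<subseteq> I \<Longrightarrow>
     bexp p' R (\<lambda>\<omega>. of_bool (cl r {x} \<omega> \<inter> exits r R \<noteq> {})) \<le> (1 - exp (p - p')) / 2"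
    using vanishingE[OF vx d] by metis
  define R where "R = insert x R\<^sub>0"
  have R: "finite R" "R\<^sub>0 \<subseteq> R" "R \<subseteq> I" "x \<in> R" using R\<^sub>0 x by (auto simp: R_def)
  have "1 - exp (p - p') \<le> bexp p' R (reach r R x)"
  proof (rule reach_lower_bound[OF R(1) r_sym R(4)])
    fix S assume S: "S \<subseteq> R" "x \<in> S"
    then show "1 \<le> offspring r p S x" using R by (intro ge) (auto intro: finite_subset)
  qed (use R r_fin p in auto)
  also have "\<dots> = bexp p' R (\<lambda>\<omega>. of_bool (cl r {x} \<omega> \<inter> exits r R \<noteq> {}))"
    unfolding reach_def by (simp only: cl_sym_iff[OF r_sym])
  also have "\<dots> \<le> (1 - exp (p - p')) / 2" using R by (intro R\<^sub>0)
  finally show False using d by simp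
qed

text \<open>Sharpness of the phase transition. Automorphisms carry the good blocks of finitely many orbit
representatives to all sites, so the block sizes and the expected offspring are uniformly bounded.\<close>

lemma subcritical_exponential_moments:
  assumes v: "vanishing p' Y" and p: "0 \<le> p" "p < p'" "p' \<le> 1" and Y: "Y \<subseteq> I" "Y \<noteq> {}"
    and T: "finite T" "T \<subseteq> I" "\<And>i. i \<in> I \<Longrightarrow> \<exists>t\<in>T. \<exists>f. site_automorphism f \<and> f t = i"
    and e: "0 < e"
  shows "\<exists>\<rho>>1. \<forall>R W. finite R \<and> R \<subseteq> I \<and> finite W \<longrightarrow>
    bexp p R (\<lambda>\<omega>. \<rho> ^ card (cl r W \<omega>)) \<le> (1 + e) ^ card W"
proof -
  obtain S where S: "finite (S t)" "S t \<subseteq> I" "t \<in> S t" "offspring r p (S t) t < 1" if "t \<in> T" for t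
    using offspring_less_one[OF v p Y] T(2) by (metis subsetD)
  obtain t f where tf: "t i \<in> T" "site_automorphism (f i)" "f i (t i) = i" if "i \<in> I" for i
    using T(3) by metis
  define M where "M = (\<Sum>t\<in>T. card (S t))"
  define B where "B = (\<Sum>t\<in>T. card (r `` S t))"
  define \<phi> where "\<phi> = Max (insert 0 ((\<lambda>t. offspring r p (S t) t) ` T))"
  have \<phi>: "0 \<le> \<phi>" "\<phi> < 1" using S T(1) by (auto simp: \<phi>_def)
  show ?thesis
  proof (rule exponential_moments[OF p(1) _ _ \<phi> e])
    show "p \<le> 1" using p by simp
    fix i assume i: "i \<in> I"
    let ?f = "f i" and ?t = "t i"
    note tf = tf[OF i] and S = S[OF tf(1)]
    have inj: "inj_on ?f I" "?f ` I = I" using tf(2) by (auto simp: site_automorphism_def bij_betw_def)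
    have tI: "?t \<in> I" using tf T(2) by auto
    have "card (?f ` S ?t) \<le> card (S ?t)" using S by (intro card_image_le)
    also have "\<dots> \<le> M" unfolding M_def using tf(1) T(1) by (intro member_le_sum) auto
    finally have 1: "card (?f ` S ?t) \<le> M" .
    have "card (r `` (?f ` S ?t)) \<le> card (r `` S ?t)"
      unfolding automorphism_nbrs[OF tf(2) S(2)] by (intro card_image_le finite_nbrs S)
    also have "\<dots> \<le> B" unfolding B_def using tf(1) T(1) by (intro member_le_sum) auto
    finally have 2: "card (r `` (?f ` S ?t)) \<le> B" .
    have "offspring r p (?f ` S ?t) i = offspring r p (S ?t) ?t"
      using automorphism_offspring[OF tf(2) S(2) tI, of p] tf(3) by simp
    also have "\<dots> \<le> \<phi>" unfolding \<phi>_def using T(1) tf(1) by (intro Max_ge) auto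
    finally show "finite (?f ` S ?t) \<and> i \<in> ?f ` S ?t \<and> ?f ` S ?t \<subseteq> I \<and> card (?f ` S ?t) \<le> M \<and>
      card (r `` (?f ` S ?t)) \<le> B \<and> offspring r p (?f ` S ?t) i \<le> \<phi>"
      using 1 2 S tf(3) inj by (auto intro: rev_image_eqI)
  qed
qed

end

section \<open>The law of finite clusters\<close>

lemma space_bernoulli_percolation:
  "space (bernoulli_percolation I p) = (\<Pi>\<^sub>E i\<in>I. UNIV)"
  by (simp add: bernoulli_percolation_def space_PiM)

lemma prob_space_bernoulli_percolation: "prob_space (bernoulli_percolation I p)"
  unfolding bernoulli_percolation_def by (rule prob_space_PiM) (rule measure_pmf.prob_space_axioms)

definition occupied :: "'i set \<Rightarrow> ('i \<Rightarrow> bool) \<Rightarrow> 'i set" where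
  "occupied I \<omega> = {i \<in> I. \<omega> i}"

definition cylinder :: "'i set \<Rightarrow> real \<Rightarrow> 'i set \<Rightarrow> 'i set \<Rightarrow> ('i \<Rightarrow> bool) set" where
  "cylinder I p A B =
    {\<omega> \<in> space (bernoulli_percolation I p). A \<subseteq> occupied I \<omega> \<and> B \<inter> occupied I \<omega> = {}}"

lemma cylinder_law:
  assumes "finite A" "finite B" "A \<subseteq> I" "B \<subseteq> I" "A \<inter> B = {}" "0 \<le> p" "p \<le> 1"
  shows "cylinder I p A B \<in> sets (bernoulli_percolation I p)"
    and "measure (bernoulli_percolation I p) (cylinder I p A B) = p ^ card A * (1 - p) ^ card B"
proof -
  let ?M = "\<lambda>i::'a. measure_pmf (bernoulli_pmf p)"
  interpret product_prob_space ?M I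
    by (simp add: product_prob_space_def product_sigma_finite_def product_prob_space_axioms_def
        measure_pmf.prob_space_axioms prob_space_imp_sigma_finite)
  let ?X = "\<lambda>i. {i \<in> A}"
  have eq: "cylinder I p A B = prod_emb I ?M (A \<union> B) (Pi\<^sub>E (A \<union> B) ?X)"
  proof (rule set_eqI)
    fix \<omega> :: "'a \<Rightarrow> bool"
    have "restrict \<omega> (A \<union> B) \<in> Pi\<^sub>E (A \<union> B) ?X \<longleftrightarrow> (\<forall>i\<in>A \<union> B. \<omega> i = (i \<in> A))"
      by (simp add: PiE_iff)
    moreover have "A \<subseteq> occupied I \<omega> \<and> B \<inter> occupied I \<omega> = {} \<longleftrightarrow> (\<forall>i\<in>A \<union> B. \<omega> i = (i \<in> A))"
      using assms unfolding occupied_def by blast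
    ultimately show "\<omega> \<in> cylinder I p A B \<longleftrightarrow> \<omega> \<in> prod_emb I ?M (A \<union> B) (Pi\<^sub>E (A \<union> B) ?X)"
      by (simp add: cylinder_def space_bernoulli_percolation prod_emb_def conj_commute)
  qed
  show "cylinder I p A B \<in> sets (bernoulli_percolation I p)"
    unfolding eq bernoulli_percolation_def using assms by (intro sets_PiM_I) auto
  have "measure (Pi\<^sub>M I ?M) (prod_emb I ?M (A \<union> B) (Pi\<^sub>E (A \<union> B) ?X)) =
      (\<Prod>i\<in>A \<union> B. measure (measure_pmf (bernoulli_pmf p)) (?X i))"
    using assms by (intro measure_PiM_emb) auto
  also have "\<dots> = (\<Prod>i\<in>A \<union> B. if i \<in> A then p else 1 - p)"
    using assms by (intro prod.cong) (auto simp: measure_pmf_single)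
  also have "\<dots> = (\<Prod>i\<in>A. if i \<in> A then p else 1 - p) * (\<Prod>i\<in>B. if i \<in> A then p else 1 - p)"
    using assms by (intro prod.union_disjoint) auto
  also have "(\<Prod>i\<in>A. if i \<in> A then p else 1 - p) = p ^ card A" by simp
  also have "(\<Prod>i\<in>B. if i \<in> A then p else 1 - p) = (\<Prod>i\<in>B. 1 - p)"
    using assms by (intro prod.cong) auto
  finally show "measure (bernoulli_percolation I p) (cylinder I p A B) = p ^ card A * (1 - p) ^ card B"
    by (simp add: eq bernoulli_percolation_def)
qed

lemma (in finite_measure) measure_countable_has_sum:
  assumes J: "countable J" and E: "\<And>j. j \<in> J \<Longrightarrow> E j \<in> sets M" and "disjoint_family_on E J"
  shows "((\<lambda>j. measure M (E j)) has_sum measure M (\<Union>j\<in>J. E j)) J"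
proof -
  define F where "F n = (if n \<in> to_nat_on J ` J then E (from_nat_into J n) else {})" for n
  have F: "F (to_nat_on J j) = E j" if "j \<in> J" for j using that J by (auto simp: F_def)
  have 1: "range F \<subseteq> sets M" using E J by (auto simp: F_def)
  have 2: "disjoint_family F" unfolding disjoint_family_on_def
  proof (intro ballI impI)
    fix m n :: nat assume "m \<noteq> n"
    show "F m \<inter> F n = {}"
    proof (cases "m \<in> to_nat_on J ` J \<and> n \<in> to_nat_on J ` J")
      case True
      then obtain i j where ij: "i \<in> J" "j \<in> J" "m = to_nat_on J i" "n = to_nat_on J j" by auto
      then have "i \<noteq> j" using \<open>m \<noteq> n\<close> by auto
      then show ?thesis using assms(3) ij F by (auto simp: disjoint_family_on_def)
    qed (auto simp: F_def)
  qed
  have "(\<lambda>n. measure M (F n)) sums measure M (\<Union>n. F n)" by (rule finite_measure_UNION[OF 1 2])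
  then have "((\<lambda>n. measure M (F n)) has_sum measure M (\<Union>n. F n)) UNIV"
    by (rule sums_nonneg_imp_has_sum) simp
  then have "((\<lambda>n. measure M (F n)) has_sum measure M (\<Union>n. F n)) (to_nat_on J ` J)"
    by (subst (asm) has_sum_cong_neutral[where T = "to_nat_on J ` J" and g = "\<lambda>n. measure M (F n)"])
       (auto simp: F_def)
  then have "((\<lambda>n. measure M (F n)) \<circ> to_nat_on J has_sum measure M (\<Union>n. F n)) J"
    using J by (subst (asm) has_sum_reindex) (auto intro: inj_on_to_nat_on)
  moreover have "(\<Union>n. F n) = (\<Union>n\<in>to_nat_on J ` J. F n)"
    by (auto simp: F_def split: if_splits)
  then have "(\<Union>n. F n) = (\<Union>j\<in>J. E j)" using F by simp
  ultimately show ?thesis by (subst (asm) has_sum_cong[where g = "\<lambda>j. measure M (E j)"]) (auto simp: F)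
qed

text \<open>Countable additivity: by \<open>uniq\<close> no configuration lies in two of the cylinders.\<close>

lemma cylinders_has_sum:
  assumes J: "countable J" and p: "0 \<le> p" "p \<le> 1"
    and AB: "\<And>j. j \<in> J \<Longrightarrow> finite (A j) \<and> finite (B j) \<and> A j \<subseteq> I \<and> B j \<subseteq> I \<and> A j \<inter> B j = {}"
    and uniq: "\<And>i j T. i \<in> J \<Longrightarrow> j \<in> J \<Longrightarrow> T \<subseteq> I \<Longrightarrow> A i \<subseteq> T \<Longrightarrow> A j \<subseteq> T \<Longrightarrow> B i \<inter> T = {} \<Longrightarrow>
      B j \<inter> T = {} \<Longrightarrow> i = j"
    and Q: "\<And>\<omega>. \<omega> \<in> space (bernoulli_percolation I p) \<Longrightarrow>
      Q \<omega> \<longleftrightarrow> (\<exists>j\<in>J. A j \<subseteq> occupied I \<omega> \<and> B j \<inter> occupied I \<omega> = {})"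
  shows "{\<omega> \<in> space (bernoulli_percolation I p). Q \<omega>} \<in> sets (bernoulli_percolation I p)"
    and "((\<lambda>j. p ^ card (A j) * (1 - p) ^ card (B j)) has_sum
      measure (bernoulli_percolation I p) {\<omega> \<in> space (bernoulli_percolation I p). Q \<omega>}) J"
proof -
  interpret prob_space "bernoulli_percolation I p" by (rule prob_space_bernoulli_percolation)
  have eq: "{\<omega> \<in> space (bernoulli_percolation I p). Q \<omega>} = (\<Union>j\<in>J. cylinder I p (A j) (B j))"
    using Q by (auto simp: cylinder_def)
  have cyl: "cylinder I p (A j) (B j) \<in> sets (bernoulli_percolation I p)"
    "measure (bernoulli_percolation I p) (cylinder I p (A j) (B j)) = p ^ card (A j) * (1 - p) ^ card (B j)"
    if "j \<in> J" for j using cylinder_law[of "A j" "B j" I p] AB[OF that] p by auto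
  show "{\<omega> \<in> space (bernoulli_percolation I p). Q \<omega>} \<in> sets (bernoulli_percolation I p)"
    unfolding eq using J cyl by (intro sets.countable_UN') auto
  have "disjoint_family_on (\<lambda>j. cylinder I p (A j) (B j)) J"
    unfolding disjoint_family_on_def
  proof (intro ballI impI)
    fix i j assume ij: "i \<in> J" "j \<in> J" "i \<noteq> j"
    have "False" if "\<omega> \<in> cylinder I p (A i) (B i)" "\<omega> \<in> cylinder I p (A j) (B j)" for \<omega>
      using uniq[OF ij(1,2), of "occupied I \<omega>"] ij(3) that by (auto simp: cylinder_def occupied_def)
    then show "cylinder I p (A i) (B i) \<inter> cylinder I p (A j) (B j) = {}" by blast
  qed
  then have "((\<lambda>j. measure (bernoulli_percolation I p) (cylinder I p (A j) (B j))) has_sum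
      measure (bernoulli_percolation I p) (\<Union>j\<in>J. cylinder I p (A j) (B j))) J"
    using J cyl(1) by (intro measure_countable_has_sum)
  also have "?this \<longleftrightarrow> ((\<lambda>j. p ^ card (A j) * (1 - p) ^ card (B j)) has_sum
      measure (bernoulli_percolation I p) (\<Union>j\<in>J. cylinder I p (A j) (B j))) J"
    by (rule has_sum_cong) (rule cyl(2))
  finally show "((\<lambda>j. p ^ card (A j) * (1 - p) ^ card (B j)) has_sum
      measure (bernoulli_percolation I p) {\<omega> \<in> space (bernoulli_percolation I p). Q \<omega>}) J"
    unfolding eq .
qed

text \<open>Exploring from more sources does not change what is found from fewer of them.\<close>

lemma cl_cl_subset:
  assumes "Y \<subseteq> Y'" shows "cl r Y (cl r Y' \<omega>) = cl r Y \<omega>"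
proof
  show "cl r Y (cl r Y' \<omega>) \<subseteq> cl r Y \<omega>" by (rule cl_mono[OF order_refl]) (rule cl_subset)
  have "cl r Y \<omega> = cl r Y (cl r Y \<omega>)" by (rule cl_cl[symmetric])
  also have "\<dots> \<subseteq> cl r Y (cl r Y' \<omega>)" by (rule cl_mono[OF order_refl]) (rule cl_mono[OF assms order_refl])
  finally show "cl r Y \<omega> \<subseteq> cl r Y (cl r Y' \<omega>)" .
qed

context connected_site_graph
begin

text \<open>The possible finite values of the cluster of \<open>Y\<close>.\<close>

definition clusters :: "'i set \<Rightarrow> 'i set set" where
  "clusters Y = {L. finite L \<and> L \<subseteq> I \<and> cl r Y L = L}"

lemma countable_sites: "countable I"
proof (cases "I = {}")
  case False
  then obtain i where i: "i \<in> I" by auto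
  define N where "N n = ((\<lambda>S. r `` S) ^^ n) {i}" for n
  have "finite (N n)" for n by (induction n) (auto simp: N_def intro: finite_nbrs)
  moreover have "j \<in> (\<Union>n. N n)" if "(i, j) \<in> r\<^sup>*" for j using that
  proof (induction rule: rtrancl_induct)
    case base then show ?case by (auto simp: N_def intro!: exI[of _ 0])
  next
    case (step u w)
    then obtain n where "u \<in> N n" by auto
    then have "w \<in> N (Suc n)" using step by (auto simp: N_def)
    then show ?case by blast
  qed
  then have "I \<subseteq> (\<Union>n. N n)" using conn[OF i] by auto
  ultimately show ?thesis by (meson countable_UN countable_finite countable_subset countableI_type)
qed simp

lemma countable_clusters: "countable (clusters Y)"
proof -
  have "clusters Y \<subseteq> {L. finite L \<and> L \<subseteq> I}" by (auto simp: clusters_def)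
  then show ?thesis using countable_Collect_finite_subset[OF countable_sites] countable_subset by blast
qed

lemma cluster_bd:
  assumes "L \<in> clusters Y" "finite Y" "Y \<subseteq> I"
  shows "finite L" "finite (bd r Y L)" "L \<subseteq> I" "bd r Y L \<subseteq> I" "L \<inter> bd r Y L = {}" "cl r Y L = L"
proof -
  show L: "finite L" "L \<subseteq> I" "cl r Y L = L" using assms by (auto simp: clusters_def)
  show "finite (bd r Y L)" using finite_nbrs[OF L(1)] assms(2) by (simp add: bd_def)
  show "bd r Y L \<subseteq> I" "L \<inter> bd r Y L = {}" using assms(3) r_sub by (auto simp: bd_def)
qed

lemma finite_cluster_iff:
  assumes "T \<subseteq> I"
  shows "finite (cl r Y T) \<longleftrightarrow> (\<exists>L\<in>clusters Y. L \<subseteq> T \<and> bd r Y L \<inter> T = {})"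
proof
  assume "finite (cl r Y T)"
  then have "cl r Y T \<in> clusters Y" using cl_cl[of r Y T] cl_subset[of r Y T] assms by (simp add: clusters_def)
  then show "\<exists>L\<in>clusters Y. L \<subseteq> T \<and> bd r Y L \<inter> T = {}"
    by (intro bexI[of _ "cl r Y T"] conjI cl_subset bd_cl)
next
  assume "\<exists>L\<in>clusters Y. L \<subseteq> T \<and> bd r Y L \<inter> T = {}"
  then obtain L where L: "L \<in> clusters Y" "L \<subseteq> T" "bd r Y L \<inter> T = {}" by blast
  then have "cl r Y L = L" by (simp add: clusters_def)
  then have "cl r Y T = L" using L(2,3) by (rule cl_eqI)
  then show "finite (cl r Y T)" using L(1) by (simp add: clusters_def)
qed

lemma cluster_unique:
  assumes "cl r Y L = L" "cl r Y L' = L'" "L \<subseteq> T" "L' \<subseteq> T" "bd r Y L \<inter> T = {}" "bd r Y L' \<inter> T = {}"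
  shows "L = L'"
  by (rule cl_eqI[OF assms(1,3,5), symmetric, THEN trans]) (rule cl_eqI[OF assms(2,4,6)])

definition prob_finite :: "'i set \<Rightarrow> real \<Rightarrow> real" where
  "prob_finite Y p = measure (bernoulli_percolation I p)
     {\<omega> \<in> space (bernoulli_percolation I p). finite (cl r Y (occupied I \<omega>))}"

lemma prob_finite:
  assumes Y: "finite Y" "Y \<subseteq> I" and p: "0 \<le> p" "p \<le> 1"
  shows "{\<omega> \<in> space (bernoulli_percolation I p). finite (cl r Y (occupied I \<omega>))} \<in> sets (bernoulli_percolation I p)"
    and "((\<lambda>L. p ^ card L * (1 - p) ^ card (bd r Y L)) has_sum prob_finite Y p) (clusters Y)"
proof -
  have AB: "finite L \<and> finite (bd r Y L) \<and> L \<subseteq> I \<and> bd r Y L \<subseteq> I \<and> L \<inter> bd r Y L = {}"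
    if "L \<in> clusters Y" for L using cluster_bd[OF that Y] by auto
  have uniq: "L = L'" if "L \<in> clusters Y" "L' \<in> clusters Y" "L \<subseteq> T" "L' \<subseteq> T"
    "bd r Y L \<inter> T = {}" "bd r Y L' \<inter> T = {}" for L L' T
    by (rule cluster_unique[of Y L L' T]) (use that in \<open>auto simp: clusters_def\<close>)
  have Q: "finite (cl r Y (occupied I \<omega>)) \<longleftrightarrow>
    (\<exists>L\<in>clusters Y. L \<subseteq> occupied I \<omega> \<and> bd r Y L \<inter> occupied I \<omega> = {})" for \<omega>
    by (rule finite_cluster_iff) (auto simp: occupied_def)
  show "{\<omega> \<in> space (bernoulli_percolation I p). finite (cl r Y (occupied I \<omega>))} \<in> sets (bernoulli_percolation I p)"
    by (rule cylinders_has_sum(1)[OF countable_clusters p AB uniq Q])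
  show "((\<lambda>L. p ^ card L * (1 - p) ^ card (bd r Y L)) has_sum prob_finite Y p) (clusters Y)"
    unfolding prob_finite_def by (rule cylinders_has_sum(2)[OF countable_clusters p AB uniq Q])
qed

text \<open>The vacant sites form percolation with the complementary parameter.\<close>

lemma prob_finite_vacant:
  assumes Y: "finite Y" "Y \<subseteq> I" and p: "0 \<le> p" "p \<le> 1"
  shows "{\<omega> \<in> space (bernoulli_percolation I p). finite (cl r Y (I - occupied I \<omega>))} \<in> sets (bernoulli_percolation I p)"
    and "measure (bernoulli_percolation I p)
      {\<omega> \<in> space (bernoulli_percolation I p). finite (cl r Y (I - occupied I \<omega>))} = prob_finite Y (1 - p)"
proof -
  have AB: "finite (bd r Y L) \<and> finite L \<and> bd r Y L \<subseteq> I \<and> L \<subseteq> I \<and> bd r Y L \<inter> L = {}"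
    if "L \<in> clusters Y" for L using cluster_bd[OF that Y] by auto
  have uniq: "L = L'" if "L \<in> clusters Y" "L' \<in> clusters Y" "T \<subseteq> I" "bd r Y L \<subseteq> T" "bd r Y L' \<subseteq> T"
    "L \<inter> T = {}" "L' \<inter> T = {}" for L L' T
    by (rule cluster_unique[of Y L L' "I - T"]) (use that in \<open>auto simp: clusters_def\<close>)
  have Q: "finite (cl r Y (I - occupied I \<omega>)) \<longleftrightarrow>
    (\<exists>L\<in>clusters Y. bd r Y L \<subseteq> occupied I \<omega> \<and> L \<inter> occupied I \<omega> = {})" for \<omega>
  proof -
    have "(L \<subseteq> I - occupied I \<omega> \<and> bd r Y L \<inter> (I - occupied I \<omega>) = {}) \<longleftrightarrow>
      (bd r Y L \<subseteq> occupied I \<omega> \<and> L \<inter> occupied I \<omega> = {})" if "L \<in> clusters Y" for L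
      using AB[OF that] by blast
    then show ?thesis by (subst finite_cluster_iff) auto
  qed
  show "{\<omega> \<in> space (bernoulli_percolation I p). finite (cl r Y (I - occupied I \<omega>))} \<in> sets (bernoulli_percolation I p)"
    by (rule cylinders_has_sum(1)[OF countable_clusters p AB uniq Q])
  have "((\<lambda>L. p ^ card (bd r Y L) * (1 - p) ^ card L) has_sum measure (bernoulli_percolation I p)
      {\<omega> \<in> space (bernoulli_percolation I p). finite (cl r Y (I - occupied I \<omega>))}) (clusters Y)"
    by (rule cylinders_has_sum(2)[OF countable_clusters p AB uniq Q])
  moreover have "((\<lambda>L. p ^ card (bd r Y L) * (1 - p) ^ card L) has_sum prob_finite Y (1 - p)) (clusters Y)"
    using prob_finite(2)[OF Y, of "1 - p"] p by (simp add: mult.commute)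
  ultimately show "measure (bernoulli_percolation I p)
      {\<omega> \<in> space (bernoulli_percolation I p). finite (cl r Y (I - occupied I \<omega>))} = prob_finite Y (1 - p)"
    by (rule has_sum_unique)
qed

lemma bexp_cluster:
  assumes "finite R" "L \<union> bd r Y L \<subseteq> R" "cl r Y L = L"
  shows "bexp p R (\<lambda>\<omega>. of_bool (cl r Y \<omega> = L)) = p ^ card L * (1 - p) ^ card (bd r Y L)"
proof -
  have "cl r Y \<omega> = L \<longleftrightarrow> L \<subseteq> \<omega> \<and> bd r Y L \<inter> \<omega> = {}" for \<omega>
    using cl_eq_iff[of r Y \<omega> L] assms(3) by simp
  moreover have "L \<inter> bd r Y L = {}" by (auto simp: bd_def)
  ultimately show ?thesis using assms(1,2) bexp_cylinder[of R L "bd r Y L" p] by simp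
qed

lemma prob_finite_ge:
  assumes Y: "finite Y" "Y \<subseteq> R" and R: "finite R" "R \<subseteq> I" and p: "0 \<le> p" "p \<le> 1"
  shows "1 - bexp p R (\<lambda>\<omega>. of_bool (cl r Y \<omega> \<inter> exits r R \<noteq> {})) \<le> prob_finite Y p"
proof -
  define F where "F = {L. L \<subseteq> R \<and> cl r Y L = L \<and> L \<inter> exits r R = {}}"
  have fF: "finite F" using R by (auto simp: F_def)
  have FR: "L \<union> bd r Y L \<subseteq> R" if "L \<in> F" for L
    using that Y by (auto simp: F_def bd_def exits_def)
  have "1 - bexp p R (\<lambda>\<omega>. of_bool (cl r Y \<omega> \<inter> exits r R \<noteq> {})) =
      bexp p R (\<lambda>\<omega>. 1 - of_bool (cl r Y \<omega> \<inter> exits r R \<noteq> {}))" using R by (simp add: bexp_diff)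
  also have "\<dots> = bexp p R (\<lambda>\<omega>. \<Sum>L\<in>F. of_bool (cl r Y \<omega> = L))"
  proof (intro bexp_cong)
    fix \<omega> assume "\<omega> \<subseteq> R"
    then have "cl r Y \<omega> \<in> F \<longleftrightarrow> cl r Y \<omega> \<inter> exits r R = {}"
      using cl_subset[of r Y \<omega>] by (auto simp: F_def cl_cl)
    moreover have "(\<Sum>L\<in>F. of_bool (cl r Y \<omega> = L)) = (of_bool (cl r Y \<omega> \<in> F) :: real)"
      unfolding of_bool_def using sum.delta'[OF fF, of "cl r Y \<omega>" "\<lambda>_. 1::real"] by simp
    ultimately show "1 - of_bool (cl r Y \<omega> \<inter> exits r R \<noteq> {}) = (\<Sum>L\<in>F. of_bool (cl r Y \<omega> = L) :: real)"
      by (simp add: of_bool_def)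
  qed
  also have "\<dots> = (\<Sum>L\<in>F. p ^ card L * (1 - p) ^ card (bd r Y L))"
    unfolding bexp_sum using FR R by (intro sum.cong refl bexp_cluster) (auto simp: F_def)
  also have "\<dots> \<le> prob_finite Y p"
    using p fF R by (intro finite_sum_le_has_sum[OF prob_finite(2)])
      (use Y in \<open>auto simp: F_def clusters_def intro: finite_subset\<close>)
  finally show ?thesis .
qed

lemma prob_finite_le_1: "prob_finite Y p \<le> 1"
  unfolding prob_finite_def using prob_space_bernoulli_percolation by (rule prob_space.prob_le_1)

text \<open>This links the finite regions with the product measure: the event that the cluster of \<open>Y\<close> is finite is a
countable disjoint union of cylinder events, and finitely many of these carry nearly all of its mass.\<close>

lemma vanishing_iff:
  assumes Y: "finite Y" "Y \<subseteq> I" and p: "0 \<le> p" "p \<le> 1"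
  shows "vanishing p Y \<longleftrightarrow> prob_finite Y p = 1"
proof
  assume v: "vanishing p Y"
  have "1 - \<delta> \<le> prob_finite Y p" if \<delta>: "0 < \<delta>" for \<delta>
  proof -
    obtain R\<^sub>0 where R\<^sub>0: "finite R\<^sub>0" "R\<^sub>0 \<subseteq> I" "\<And>R. finite R \<Longrightarrow> R\<^sub>0 \<subseteq> R \<Longrightarrow> R \<subseteq> I \<Longrightarrow>
      bexp p R (\<lambda>\<omega>. of_bool (cl r Y \<omega> \<inter> exits r R \<noteq> {})) \<le> \<delta>"
      using vanishingE[OF v \<delta>] by metis
    have "bexp p (R\<^sub>0 \<union> Y) (\<lambda>\<omega>. of_bool (cl r Y \<omega> \<inter> exits r (R\<^sub>0 \<union> Y) \<noteq> {})) \<le> \<delta>"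
      by (rule R\<^sub>0(3)) (use R\<^sub>0 Y in auto)
    then show ?thesis using prob_finite_ge[of Y "R\<^sub>0 \<union> Y" p] R\<^sub>0(1,2) Y p by simp
  qed
  then have "1 \<le> prob_finite Y p" by (metis add.commute diff_le_eq field_le_epsilon)
  then show "prob_finite Y p = 1" using prob_finite_le_1[of Y p] by simp
next
  assume 1: "prob_finite Y p = 1"
  show "vanishing p Y"
  proof (rule vanishingI)
    fix \<delta> :: real assume "0 < \<delta>"
    then obtain F where F: "finite F" "F \<subseteq> clusters Y"
      "dist (\<Sum>L\<in>F. p ^ card L * (1 - p) ^ card (bd r Y L)) 1 \<le> \<delta>"
      using has_sum_finite_approximation[OF prob_finite(2)[OF Y p]] 1 by metis
    define R\<^sub>0 where "R\<^sub>0 = (\<Union>L\<in>F. L \<union> r `` L \<union> Y)"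
    have "finite (L \<union> r `` L \<union> Y)" if "L \<in> F" for L
      using finite_nbrs[of L] F that Y by (auto simp: clusters_def)
    then have R\<^sub>0: "finite R\<^sub>0" "R\<^sub>0 \<subseteq> I" using F Y r_sub by (auto simp: R\<^sub>0_def clusters_def)
    have "bexp p R (\<lambda>\<omega>. of_bool (cl r Y \<omega> \<inter> exits r R \<noteq> {})) \<le> \<delta>"
      if R: "finite R" "R\<^sub>0 \<subseteq> R" "R \<subseteq> I" for R
    proof -
      have "bexp p R (\<lambda>\<omega>. of_bool (cl r Y \<omega> \<inter> exits r R \<noteq> {})) \<le>
        bexp p R (\<lambda>\<omega>. 1 - (\<Sum>L\<in>F. of_bool (cl r Y \<omega> = L)))"
      proof (intro bexp_mono p)
        fix \<omega> assume "\<omega> \<subseteq> R"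
        have "(\<Sum>L\<in>F. of_bool (cl r Y \<omega> = L)) = (of_bool (cl r Y \<omega> \<in> F) :: real)"
          unfolding of_bool_def using sum.delta'[OF F(1), of "cl r Y \<omega>" "\<lambda>_. 1::real"] by simp
        moreover have "L \<inter> exits r R = {}" if "L \<in> F" for L
        proof -
          have "r `` L \<subseteq> R" using that R(2) unfolding R\<^sub>0_def by blast
          then show ?thesis by (auto simp: exits_def)
        qed
        ultimately show "of_bool (cl r Y \<omega> \<inter> exits r R \<noteq> {}) \<le> 1 - (\<Sum>L\<in>F. of_bool (cl r Y \<omega> = L) :: real)"
          by (cases "cl r Y \<omega> \<in> F") (auto simp: of_bool_def)
      qed
      also have "\<dots> = 1 - (\<Sum>L\<in>F. p ^ card L * (1 - p) ^ card (bd r Y L))"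
      proof -
        have "bexp p R (\<lambda>\<omega>. of_bool (cl r Y \<omega> = L)) = p ^ card L * (1 - p) ^ card (bd r Y L)"
          if "L \<in> F" for L
        proof (rule bexp_cluster[OF R(1)])
          have "L \<union> r `` L \<union> Y \<subseteq> R" using that R(2) unfolding R\<^sub>0_def by blast
          then show "L \<union> bd r Y L \<subseteq> R" by (auto simp: bd_def)
          show "cl r Y L = L" using that F(2) by (auto simp: clusters_def)
        qed
        then show ?thesis using R(1) by (simp add: bexp_diff bexp_sum)
      qed
      also have "\<dots> \<le> \<delta>" using F(3) by (simp add: dist_real_def)
      finally show ?thesis .
    qed
    then show "\<exists>R\<^sub>0. finite R\<^sub>0 \<and> R\<^sub>0 \<subseteq> I \<and> (\<forall>R. finite R \<longrightarrow> R\<^sub>0 \<subseteq> R \<longrightarrow> R \<subseteq> I \<longrightarrow>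
      bexp p R (\<lambda>\<omega>. of_bool (cl r Y \<omega> \<inter> exits r R \<noteq> {})) \<le> \<delta>)"
      using R\<^sub>0 by (intro exI[of _ R\<^sub>0]) auto
  qed
qed

lemma prob_infinite:
  assumes "finite Y" "Y \<subseteq> I" "0 \<le> p" "p \<le> 1"
  shows "measure (bernoulli_percolation I p)
    {\<omega> \<in> space (bernoulli_percolation I p). infinite (cl r Y (occupied I \<omega>))} = 1 - prob_finite Y p"
proof -
  interpret prob_space "bernoulli_percolation I p" by (rule prob_space_bernoulli_percolation)
  have "{\<omega> \<in> space (bernoulli_percolation I p). infinite (cl r Y (occupied I \<omega>))} =
      space (bernoulli_percolation I p) -
      {\<omega> \<in> space (bernoulli_percolation I p). finite (cl r Y (occupied I \<omega>))}" by auto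
  then show ?thesis using prob_compl[OF prob_finite(1)[OF assms]] by (simp add: prob_finite_def)
qed

end

section \<open>Real analyticity on an interval\<close>

text \<open>The identity theorem, continued along the interval up to its right end point.\<close>

lemma real_analytic_on_zero:
  assumes f: "real_analytic_on f {s<..1}" and t: "s < t" "t \<le> 1" and 0: "\<And>y. s < y \<Longrightarrow> y < t \<Longrightarrow> f y = 0"
  shows "f 1 = 0"
proof -
  define S where "S = {u \<in> {t..1}. \<forall>y. s < y \<and> y < u \<longrightarrow> f y = 0}"
  define w where "w = Sup S"
  have tS: "t \<in> S" using t 0 by (auto simp: S_def)
  have bdd: "bdd_above S" by (rule bdd_aboveI[of _ 1]) (auto simp: S_def)
  have w: "t \<le> w" "w \<le> 1"
    using tS bdd unfolding w_def by (auto intro: cSup_upper cSup_least simp: S_def)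
  have below: "f y = 0" if "s < y" "y < w" for y
    using that less_cSup_iff[of S y] tS bdd by (auto simp: w_def S_def)
  obtain e g where e: "e > 0" and g: "g holomorphic_on ball (complex_of_real w) e"
    and gf: "\<And>y. y \<in> {s<..1} \<Longrightarrow> complex_of_real y \<in> ball (complex_of_real w) e \<Longrightarrow>
      g (complex_of_real y) = complex_of_real (f y)"
    using f w t unfolding real_analytic_on_def by (meson greaterThanAtMost_iff less_le_trans)
  define U where "U = complex_of_real ` {max s (w - e)<..<w}"
  have U: "U \<subseteq> ball (complex_of_real w) e" using e by (auto simp: U_def dist_real_def)
  have lim: "complex_of_real w islimpt U"
    unfolding islimpt_approachable
  proof (intro allI impI)
    fix d :: real assume d: "d > 0"
    define x where "x = w - min d (w - max s (w - e)) / 2"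
    have "max s (w - e) < x" "x < w" "\<bar>x - w\<bar> < d"
      using d e w t by (auto simp: x_def min_def max_def field_simps)
    then show "\<exists>x'\<in>U. x' \<noteq> complex_of_real w \<and> dist x' (complex_of_real w) < d"
      by (intro bexI[of _ "complex_of_real x"]) (auto simp: U_def dist_real_def)
  qed
  have g0: "g z = 0" if "z \<in> ball (complex_of_real w) e" for z
  proof (rule analytic_continuation[OF g open_ball connected_ball U _ lim _ that])
    show "complex_of_real w \<in> ball (complex_of_real w) e" using e by simp
    fix u assume "u \<in> U"
    then obtain y where y: "u = complex_of_real y" "s < y" "w - e < y" "y < w" by (auto simp: U_def)
    then show "g u = 0" using gf[of y] below[of y] U \<open>u \<in> U\<close> w by auto
  qed
  have f0: "f y = 0" if "s < y" "y \<le> 1" "\<bar>y - w\<bar> < e" for y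
    using gf[of y] g0[of "complex_of_real y"] that by (simp add: dist_real_def abs_minus_commute)
  have "w = 1"
  proof (rule ccontr)
    assume "w \<noteq> 1"
    define u where "u = min 1 (w + e / 2)"
    have u: "w < u" "u \<le> 1" "u \<le> w + e / 2" using \<open>w \<noteq> 1\<close> w e by (auto simp: u_def)
    have "f y = 0" if "s < y" "y < u" for y
      using that u e f0[of y] below[of y] by (cases "y < w") auto
    then have "u \<in> S" using u w by (auto simp: S_def)
    then show False using u(1) cSup_upper[OF _ bdd] by (force simp: w_def)
  qed
  then show ?thesis using f0[of 1] t e by simp
qed

lemma real_analytic_on_cong:
  assumes "real_analytic_on f A" "B \<subseteq> A" "\<And>y. y \<in> B \<Longrightarrow> h y = f y"
  shows "real_analytic_on h B"
  unfolding real_analytic_on_def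
proof
  fix x assume "x \<in> B"
  then have "x \<in> A" using assms(2) by auto
  then obtain e g where g: "e > 0" "g holomorphic_on ball (complex_of_real x) e"
    "\<forall>y\<in>A. complex_of_real y \<in> ball (complex_of_real x) e \<longrightarrow> g (complex_of_real y) = complex_of_real (f y)"
    using assms(1) unfolding real_analytic_on_def by blast
  have "\<forall>y\<in>B. complex_of_real y \<in> ball (complex_of_real x) e \<longrightarrow> g (complex_of_real y) = complex_of_real (h y)"
    using g(3) assms(2,3) by (metis subsetD)
  then show "\<exists>r>0. \<exists>g. g holomorphic_on ball (complex_of_real x) r \<and>
      (\<forall>y\<in>B. complex_of_real y \<in> ball (complex_of_real x) r \<longrightarrow> g (complex_of_real y) = complex_of_real (h y))"
    using g(1,2) by blast
qed

text \<open>The weighted arithmetic-geometric mean inequality in the form that separates a size from an event when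
the expectation of their product is estimated.\<close>

lemma young_le:
  fixes l u :: real assumes "0 < l" "0 \<le> u" shows "u \<le> l * u\<^sup>2 + 1 / l"
proof -
  have "0 \<le> (l * u - 1)\<^sup>2 / l" using assms by simp
  also have "\<dots> = l * u\<^sup>2 - 2 * u + 1 / l" using assms by (simp add: power2_eq_square field_simps)
  finally show ?thesis using assms(2) by simp
qed

lemma combine_bounds:
  fixes X N b d :: real assumes "1 \<le> X" "0 < N" "0 \<le> b" "0 \<le> d"
  shows "X * (1 / N * X + b / N * d) \<le> X * X * (1 + b * d) / N"
proof -
  have "0 \<le> b * d" using assms by simp
  from mult_left_mono[OF assms(1) this] have "X + b * d \<le> X * (1 + b * d)" by (simp add: algebra_simps)
  then have "X * (X + b * d) \<le> X * (X * (1 + b * d))" using assms(1) by (intro mult_left_mono) auto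
  then have "X * (X + b * d) / N \<le> X * (X * (1 + b * d)) / N" using assms(2) by (intro divide_right_mono) auto
  moreover have "X * (1 / N * X + b / N * d) = X * (X + b * d) / N"
    using assms(2) by (simp add: field_simps)
  ultimately show ?thesis by (simp add: mult.assoc)
qed

section \<open>Finding a vacant contour by exploration\<close>

text \<open>What the analyticity proof needs to know about the graph. If the cluster of \<open>seed\<close> in the complement of
\<open>\<kappa>\<close> is finite, this is due to a finite connected contour \<open>B \<subseteq> \<kappa>\<close>, which meets one of the sets \<open>src j\<close>
and is not small compared with the \<open>j\<close> for which it does. In the applications \<open>src j\<close> sits at the \<open>j\<close>-th
vertex of a geodesic ray, and \<open>T\<close> represents the orbits of sites.\<close>

locale contour_graph = connected_site_graph I r for I :: "'i set" and r +
  fixes seed :: "'i set" and src :: "nat \<Rightarrow> 'i set" and T :: "'i set" and D a c :: nat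
  assumes infinite_sites: "infinite I"
    and orbit_reps: "finite T" "T \<subseteq> I" "\<And>i. i \<in> I \<Longrightarrow> \<exists>t\<in>T. \<exists>f. site_automorphism f \<and> f t = i"
    and seed: "finite seed" "seed \<subseteq> I" "seed \<noteq> {}"
    and src: "finite (src k)" "src k \<subseteq> I" "card (src k) \<le> D"
    and contour: "\<kappa> \<subseteq> I \<Longrightarrow> finite (cl r seed (I - \<kappa>)) \<Longrightarrow>
      \<exists>B\<subseteq>\<kappa>. finite B \<and> (\<forall>b\<in>B. B \<subseteq> cl r {b} B) \<and> finite (cl r seed (I - B)) \<and>
        (\<exists>j. B \<inter> src j \<noteq> {}) \<and> (\<forall>j. B \<inter> src j \<noteq> {} \<longrightarrow> j \<le> a * card B + c)"
begin

text \<open>The set \<open>\<kappa>\<close> separates \<open>seed\<close> from infinity.\<close>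

definition sep :: "'i set \<Rightarrow> bool" where
  "sep \<kappa> \<longleftrightarrow> finite (cl r seed (I - \<kappa>))"

definition W :: "nat \<Rightarrow> 'i set" where
  "W k = (\<Union>j\<le>k. src j)"

text \<open>The possible outcomes of the exploration: \<open>k\<close> is the first stage at which the vacant cluster of the
sources up to \<open>k\<close> is a separating set, and \<open>L\<close> is that cluster.\<close>

definition J :: "(nat \<times> 'i set) set" where
  "J = {(k, L). L \<in> clusters (W k) \<and> sep L \<and> (\<forall>j<k. \<not> sep (cl r (W j) L))}"

lemma W: "finite (W k)" "W k \<subseteq> I" "src k \<subseteq> W k" "card (W k) \<le> D * (k + 1)"
proof -
  show "finite (W k)" "W k \<subseteq> I" "src k \<subseteq> W k" using src by (auto simp: W_def)
  have "card (W k) \<le> (\<Sum>j\<le>k. card (src j))" unfolding W_def by (rule card_UN_le) simp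
  also have "\<dots> \<le> (\<Sum>j\<le>k. D)" by (intro sum_mono src)
  finally show "card (W k) \<le> D * (k + 1)" by (simp add: mult.commute)
qed

lemma W_mono: "j \<le> k \<Longrightarrow> W j \<subseteq> W k"
  unfolding W_def by (intro UN_mono) auto

lemma sep_mono: "\<kappa> \<subseteq> \<kappa>' \<Longrightarrow> sep \<kappa> \<Longrightarrow> sep \<kappa>'"
  unfolding sep_def by (erule finite_subset[rotated]) (rule cl_mono, auto)

lemma connected_subset_cl:
  assumes "\<And>b. b \<in> B \<Longrightarrow> B \<subseteq> cl r {b} B" "B \<subseteq> \<kappa>" "b \<in> B" "b \<in> cl r Y \<kappa>"
  shows "B \<subseteq> cl r Y \<kappa>"
proof -
  have "B \<subseteq> cl r {b} B" using assms by auto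
  also have "\<dots> \<subseteq> cl r Y \<kappa>" using assms by (intro cl_trans) auto
  finally show ?thesis .
qed

lemma sep_witness:
  assumes "\<kappa> \<subseteq> I" "sep \<kappa>" shows "\<exists>k. sep (cl r (W k) \<kappa>)"
proof -
  obtain B j b where B: "B \<subseteq> \<kappa>" "\<And>b. b \<in> B \<Longrightarrow> B \<subseteq> cl r {b} B" "sep B" "b \<in> B" "b \<in> src j"
    using contour[OF assms(1)] assms(2) unfolding sep_def by blast
  then have "b \<in> W j" "b \<in> \<kappa>" using W(3)[of j] by blast+
  then have "b \<in> cl r (W j) \<kappa>" by (rule cl_source)
  then have "B \<subseteq> cl r (W j) \<kappa>" using connected_subset_cl[OF B(2,1,4)] by auto
  then show ?thesis using sep_mono B(3) by blast
qed

text \<open>A contour \<open>B\<close> inside the revealed cluster is connected, so it lies in the cluster of a single \<open>src i\<close>, and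
\<open>i\<close> cannot be smaller than \<open>k\<close> since \<open>B\<close> would have been found at stage \<open>i\<close>. For the same reason \<open>B\<close>
does not meet \<open>src j\<close> with \<open>j < k\<close>; as it meets some \<open>src j\<close>, it has size of order at least \<open>k\<close>.\<close>

lemma first_sep_large:
  assumes \<kappa>: "\<kappa> \<subseteq> I" and s: "sep (cl r (W k) \<kappa>)" "\<And>j. j < k \<Longrightarrow> \<not> sep (cl r (W j) \<kappa>)"
    and fin: "finite (cl r (W k) \<kappa>)"
  shows "k \<le> a * card (cl r (src k) \<kappa>) + c"
proof -
  let ?L = "cl r (W k) \<kappa>"
  have L: "?L \<subseteq> \<kappa>" by (rule cl_subset)
  have "\<exists>B\<subseteq>?L. finite B \<and> (\<forall>b\<in>B. B \<subseteq> cl r {b} B) \<and> sep B \<and>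
        (\<exists>j. B \<inter> src j \<noteq> {}) \<and> (\<forall>j. B \<inter> src j \<noteq> {} \<longrightarrow> j \<le> a * card B + c)"
    using contour[of ?L] s(1) L \<kappa> unfolding sep_def by auto
  then obtain B j b where B: "B \<subseteq> ?L" "\<And>b. b \<in> B \<Longrightarrow> B \<subseteq> cl r {b} B" "sep B" "b \<in> B" "b \<in> src j"
    "j \<le> a * card B + c" by blast
  have not: "\<not> B \<subseteq> cl r (W i) \<kappa>" if "i < k" for i using s(2)[OF that] sep_mono B(3) by blast
  have in_src: "B \<subseteq> cl r (src i) \<kappa>" if "b \<in> cl r (src i) \<kappa>" for i
    using connected_subset_cl[OF B(2) _ B(4) that] B(1) L by auto
  have srcW: "cl r (src i) \<kappa> \<subseteq> cl r (W i) \<kappa>" for i using W(3) by (intro cl_mono) auto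
  have "b \<in> cl r (src j) \<kappa>" using B L by (auto intro: cl_source)
  then have "k \<le> j" using in_src[of j] not[of j] srcW[of j] by force
  have "b \<in> (\<Union>y\<in>W k. cl r {y} \<kappa>)" using B(1,4) cl_UN[of r "W k" \<kappa>] by auto
  then obtain i where i: "i \<le> k" "b \<in> cl r (src i) \<kappa>" using cl_UN[of r "src _" \<kappa>] by (fastforce simp: W_def)
  then have "i = k" using in_src[of i] not[of i] srcW[of i] by force
  then have "B \<subseteq> cl r (src k) \<kappa>" using in_src i by auto
  moreover have "finite (cl r (src k) \<kappa>)" using srcW[of k] fin finite_subset by blast
  ultimately have "card B \<le> card (cl r (src k) \<kappa>)" by (intro card_mono)
  then have "a * card B \<le> a * card (cl r (src k) \<kappa>)" by simp
  then show ?thesis using \<open>k \<le> j\<close> B(6) by linarith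
qed

lemma J_bd:
  assumes "(k, L) \<in> J"
  shows "finite L" "finite (bd r (W k) L)" "L \<subseteq> I" "bd r (W k) L \<subseteq> I" "bd r (W k) L \<inter> L = {}"
    "cl r (W k) L = L" "sep L" "\<And>j. j < k \<Longrightarrow> \<not> sep (cl r (W j) L)"
  using cluster_bd[of L "W k"] W(1,2)[of k] assms by (auto simp: J_def)

text \<open>By \<open>fin\<close> the exploration almost surely reveals finite clusters only. So up to a null set the cluster of \<open>seed\<close> is finite if and only if the exploration stops at some stage, and
distinct outcomes are disjoint cylinder events.\<close>

lemma prob_finite_contours:
  assumes p: "0 \<le> p" "p \<le> 1" and fin: "\<And>k. prob_finite (W k) (1 - p) = 1"
  shows "((\<lambda>(k, L). p ^ card (bd r (W k) L) * (1 - p) ^ card L) has_sum prob_finite seed p) J"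
proof -
  let ?M = "bernoulli_percolation I p"
  interpret prob_space ?M by (rule prob_space_bernoulli_percolation)
  define A where "A = (\<lambda>(k, L). bd r (W k) L)"
  define B where "B = (\<lambda>(k :: nat, L :: 'i set). L)"
  define Q where "Q \<omega> \<longleftrightarrow> (\<exists>j\<in>J. A j \<subseteq> occupied I \<omega> \<and> B j \<inter> occupied I \<omega> = {})" for \<omega>
  have "countable J"
    by (rule countable_subset[of _ "UNIV \<times> {L. finite L \<and> L \<subseteq> I}"])
      (auto simp: J_def clusters_def intro!: countable_SIGMA countable_Collect_finite_subset countable_sites)
  have AB: "finite (A j) \<and> finite (B j) \<and> A j \<subseteq> I \<and> B j \<subseteq> I \<and> A j \<inter> B j = {}" if "j \<in> J" for j
    using J_bd[of "fst j" "snd j"] that by (auto simp: A_def B_def split: prod.splits)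
  have is_cl: "cl r (W k) (I - S) = L" if "(k, L) \<in> J" "A (k, L) \<subseteq> S" "B (k, L) \<inter> S = {}" for k L S
    using that J_bd[OF that(1)] by (intro cl_eqI[OF J_bd(6)[OF that(1)]]) (auto simp: A_def B_def)
  have uniq: "i = j" if ij: "i \<in> J" "j \<in> J" "S \<subseteq> I" "A i \<subseteq> S" "A j \<subseteq> S" "B i \<inter> S = {}" "B j \<inter> S = {}" for i j S
  proof -
    obtain k L where i: "i = (k, L)" by force
    obtain k' L' where j: "j = (k', L')" by force
    have L: "cl r (W k) (I - S) = L" "cl r (W k') (I - S) = L'" using is_cl ij by (auto simp: i j)
    have "\<not> m < n" if "(m, M) \<in> J" "(n, N) \<in> J" "cl r (W m) (I - S) = M" "cl r (W n) (I - S) = N" for m n M N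
    proof
      assume "m < n"
      then have "\<not> sep (cl r (W m) N)" using J_bd(8)[OF that(2)] by auto
      moreover have "cl r (W m) N = M" using that(3,4) cl_cl_subset[OF W_mono, of m n r "I - S"] \<open>m < n\<close> by auto
      ultimately show False using J_bd(7)[OF that(1)] by simp
    qed
    from this[of k L k' L'] this[of k' L' k L] have "k = k'" using ij L by (simp add: i j)
    then show ?thesis using L by (simp add: i j)
  qed
  have sets: "{\<omega> \<in> space ?M. Q \<omega>} \<in> sets ?M"
    by (rule cylinders_has_sum(1)[OF \<open>countable J\<close> p AB uniq Q_def])
  have sum: "((\<lambda>j. p ^ card (A j) * (1 - p) ^ card (B j)) has_sum prob {\<omega> \<in> space ?M. Q \<omega>}) J"
    by (rule cylinders_has_sum(2)[OF \<open>countable J\<close> p AB uniq Q_def])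
  have "AE \<omega> in ?M. finite (cl r (W k) (I - occupied I \<omega>))" for k
  proof -
    have "prob {\<omega> \<in> space ?M. finite (cl r (W k) (I - occupied I \<omega>))} = 1"
      using prob_finite_vacant(2)[OF W(1,2) p] fin by simp
    from AE_prob_1[OF this] show ?thesis by eventually_elim auto
  qed
  then have "AE \<omega> in ?M. \<forall>k. finite (cl r (W k) (I - occupied I \<omega>))" by (simp add: AE_all_countable)
  then have "AE \<omega> in ?M. \<omega> \<in> {\<omega> \<in> space ?M. Q \<omega>} \<longleftrightarrow> \<omega> \<in> {\<omega> \<in> space ?M. finite (cl r seed (occupied I \<omega>))}"
  proof eventually_elim
    case (elim \<omega>)
    let ?\<kappa> = "I - occupied I \<omega>"
    have occ: "I - ?\<kappa> = occupied I \<omega>" by (auto simp: occupied_def)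
    have "Q \<omega> \<longleftrightarrow> sep ?\<kappa>"
    proof
      assume "Q \<omega>"
      then obtain k L where kL: "(k, L) \<in> J" "A (k, L) \<subseteq> occupied I \<omega>" "B (k, L) \<inter> occupied I \<omega> = {}"
        by (auto simp: Q_def)
      then have "L \<subseteq> ?\<kappa>" using J_bd(3)[OF kL(1)] by (auto simp: B_def)
      then show "sep ?\<kappa>" using sep_mono J_bd(7)[OF kL(1)] by blast
    next
      assume "sep ?\<kappa>"
      define k where "k = (LEAST k. sep (cl r (W k) ?\<kappa>))"
      define L where "L = cl r (W k) ?\<kappa>"
      have "sep L" unfolding L_def k_def using sep_witness[OF _ \<open>sep ?\<kappa>\<close>] by (auto intro: LeastI_ex)
      moreover have "\<not> sep (cl r (W j) L)" if "j < k" for j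
        using not_less_Least[of j "\<lambda>k. sep (cl r (W k) ?\<kappa>)"] that W_mono[of j k]
          cl_cl_subset[of "W j" "W k" r ?\<kappa>] by (auto simp: L_def k_def)
      moreover have "L \<in> clusters (W k)"
        using elim cl_subset[of r "W k" ?\<kappa>] by (auto simp: L_def clusters_def cl_cl)
      ultimately have "(k, L) \<in> J" by (simp add: J_def)
      moreover have "A (k, L) \<subseteq> occupied I \<omega>"
        using bd_cl[of r "W k" ?\<kappa>] J_bd(4)[OF \<open>(k, L) \<in> J\<close>] by (auto simp: A_def L_def)
      moreover have "B (k, L) \<inter> occupied I \<omega> = {}"
        using cl_subset[of r "W k" ?\<kappa>] by (auto simp: B_def L_def)
      ultimately show "Q \<omega>" by (auto simp: Q_def)
    qed
    then show ?case by (simp add: sep_def occ)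
  qed
  then have "prob {\<omega> \<in> space ?M. Q \<omega>} = prob_finite seed p"
    unfolding prob_finite_def using sets prob_finite(1)[OF seed(1,2) p] by (intro finite_measure_eq_AE)
  then have "((\<lambda>j. p ^ card (A j) * (1 - p) ^ card (B j)) has_sum prob_finite seed p) J" using sum by simp
  then show ?thesis by (rule has_sum_cong[THEN iffD1, rotated]) (auto simp: A_def B_def)
qed

end

section \<open>Analyticity above the dual threshold\<close>

context contour_graph
begin

lemma degree_bound: "\<exists>\<Delta>. \<forall>L. finite L \<longrightarrow> L \<subseteq> I \<longrightarrow> card (r `` L) \<le> \<Delta> * card L"
proof -
  obtain \<Delta> where 1: "\<forall>i\<in>I. card (r `` {i}) \<le> \<Delta>"
    using bounded_degree[OF orbit_reps] by (rule exE)
  have "card (r `` L) \<le> \<Delta> * card L" if L: "finite L" "L \<subseteq> I" for L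
  proof -
    have "card (r `` L) \<le> (\<Sum>i\<in>L. card (r `` {i}))" by (subst Image_eq_UN) (rule card_UN_le[OF L(1)])
    also have "\<dots> \<le> (\<Sum>i\<in>L. \<Delta>)" using 1 L by (intro sum_mono) auto
    finally show ?thesis by (simp add: mult.commute)
  qed
  then show ?thesis by blast
qed

lemma moments_upto:
  assumes v: "vanishing p' seed" and q1: "0 \<le> q1" "q1 < p'" "p' \<le> 1" and e: "0 < e"
  shows "\<exists>\<rho>>1. \<forall>q R Y. 0 \<le> q \<longrightarrow> q \<le> q1 \<longrightarrow> finite R \<longrightarrow> R \<subseteq> I \<longrightarrow> finite Y \<longrightarrow>
    bexp q R (\<lambda>\<omega>. \<rho> ^ card (cl r Y \<omega>)) \<le> (1 + e) ^ card Y"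
proof -
  obtain \<rho> where \<rho>: "\<rho> > 1" "\<And>R Y. finite R \<Longrightarrow> R \<subseteq> I \<Longrightarrow> finite Y \<Longrightarrow>
      bexp q1 R (\<lambda>\<omega>. \<rho> ^ card (cl r Y \<omega>)) \<le> (1 + e) ^ card Y"
    using subcritical_exponential_moments[OF v q1 seed(2,3) orbit_reps e] by metis
  have "bexp q R (\<lambda>\<omega>. \<rho> ^ card (cl r Y \<omega>)) \<le> (1 + e) ^ card Y"
    if "0 \<le> q" "q \<le> q1" "finite R" "R \<subseteq> I" "finite Y" for q R Y
  proof (rule order_trans[OF bexp_mono_param \<rho>(2)])
    fix \<omega> \<omega>' assume o: "\<omega> \<subseteq> \<omega>'" "\<omega>' \<subseteq> R"
    have "finite (cl r Y \<omega>')" using cl_subset[of r Y \<omega>'] o that(3) by (meson finite_subset)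
    then show "\<rho> ^ card (cl r Y \<omega>) \<le> \<rho> ^ card (cl r Y \<omega>')"
      using \<rho>(1) cl_mono[OF order_refl o(1), of r Y] by (intro power_increasing card_mono) auto
  qed (use that q1 in auto)
  then show ?thesis using \<rho>(1) by (intro exI[of _ \<rho>]) auto
qed

text \<open>In terms of a finite region with closed sites of density \<open>q\<close>, the left hand side is at most the expectation of
\<open>\<rho> ^ n\<close> on the event that the exploration stops at stage \<open>k\<close>, with \<open>n\<close> the number of revealed sites. On
that event the cluster of \<open>src k\<close> has size at least of order \<open>k\<close>, so that the \<open>\<tau>\<close>-moment makes its probability
at most of order \<open>\<nu> ^ (- 4 * k)\<close>. The moment of the size of all revealed clusters grows by a factor close
to 1 with each stage. The inequality \<open>young_le\<close> with weight \<open>\<nu> ^ (- 2 * k)\<close> combines the two estimates.\<close>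

lemma barrier_bound:
  assumes v: "vanishing p' seed" and q1: "0 \<le> q1" "q1 < p'" "p' \<le> 1"
  shows "\<exists>\<rho> K \<nu>. 1 < \<rho> \<and> 1 < \<nu> \<and> (\<forall>q k F. 0 \<le> q \<longrightarrow> q \<le> q1 \<longrightarrow> finite F \<longrightarrow> (\<forall>L\<in>F. (k, L) \<in> J) \<longrightarrow>
    (\<Sum>L\<in>F. (\<rho> * q) ^ card L * (\<rho> * (1 - q)) ^ card (bd r (W k) L)) \<le> K * (1 / \<nu>) ^ k)"
proof -
  obtain \<tau> where \<tau>: "\<tau> > 1" and mom\<tau>: "\<And>q R Y. 0 \<le> q \<Longrightarrow> q \<le> q1 \<Longrightarrow> finite R \<Longrightarrow> R \<subseteq> I \<Longrightarrow> finite Y \<Longrightarrow>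
      bexp q R (\<lambda>\<omega>. \<tau> ^ card (cl r Y \<omega>)) \<le> (1 + 1) ^ card Y"
    using moments_upto[OF v q1, of 1] by auto
  obtain \<Delta> where \<Delta>: "\<And>L. finite L \<Longrightarrow> L \<subseteq> I \<Longrightarrow> card (r `` L) \<le> \<Delta> * card L" using degree_bound by blast
  \<comment> \<open>The exponent uses \<open>a + 1\<close> instead of \<open>a\<close> so that the order of the root is positive even for \<open>a = 0\<close>; likewise \<open>D + 1\<close> below.\<close>
  define \<nu> where "\<nu> = root (4 * (a + 1)) \<tau>"
  have \<nu>: "1 < \<nu>" using \<tau> by (simp add: \<nu>_def)
  have \<nu>\<tau>: "\<nu> ^ (4 * (a + 1)) = \<tau>" unfolding \<nu>_def using \<tau> by (intro real_root_pow_pos2) auto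
  define e where "e = root (2 * (D + 1)) \<nu> - 1"
  have e: "0 < e" using \<nu> by (simp add: e_def)
  have e\<nu>: "(1 + e) ^ (2 * (D + 1)) = \<nu>" unfolding e_def using \<nu> by (simp del: power_Suc add: real_root_pow_pos2)
  obtain \<mu> where \<mu>: "\<mu> > 1" and mom\<mu>: "\<And>q R Y. 0 \<le> q \<Longrightarrow> q \<le> q1 \<Longrightarrow> finite R \<Longrightarrow> R \<subseteq> I \<Longrightarrow> finite Y \<Longrightarrow>
      bexp q R (\<lambda>\<omega>. \<mu> ^ card (cl r Y \<omega>)) \<le> (1 + e) ^ card Y"
    using moments_upto[OF v q1 e] by metis
  define \<rho> where "\<rho> = min (1 + e) (root (2 * (\<Delta> + 1)) \<mu>)"
  have \<rho>: "1 < \<rho>" "\<rho> \<le> 1 + e" using e \<mu> by (auto simp: \<rho>_def)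
  have "\<rho> ^ (2 * (\<Delta> + 1)) \<le> root (2 * (\<Delta> + 1)) \<mu> ^ (2 * (\<Delta> + 1))"
    using \<rho>(1) by (intro power_mono) (auto simp: \<rho>_def)
  also have "\<dots> = \<mu>" using \<mu> by (intro real_root_pow_pos2) auto
  finally have \<rho>\<mu>: "\<rho> ^ (2 * (\<Delta> + 1)) \<le> \<mu>" .
  define K where "K = \<nu> * (1 + \<nu> ^ (4 * c) * 2 ^ D)"
  have main: "(\<Sum>L\<in>F. (\<rho> * q) ^ card L * (\<rho> * (1 - q)) ^ card (bd r (W k) L)) \<le> K * (1 / \<nu>) ^ k"
    if q: "0 \<le> q" "q \<le> q1" and F: "finite F" "\<And>L. L \<in> F \<Longrightarrow> (k, L) \<in> J" for q k F
  proof -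
    define R where "R = src k \<union> W k \<union> (\<Union>L\<in>F. L \<union> bd r (W k) L)"
    have R: "finite R" using F(1) J_bd(1,2)[OF F(2)] src(1) W(1) unfolding R_def by blast
    have RI: "R \<subseteq> I" using J_bd(3,4)[OF F(2)] src(2) W(2) unfolding R_def by blast
    note R = R RI
    define n where "n L = card L + card (bd r (W k) L)" for L
    have q': "q \<le> 1" using q q1 by auto
    have nle: "n L \<le> (\<Delta> + 1) * card L + D * (k + 1)" if "L \<in> F" for L
    proof -
      note bd = J_bd[OF F(2)[OF that]]
      have "finite (W k \<union> r `` L)" using W(1)[of k] finite_nbrs[OF bd(1)] by simp
      then have "card (bd r (W k) L) \<le> card (W k \<union> r `` L)" by (rule card_mono) (auto simp: bd_def)
      also have "\<dots> \<le> card (W k) + card (r `` L)" by (rule card_Un_le)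
      also have "\<dots> \<le> D * (k + 1) + \<Delta> * card L" using W(4) \<Delta>[OF bd(1,3)] by (rule add_mono)
      finally show ?thesis by (simp add: n_def)
    qed
    have "(\<Sum>L\<in>F. (\<rho> * q) ^ card L * (\<rho> * (1 - q)) ^ card (bd r (W k) L)) =
        (\<Sum>L\<in>F. \<rho> ^ n L * bexp q R (\<lambda>\<omega>. of_bool (cl r (W k) \<omega> = L)))"
    proof (rule sum.cong[OF refl])
      fix L assume "L \<in> F"
      then have "bexp q R (\<lambda>\<omega>. of_bool (cl r (W k) \<omega> = L)) = q ^ card L * (1 - q) ^ card (bd r (W k) L)"
        using J_bd(6)[OF F(2)] R(1) by (intro bexp_cluster) (auto simp: R_def)
      then show "(\<rho> * q) ^ card L * (\<rho> * (1 - q)) ^ card (bd r (W k) L) =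
          \<rho> ^ n L * bexp q R (\<lambda>\<omega>. of_bool (cl r (W k) \<omega> = L))"
        by (simp add: n_def power_add power_mult_distrib)
    qed
    also have "\<dots> = bexp q R (\<lambda>\<omega>. \<Sum>L\<in>F. \<rho> ^ n L * of_bool (cl r (W k) \<omega> = L))"
      by (simp add: bexp_sum bexp_cmult)
    also have "\<dots> \<le> bexp q R (\<lambda>\<omega>. \<rho> ^ (D * (k + 1)) * ((1 / \<nu> ^ (2 * k)) * \<mu> ^ card (cl r (W k) \<omega>)
        + (\<nu> ^ (4 * c) / \<nu> ^ (2 * k)) * \<tau> ^ card (cl r (src k) \<omega>)))"
    proof (intro bexp_mono q(1) q')
      fix \<omega> assume o: "\<omega> \<subseteq> R"
      let ?L = "cl r (W k) \<omega>" and ?m = "card (cl r (src k) \<omega>)"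
      have nonneg: "0 \<le> \<rho> ^ (D * (k + 1)) * ((1 / \<nu> ^ (2 * k)) * \<mu> ^ card ?L
        + (\<nu> ^ (4 * c) / \<nu> ^ (2 * k)) * \<tau> ^ ?m)"
        using \<rho>(1) \<nu> \<mu> \<tau> by (intro mult_nonneg_nonneg add_nonneg_nonneg) auto
      show "(\<Sum>L\<in>F. \<rho> ^ n L * of_bool (?L = L)) \<le> \<rho> ^ (D * (k + 1)) * ((1 / \<nu> ^ (2 * k)) * \<mu> ^ card ?L
        + (\<nu> ^ (4 * c) / \<nu> ^ (2 * k)) * \<tau> ^ ?m)"
      proof (cases "?L \<in> F")
        case False
        then have "(\<Sum>L\<in>F. \<rho> ^ n L * of_bool (?L = L)) = 0" by (intro sum.neutral) auto
        then show ?thesis using nonneg by simp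
      next
        case True
        have "(\<Sum>L\<in>F. \<rho> ^ n L * of_bool (?L = L)) = (\<Sum>L\<in>F. if ?L = L then \<rho> ^ n L else 0)"
          by (intro sum.cong) auto
        also have "\<dots> = \<rho> ^ n ?L" using True F(1) by simp
        also have "\<dots> \<le> \<rho> ^ ((\<Delta> + 1) * card ?L + D * (k + 1))"
          using nle[OF True] \<rho>(1) by (intro power_increasing) auto
        also have "\<dots> = \<rho> ^ (D * (k + 1)) * \<rho> ^ ((\<Delta> + 1) * card ?L)" by (simp add: power_add mult.commute)
        also have "\<dots> \<le> \<rho> ^ (D * (k + 1)) * ((1 / \<nu> ^ (2 * k)) * \<mu> ^ card ?L
            + (\<nu> ^ (4 * c) / \<nu> ^ (2 * k)) * \<tau> ^ ?m)"
        proof (intro mult_left_mono)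
          let ?u = "\<rho> ^ ((\<Delta> + 1) * card ?L)" and ?l = "1 / \<nu> ^ (2 * k)"
          have kJ: "(k, ?L) \<in> J" using F(2)[OF True] .
          have "k \<le> a * ?m + c"
          proof (rule first_sep_large)
            show "\<omega> \<subseteq> I" using o R by auto
            show "sep ?L" "finite ?L" using J_bd[OF kJ] by auto
            fix j assume j: "j < k"
            then have "\<not> sep (cl r (W j) ?L)" by (rule J_bd(8)[OF kJ])
            then show "\<not> sep (cl r (W j) \<omega>)" using cl_cl_subset[OF W_mono, of j k r \<omega>] j by simp
          qed
          then have "k \<le> (a + 1) * ?m + c" by simp
          then have "\<nu> ^ (4 * k) \<le> \<nu> ^ (4 * ((a + 1) * ?m + c))" using \<nu> by (intro power_increasing) auto
          also have "\<dots> = (\<nu> ^ (4 * (a + 1))) ^ ?m * \<nu> ^ (4 * c)"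
            by (simp add: power_add power_mult[symmetric] algebra_simps)
          also have "\<dots> = \<tau> ^ ?m * \<nu> ^ (4 * c)" by (simp only: \<nu>\<tau>)
          finally have "\<nu> ^ (2 * k) * \<nu> ^ (2 * k) \<le> \<nu> ^ (4 * c) * \<tau> ^ ?m"
            by (simp add: mult.commute flip: power_add)
          then have 1: "\<nu> ^ (2 * k) \<le> (\<nu> ^ (4 * c) / \<nu> ^ (2 * k)) * \<tau> ^ ?m"
            using \<nu> by (simp add: field_simps)
          have u: "1 \<le> ?u" using \<rho>(1) by simp
          have l: "0 < ?l" using \<nu> by simp
          have "?u \<le> ?l * ?u\<^sup>2 + 1 / ?l" using l u by (intro young_le) auto
          also have "?u\<^sup>2 = (\<rho> ^ (2 * (\<Delta> + 1))) ^ card ?L" by (simp only: power_mult[symmetric] mult_ac)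
          also have "?l * \<dots> \<le> ?l * \<mu> ^ card ?L"
            using l \<rho>\<mu> \<rho>(1) by (intro mult_left_mono power_mono) auto
          also have "1 / ?l \<le> (\<nu> ^ (4 * c) / \<nu> ^ (2 * k)) * \<tau> ^ ?m" using 1 by simp
          finally show "?u \<le> ?l * \<mu> ^ card ?L + (\<nu> ^ (4 * c) / \<nu> ^ (2 * k)) * \<tau> ^ ?m" by simp
        qed (use \<rho> in simp)
        finally show ?thesis .
      qed
    qed
    also have "\<dots> = \<rho> ^ (D * (k + 1)) * ((1 / \<nu> ^ (2 * k)) * bexp q R (\<lambda>\<omega>. \<mu> ^ card (cl r (W k) \<omega>))
        + (\<nu> ^ (4 * c) / \<nu> ^ (2 * k)) * bexp q R (\<lambda>\<omega>. \<tau> ^ card (cl r (src k) \<omega>)))"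
      by (simp only: bexp_cmult bexp_add)
    also have "\<dots> \<le> (1 + e) ^ (D * (k + 1)) * ((1 / \<nu> ^ (2 * k)) * (1 + e) ^ (D * (k + 1))
        + (\<nu> ^ (4 * c) / \<nu> ^ (2 * k)) * 2 ^ D)"
    proof (intro mult_mono add_mono)
      have "bexp q R (\<lambda>\<omega>. \<mu> ^ card (cl r (W k) \<omega>)) \<le> (1 + e) ^ card (W k)" by (rule mom\<mu>[OF q R W(1)])
      also have "\<dots> \<le> (1 + e) ^ (D * (k + 1))" using e by (intro power_increasing W(4)) auto
      finally show "bexp q R (\<lambda>\<omega>. \<mu> ^ card (cl r (W k) \<omega>)) \<le> (1 + e) ^ (D * (k + 1))" .
      have "bexp q R (\<lambda>\<omega>. \<tau> ^ card (cl r (src k) \<omega>)) \<le> (1 + 1) ^ card (src k)" by (rule mom\<tau>[OF q R src(1)])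
      also have "\<dots> \<le> (1 + 1) ^ D" by (intro power_increasing src(3)) auto
      finally show "bexp q R (\<lambda>\<omega>. \<tau> ^ card (cl r (src k) \<omega>)) \<le> 2 ^ D" by simp
      have nn: "0 \<le> bexp q R (\<lambda>\<omega>. x ^ card (f \<omega>))" if "0 \<le> x" for x and f :: "'i set \<Rightarrow> 'i set"
        using bexp_mono[OF q(1) q', of R "\<lambda>_. 0" "\<lambda>\<omega>. x ^ card (f \<omega>)"] that R(1) by simp
      show "0 \<le> (1 / \<nu> ^ (2 * k)) * bexp q R (\<lambda>\<omega>. \<mu> ^ card (cl r (W k) \<omega>))
        + (\<nu> ^ (4 * c) / \<nu> ^ (2 * k)) * bexp q R (\<lambda>\<omega>. \<tau> ^ card (cl r (src k) \<omega>))"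
        using \<nu> \<mu> \<tau> by (intro add_nonneg_nonneg mult_nonneg_nonneg nn) auto
      show "0 \<le> bexp q R (\<lambda>\<omega>. \<mu> ^ card (cl r (W k) \<omega>))" "0 \<le> bexp q R (\<lambda>\<omega>. \<tau> ^ card (cl r (src k) \<omega>))"
        using \<mu> \<tau> by (auto intro!: nn)
    qed (use \<rho> e \<nu> in \<open>auto intro: power_mono\<close>)
    also have "\<dots> \<le> (1 + e) ^ (2 * D * (k + 1)) * (1 + \<nu> ^ (4 * c) * 2 ^ D) / \<nu> ^ (2 * k)"
    proof -
      have "2 * D * (k + 1) = D * (k + 1) + D * (k + 1)" by simp
      then have X: "(1 + e) ^ (2 * D * (k + 1)) = (1 + e) ^ (D * (k + 1)) * (1 + e) ^ (D * (k + 1))"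
        by (simp only: power_add)
      show ?thesis unfolding X using e \<nu> by (intro combine_bounds) auto
    qed
    also have "\<dots> \<le> \<nu> ^ (k + 1) * (1 + \<nu> ^ (4 * c) * 2 ^ D) / \<nu> ^ (2 * k)"
    proof (intro divide_right_mono mult_right_mono)
      have "(1 + e) ^ (2 * D * (k + 1)) \<le> (1 + e) ^ (2 * (D + 1) * (k + 1))" using e by (intro power_increasing) auto
      also have "\<dots> = \<nu> ^ (k + 1)" by (simp only: power_mult[of _ "2 * (D + 1)"] e\<nu>)
      finally show "(1 + e) ^ (2 * D * (k + 1)) \<le> \<nu> ^ (k + 1)" .
    qed (use \<nu> in auto)
    also have "\<dots> = K * (1 / \<nu>) ^ k"
    proof -
      have "\<nu> ^ (2 * k) = \<nu> ^ k * \<nu> ^ k" by (simp add: mult_2 power_add)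
      then show ?thesis using \<nu> by (simp add: K_def power_divide)
    qed
    finally show ?thesis .
  qed
  have "\<forall>q k F. 0 \<le> q \<longrightarrow> q \<le> q1 \<longrightarrow> finite F \<longrightarrow> (\<forall>L\<in>F. (k, L) \<in> J) \<longrightarrow>
      (\<Sum>L\<in>F. (\<rho> * q) ^ card L * (\<rho> * (1 - q)) ^ card (bd r (W k) L)) \<le> K * (1 / \<nu>) ^ k"
  proof (intro allI impI)
    fix q k F assume "0 \<le> q" "q \<le> q1" "finite F" "\<forall>L\<in>F. (k, L) \<in> J"
    then show "(\<Sum>L\<in>F. (\<rho> * q) ^ card L * (\<rho> * (1 - q)) ^ card (bd r (W k) L)) \<le> K * (1 / \<nu>) ^ k"
      by (intro main) simp_all
  qed
  then show ?thesis by (intro exI[of _ \<rho>] exI[of _ K] exI[of _ \<nu>] conjI \<rho>(1) \<nu>)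
qed

text \<open>The series is compared with its value at a real parameter \<open>p0\<close> slightly below \<open>p\<close>. For complex \<open>z\<close> near
\<open>p\<close> both \<open>norm z \<le> \<rho> * p0\<close> and \<open>norm (1 - z) \<le> \<rho> * (1 - p0)\<close> hold. Moving away from \<open>p\<close> is what makes
the second inequality possible at \<open>p = 1\<close>.\<close>

lemma analytic_above:
  assumes v: "vanishing p' seed" and p': "0 < p'" "p' \<le> 1"
  shows "real_analytic_on (\<lambda>p. 1 - prob_finite seed p) {1 - p'<..1}"
  unfolding real_analytic_on_def
proof (intro ballI)
  fix p assume "p \<in> {1 - p'<..1}"
  then have p: "1 - p' < p" "p \<le> 1" by auto
  define q1 where "q1 = (1 - p + p') / 2"
  have q1: "0 \<le> q1" "q1 < p'" "1 - p < q1" using p p' by (auto simp: q1_def)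
  obtain \<rho> K \<nu> where \<rho>: "1 < \<rho>" and \<nu>: "1 < \<nu>"
    and bound: "\<forall>q k F. 0 \<le> q \<longrightarrow> q \<le> q1 \<longrightarrow> finite F \<longrightarrow> (\<forall>L\<in>F. (k, L) \<in> J) \<longrightarrow>
      (\<Sum>L\<in>F. (\<rho> * q) ^ card L * (\<rho> * (1 - q)) ^ card (bd r (W k) L)) \<le> K * (1 / \<nu>) ^ k"
    using barrier_bound[OF v q1(1,2) p'(2)] by (elim exE conjE) (rule that)
  have pos: "0 < p" using p p' by auto
  have "p / \<rho> < p" using pos \<rho> by (simp add: field_simps)
  define m where "m = max (1 - q1) (p / \<rho>)"
  have m: "1 - q1 \<le> m" "p / \<rho> \<le> m" "m < p" using q1(3) \<open>p / \<rho> < p\<close> by (auto simp: m_def)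
  \<comment> \<open>\<open>p0\<close> is chosen with \<open>p < \<rho> * p0\<close>, and so close to \<open>p\<close> that \<open>barrier_bound\<close> applies to \<open>1 - p0\<close>.\<close>
  define p0 where "p0 = (m + p) / 2"
  have "m < p0" "p0 < p" using m(3) by (simp_all add: p0_def)
  then have p0: "1 - q1 \<le> p0" "p0 < p" "p / \<rho> < p0" using m(1,2) by linarith+
  have "p < \<rho> * p0" using p0(3) \<rho> by (simp add: field_simps)
  define d where "d = min (p - p0) (\<rho> * p0 - p)"
  have d: "0 < d" "d \<le> p - p0" "p + d \<le> \<rho> * p0" using p0(2) \<open>p < \<rho> * p0\<close> by (auto simp: d_def)
  define q where "q = 1 - p0"
  have q: "0 \<le> q" "q \<le> q1" using p0 p by (auto simp: q_def)
  have "0 < p / \<rho>" using pos \<rho> by simp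
  then have p0pos: "0 \<le> p0" using p0(3) by linarith
  define t where "t = (\<lambda>(k, L) z. (1 - z) ^ card L * z ^ card (bd r (W k) L) :: complex)"
  define M where "M = (\<lambda>(k, L). (\<rho> * q) ^ card L * (\<rho> * (1 - q)) ^ card (bd r (W k) L))"
  have tM: "norm (t j z) \<le> M j" if "z \<in> cball (complex_of_real p) d" for j z
  proof -
    have dz: "norm (z - complex_of_real p) \<le> d" using that by (simp add: dist_norm norm_minus_commute)
    have "norm z \<le> norm (complex_of_real p) + norm (z - complex_of_real p)"
      using norm_triangle_ineq[of "complex_of_real p" "z - complex_of_real p"] by simp
    then have 1: "norm z \<le> \<rho> * (1 - q)" using dz d pos by (simp add: q_def)
    have "norm (1 - z) \<le> norm (complex_of_real (1 - p)) + norm (complex_of_real p - z)"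
      using norm_triangle_ineq[of "complex_of_real (1 - p)" "complex_of_real p - z"] by simp
    also have "norm (complex_of_real (1 - p)) = 1 - p" using p by (simp only: norm_of_real)
    finally have "norm (1 - z) \<le> q" using dz d by (simp add: q_def norm_minus_commute)
    also have "q \<le> \<rho> * q" using q \<rho> by (simp add: mult_le_cancel_right1)
    finally have 2: "norm (1 - z) \<le> \<rho> * q" .
    obtain k L where j: "j = (k, L)" by force
    have "norm (t j z) = norm (1 - z) ^ card L * norm z ^ card (bd r (W k) L)"
      by (simp add: t_def j norm_mult norm_power)
    also have "\<dots> \<le> (\<rho> * q) ^ card L * (\<rho> * (1 - q)) ^ card (bd r (W k) L)"
    proof (rule mult_mono)
      show "norm (1 - z) ^ card L \<le> (\<rho> * q) ^ card L" by (rule power_mono[OF 2]) simp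
      show "norm z ^ card (bd r (W k) L) \<le> (\<rho> * (1 - q)) ^ card (bd r (W k) L)" by (rule power_mono[OF 1]) simp
    qed (use q \<rho> in simp_all)
    also have "\<dots> = M j" by (simp add: M_def j)
    finally show ?thesis .
  qed
  have M0: "0 \<le> M j" for j using q p0pos \<rho> by (auto simp: M_def q_def split: prod.splits)
  have geo: "summable (\<lambda>k. (1 / \<nu>) ^ k)" using \<nu> by (intro summable_geometric) simp
  have Msum: "M summable_on J"
  proof (rule nonneg_bdd_above_summable_on)
    show "bdd_above (sum M ` {F. F \<subseteq> J \<and> finite F})"
    proof (rule bdd_aboveI2)
      fix F assume "F \<in> {F. F \<subseteq> J \<and> finite F}"
      then have F: "F \<subseteq> J" "finite F" by auto
      define G where "G k = snd ` {j \<in> F. fst j = k}" for k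
      have mem: "(k, L) \<in> F \<longleftrightarrow> k \<in> fst ` F \<and> L \<in> G k" for k L
      proof
        assume kL: "(k, L) \<in> F"
        have "fst (k, L) \<in> fst ` F" "snd (k, L) \<in> snd ` {j \<in> F. fst j = k}"
          using kL by (intro imageI; simp)+
        then show "k \<in> fst ` F \<and> L \<in> G k" by (simp add: G_def)
      next
        assume "k \<in> fst ` F \<and> L \<in> G k"
        then obtain j where "j \<in> F" "fst j = k" "snd j = L" by (auto simp: G_def)
        then show "(k, L) \<in> F" by (metis prod.collapse)
      qed
      have GF: "Sigma (fst ` F) G = F"
      proof (rule set_eqI)
        fix j show "j \<in> Sigma (fst ` F) G \<longleftrightarrow> j \<in> F" by (cases j) (simp only: mem_Sigma_iff mem)
      qed
      have fG: "finite (G k)" for k unfolding G_def using F(2) by simp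
      have "sum M F = (\<Sum>k\<in>fst ` F. \<Sum>L\<in>G k. M (k, L))"
        using sum.Sigma[of "fst ` F" G "\<lambda>k L. M (k, L)"] F(2) fG by (simp add: GF split_def)
      also have "\<dots> \<le> (\<Sum>k\<in>fst ` F. K * (1 / \<nu>) ^ k)"
      proof (intro sum_mono)
        fix k
        have "\<forall>L\<in>G k. (k, L) \<in> J" using F by (auto simp: G_def)
        then have "(\<Sum>L\<in>G k. (\<rho> * q) ^ card L * (\<rho> * (1 - q)) ^ card (bd r (W k) L)) \<le> K * (1 / \<nu>) ^ k"
          by (intro bound[THEN spec, THEN spec, THEN spec, THEN mp, THEN mp, THEN mp, THEN mp] q fG)
        then show "(\<Sum>L\<in>G k. M (k, L)) \<le> K * (1 / \<nu>) ^ k" by (simp add: M_def)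
      qed
      also have "\<dots> \<le> \<bar>K\<bar> * (\<Sum>k\<in>fst ` F. (1 / \<nu>) ^ k)"
        unfolding sum_distrib_left using \<nu> by (intro sum_mono mult_right_mono) auto
      also have "\<dots> \<le> \<bar>K\<bar> * suminf (\<lambda>k. (1 / \<nu>) ^ k)"
        using geo F(2) \<nu> by (intro mult_left_mono sum_le_suminf finite_imageI) auto
      finally show "sum M F \<le> \<bar>K\<bar> * suminf (\<lambda>k. (1 / \<nu>) ^ k)" .
    qed
  qed (simp add: M0)
  have ulim: "uniform_limit (cball (complex_of_real p) d) (\<lambda>F z. \<Sum>j\<in>F. t j z) (\<lambda>z. \<Sum>\<^sub>\<infinity>j\<in>J. t j z)
      (finite_subsets_at_top J)"
  proof (rule Weierstrass_m_test_general)
    show "norm (t j z) \<le> M j" if "j \<in> J" "z \<in> cball (complex_of_real p) d" for j z using that(2) by (rule tM)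
    show "M summable_on J" by (rule Msum)
  qed
  have t_hol: "t j holomorphic_on UNIV" for j
    by (cases j) (auto simp: t_def intro!: holomorphic_intros)
  have "(\<lambda>z. \<Sum>\<^sub>\<infinity>j\<in>J. t j z) holomorphic_on ball (complex_of_real p) d"
  proof (rule holomorphic_uniform_limit[OF _ ulim])
    show "\<forall>\<^sub>F F in finite_subsets_at_top J.
        continuous_on (cball (complex_of_real p) d) (\<lambda>z. \<Sum>j\<in>F. t j z) \<and>
        (\<lambda>z. \<Sum>j\<in>F. t j z) holomorphic_on ball (complex_of_real p) d"
    proof (intro always_eventually allI conjI)
      fix F
      have h: "(\<lambda>z. \<Sum>j\<in>F. t j z) holomorphic_on UNIV" by (intro holomorphic_on_sum t_hol)
      show "continuous_on (cball (complex_of_real p) d) (\<lambda>z. \<Sum>j\<in>F. t j z)"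
        by (rule holomorphic_on_imp_continuous_on[OF holomorphic_on_subset[OF h]]) simp
      show "(\<lambda>z. \<Sum>j\<in>F. t j z) holomorphic_on ball (complex_of_real p) d"
        by (rule holomorphic_on_subset[OF h]) simp
    qed
  qed auto
  then have hol: "(\<lambda>z. 1 - (\<Sum>\<^sub>\<infinity>j\<in>J. t j z)) holomorphic_on ball (complex_of_real p) d"
    by (intro holomorphic_intros)
  have eq: "1 - (\<Sum>\<^sub>\<infinity>j\<in>J. t j (complex_of_real y)) = complex_of_real (1 - prob_finite seed y)"
    if y: "1 - p' < y" "y \<le> 1" for y
  proof -
    have y0: "0 \<le> y" using y p' by auto
    have "prob_finite (W k) (1 - y) = 1" for k
    proof -
      have "vanishing p' (W k)" by (rule vanishing_finite[OF v p' seed(2,3) W(1,2)])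
      then have "vanishing (1 - y) (W k)" by (rule vanishing_mono_param) (use y p' in auto)
      then show ?thesis using vanishing_iff[OF W(1,2), of "1 - y" k] y y0 by simp
    qed
    then have "((\<lambda>(k, L). y ^ card (bd r (W k) L) * (1 - y) ^ card L) has_sum prob_finite seed y) J"
      by (intro prob_finite_contours y0 y(2))
    then have "((\<lambda>j. complex_of_real (case j of (k, L) \<Rightarrow> y ^ card (bd r (W k) L) * (1 - y) ^ card L))
        has_sum complex_of_real (prob_finite seed y)) J" by (rule has_sum_of_real)
    then have "((\<lambda>j. t j (complex_of_real y)) has_sum complex_of_real (prob_finite seed y)) J"
      by (rule has_sum_cong[THEN iffD1, rotated]) (auto simp: t_def mult.commute)
    then show ?thesis by (simp add: infsumI)
  qed
  show "\<exists>r>0. \<exists>g. g holomorphic_on ball (complex_of_real p) r \<and>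
      (\<forall>y\<in>{1 - p'<..1}. complex_of_real y \<in> ball (complex_of_real p) r \<longrightarrow>
        g (complex_of_real y) = complex_of_real (1 - prob_finite seed y))"
    using d(1) hol eq by (intro exI[of _ d] exI[of _ "\<lambda>z. 1 - (\<Sum>\<^sub>\<infinity>j\<in>J. t j z)"]) auto
qed

lemma prob_finite_0: "prob_finite seed 0 = 1"
proof -
  have "{} \<in> clusters seed" by (simp add: clusters_def cl_def)
  then have "(\<Sum>L\<in>{{}}. 0 ^ card L * (1 - 0) ^ card (bd r seed L)) \<le> prob_finite seed 0"
    by (intro finite_sum_le_has_sum[OF prob_finite(2)] seed) auto
  then show ?thesis using prob_finite_le_1[of seed 0] by simp
qed

lemma prob_finite_1: "prob_finite seed 1 = 0"
proof -
  have "bd r seed L \<noteq> {}" if L: "L \<in> clusters seed" for L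
  proof
    assume bd: "bd r seed L = {}"
    then have sub: "seed \<subseteq> L" "r `` L \<subseteq> L" by (auto simp: bd_def)
    obtain i where i: "i \<in> seed" using seed by auto
    have "j \<in> L" if "(i, j) \<in> r\<^sup>*" for j using that by (induction rule: rtrancl_induct) (use i sub in auto)
    then have "I \<subseteq> L" using conn[of i] i seed by auto
    then show False using infinite_sites L finite_subset by (auto simp: clusters_def)
  qed
  then have "1 ^ card L * (1 - 1) ^ card (bd r seed L) = (0::real)" if "L \<in> clusters seed" for L
    using cluster_bd(2)[OF that seed(1,2)] that by (simp add: card_gt_0_iff)
  then have "((\<lambda>L. 1 ^ card L * (1 - 1) ^ card (bd r seed L)) has_sum (0::real)) (clusters seed)"
    by (rule has_sum_0)
  then show ?thesis using has_sum_unique prob_finite(2)[OF seed(1,2), of 1] by fastforce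
qed

text \<open>Any parameter below \<open>p\<^sub>c\<close> lies below one at which \<open>\<theta>\<close> vanishes, to which
\<open>analytic_above\<close> applies. For the second part, \<open>p\<^sub>c > 1/2\<close> would make \<open>\<theta>\<close> analytic on \<open>(1/2, 1]\<close> and zero on
\<open>(1/2, p\<^sub>c)\<close>, contradicting \<open>\<theta> 1 = 1\<close>.\<close>

theorem threshold_duality:
  assumes \<theta>: "\<And>p. 0 \<le> p \<Longrightarrow> p \<le> 1 \<Longrightarrow> \<theta> p = 1 - prob_finite seed p"
  shows "analyticity_threshold \<theta> \<le> 1 - critical_parameter \<theta> \<and> critical_parameter \<theta> \<le> 1 / 2"
proof -
  define Z where "Z = {p \<in> {0..1}. \<theta> p = 0}"
  define pc where "pc = critical_parameter \<theta>"
  have pcZ: "pc = Sup Z" by (simp add: pc_def critical_parameter_def Z_def)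
  have Z0: "0 \<in> Z" using \<theta> prob_finite_0 by (auto simp: Z_def)
  have bddZ: "bdd_above Z" by (rule bdd_aboveI[of _ 1]) (auto simp: Z_def)
  have pc: "0 \<le> pc" "pc \<le> 1" unfolding pcZ
    using Z0 bddZ by (auto intro: cSup_upper cSup_least simp: Z_def)
  have vanish: "\<exists>p'. q < p' \<and> p' \<le> 1 \<and> vanishing p' seed" if "q < pc" for q
  proof -
    obtain p' where "p' \<in> Z" "q < p'" using \<open>q < pc\<close> Z0 bddZ less_cSup_iff[of Z q] by (auto simp: pcZ)
    then show ?thesis using \<theta>[of p'] vanishing_iff[OF seed(1,2), of p'] by (auto simp: Z_def)
  qed
  have analytic: "real_analytic_on \<theta> {s<..1}" if s: "1 - pc < s" "0 \<le> s" for s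
  proof (cases "s < 1")
    case True
    obtain p' where p': "1 - s < p'" "p' \<le> 1" "vanishing p' seed" using vanish[of "1 - s"] s by auto
    have *: "real_analytic_on (\<lambda>p. 1 - prob_finite seed p) {1 - p'<..1}"
      using True p' by (intro analytic_above) auto
    show ?thesis by (rule real_analytic_on_cong[OF *]) (use p' s(2) \<theta> in auto)
  qed (auto simp: real_analytic_on_def)
  let ?A = "{p \<in> {0..1}. real_analytic_on \<theta> {p<..1}}"
  have 1: "1 \<in> ?A" by (auto simp: real_analytic_on_def)
  have bddA: "bdd_below ?A" by (rule bdd_belowI[of _ 0]) auto
  have le: "analyticity_threshold \<theta> \<le> s" if "1 - pc < s" "s \<le> 1" for s
    unfolding analyticity_threshold_def using bddA analytic[of s] that pc by (intro cInf_lower) auto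
  have A: "analyticity_threshold \<theta> \<le> 1 - pc"
  proof (cases "pc = 0")
    case True
    then show ?thesis unfolding analyticity_threshold_def using cInf_lower[OF 1 bddA] by simp
  next
    case False
    show ?thesis
    proof (rule dense_ge_bounded[of _ 1])
      show "1 - pc < 1" using False pc by simp
    qed (auto intro: le)
  qed
  have "pc \<le> 1 / 2"
  proof (rule ccontr)
    assume "\<not> pc \<le> 1 / 2"
    then have half: "1 / 2 < pc" by simp
    have "\<theta> y = 0" if y: "1 / 2 < y" "y < pc" for y
    proof -
      obtain p' where p': "y < p'" "p' \<le> 1" "vanishing p' seed" using vanish[OF y(2)] by auto
      from p'(3) have "vanishing y seed" by (rule vanishing_mono_param) (use y p' in auto)
      then show ?thesis using vanishing_iff[OF seed(1,2), of y] \<theta>[of y] y p' by simp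
    qed
    moreover have "real_analytic_on \<theta> {1 / 2<..1}" using half by (intro analytic) auto
    ultimately have "\<theta> 1 = 0" using half pc by (intro real_analytic_on_zero[of \<theta> "1 / 2" pc]) auto
    then show False using \<theta>[of 1] prob_finite_1 by simp
  qed
  then show ?thesis using A by (simp add: pc_def)
qed

end

section \<open>Distances and geodesics\<close>

text \<open>An infinite, connected, locally finite graph. Its adjacency relation makes it an instance of the
site percolation setting above, in which \<open>cl r {u} S\<close> is the component of \<open>u\<close> in the subgraph induced by
\<open>S\<close>.\<close>

locale inf_graph =
  fixes V :: "'a set" and E :: "'a set set"
  assumes simple: "simple_graph V E" and inf: "infinite V"
    and conn_graph: "connected_graph V E" and loc_fin: "locally_finite_graph V E"
begin

abbreviation r :: "'a rel" where "r \<equiv> adjacency E"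

lemma adj_V: "(u, v) \<in> r \<Longrightarrow> u \<in> V \<and> v \<in> V"
  using simple by (auto simp: adjacency_def simple_graph_def)

lemma adj_neq: "(u, v) \<in> r \<Longrightarrow> u \<noteq> v"
  using simple by (auto simp: adjacency_def simple_graph_def)

lemma adj_sym: "sym r"
  by (auto simp: adjacency_def sym_def insert_commute)

lemma edgeE:
  assumes "e \<in> E" obtains u v where "e = {u, v}" "u \<noteq> v" "u \<in> V" "v \<in> V" "(u, v) \<in> r"
proof -
  have "card e = 2" "e \<subseteq> V" using simple assms by (auto simp: simple_graph_def)
  then obtain u v where "e = {u, v}" "u \<noteq> v" by (auto simp: card_2_iff)
  then show ?thesis using that assms \<open>e \<subseteq> V\<close> by (auto simp: adjacency_def)
qed

lemma finite_adj: "v \<in> V \<Longrightarrow> finite (r `` {v})"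
proof -
  assume "v \<in> V"
  then have "finite {e \<in> E. v \<in> e}" using loc_fin by (auto simp: locally_finite_graph_def)
  moreover have "(\<lambda>w. {v, w}) ` (r `` {v}) \<subseteq> {e \<in> E. v \<in> e}" by (auto simp: adjacency_def)
  ultimately have "finite ((\<lambda>w. {v, w}) ` (r `` {v}))" by (rule finite_subset[rotated])
  moreover have "inj_on (\<lambda>w. {v, w}) (r `` {v})"
    using adj_neq by (intro inj_onI) (metis Image_singleton_iff doubleton_eq_iff)
  ultimately show ?thesis by (rule finite_imageD)
qed

lemma connected_adj: "u \<in> V \<Longrightarrow> v \<in> V \<Longrightarrow> (u, v) \<in> r\<^sup>*"
  using conn_graph by (auto simp: connected_graph_def component_def)

sublocale connected_site_graph V r
  by unfold_locales (use adj_V adj_sym finite_adj connected_adj in auto)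

lemma component_induced:
  "component S (induced_edges E S) x = cl r {x} S"
proof -
  have "adjacency (induced_edges E S) = r \<inter> S \<times> S" by (auto simp: adjacency_def induced_edges_def)
  then show ?thesis by (auto simp: component_def cl_def)
qed

lemma relpow_V: "(u, v) \<in> r ^^ n \<Longrightarrow> u \<in> V \<Longrightarrow> v \<in> V"
  by (induction n arbitrary: v) (auto dest: adj_V)

lemma relpow_sym: "(u, v) \<in> r ^^ n \<Longrightarrow> (v, u) \<in> r ^^ n"
proof (induction n arbitrary: v)
  case (Suc n)
  then obtain w where "(u, w) \<in> r ^^ n" "(w, v) \<in> r" by auto
  then have "(w, u) \<in> r ^^ n" "(v, w) \<in> r" using Suc.IH adj_sym by (auto dest: symD)
  then show ?case by (intro relpow_Suc_I2)
qed auto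

text \<open>The graph distance.\<close>

definition gd :: "'a \<Rightarrow> 'a \<Rightarrow> nat" where
  "gd u v = (LEAST n. (u, v) \<in> r ^^ n)"

lemma gd_relpow: "u \<in> V \<Longrightarrow> v \<in> V \<Longrightarrow> (u, v) \<in> r ^^ gd u v"
  unfolding gd_def by (rule LeastI_ex) (use connected_adj rtrancl_imp_relpow in blast)

lemma gd_le: "(u, v) \<in> r ^^ n \<Longrightarrow> gd u v \<le> n"
  unfolding gd_def by (rule Least_le)

lemma gd_self [simp]: "gd u u = 0"
  using gd_le[of u u 0] by simp

lemma gd_sym: "u \<in> V \<Longrightarrow> v \<in> V \<Longrightarrow> gd u v = gd v u"
  by (intro antisym; rule gd_le[OF relpow_sym[OF gd_relpow]])

lemma gd_triangle: "u \<in> V \<Longrightarrow> v \<in> V \<Longrightarrow> w \<in> V \<Longrightarrow> gd u w \<le> gd u v + gd v w"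
  by (rule gd_le, subst relpow_add, rule relcompI[OF gd_relpow gd_relpow])

lemma gd_adj: "(u, v) \<in> r \<Longrightarrow> gd u v \<le> 1"
  by (intro gd_le) auto

lemma gd_0: "u \<in> V \<Longrightarrow> v \<in> V \<Longrightarrow> gd u v = 0 \<Longrightarrow> u = v"
  using gd_relpow[of u v] by simp

lemma gd_step:
  assumes "u \<in> V" "(v, w) \<in> r" shows "gd u w \<le> gd u v + 1"
  using gd_triangle[of u v w] gd_adj[OF assms(2)] adj_V[OF assms(2)] assms by linarith

lemma gd_split:
  assumes "u \<in> V" "v \<in> V" "gd u v = m + n"
  shows "\<exists>w\<in>V. gd u w = m \<and> gd w v = n"
proof -
  have "(u, v) \<in> r ^^ m O r ^^ n" using gd_relpow[OF assms(1,2)] by (simp add: assms(3) relpow_add)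
  then obtain w where w: "(u, w) \<in> r ^^ m" "(w, v) \<in> r ^^ n" by auto
  then have "w \<in> V" using relpow_V assms by blast
  moreover have "gd u w \<le> m" "gd w v \<le> n" using w gd_le by auto
  ultimately show ?thesis using gd_triangle[of u w v] assms by (intro bexI[of _ w]) auto
qed

lemma finite_ball: "u \<in> V \<Longrightarrow> finite {v \<in> V. gd u v \<le> n}"
proof (induction n)
  case 0
  then have "{v \<in> V. gd u v \<le> 0} \<subseteq> {u}" using gd_0 by auto
  then show ?case by (rule finite_subset) simp
next
  case (Suc n)
  let ?B = "{v \<in> V. gd u v \<le> n}"
  have "{v \<in> V. gd u v \<le> Suc n} \<subseteq> ?B \<union> r `` ?B"
  proof
    fix v assume v: "v \<in> {v \<in> V. gd u v \<le> Suc n}"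
    show "v \<in> ?B \<union> r `` ?B"
    proof (cases "gd u v = n + 1")
      case True
      then obtain w where w: "w \<in> V" "gd u w = n" "gd w v = 1" using gd_split[of u v n 1] Suc v by auto
      then have "(w, v) \<in> r" using gd_relpow[of w v] v by simp
      then show ?thesis using w by auto
    qed (use v in auto)
  qed
  then show ?case using Suc finite_nbrs[of ?B] finite_subset by auto
qed

lemma gd_attained: "u \<in> V \<Longrightarrow> \<exists>v\<in>V. gd u v = n"
proof -
  assume u: "u \<in> V"
  have "\<not> V \<subseteq> {v \<in> V. gd u v \<le> n}" using finite_ball[OF u] inf finite_subset by blast
  then obtain v where "v \<in> V" "\<not> gd u v \<le> n" by blast
  then have v: "v \<in> V" "n < gd u v" by simp_all
  then show ?thesis using gd_split[OF u v(1), of n "gd u v - n"] by auto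
qed

lemma automorphism_gd:
  assumes f: "site_automorphism f" and uv: "u \<in> V" "v \<in> V"
  shows "gd (f u) (f v) = gd u v"
proof -
  have fV: "f ` V = V" and fr: "\<And>i j. i \<in> V \<Longrightarrow> j \<in> V \<Longrightarrow> (f i, f j) \<in> r \<longleftrightarrow> (i, j) \<in> r"
    and inj: "inj_on f V"
    using f by (auto simp: site_automorphism_def bij_betw_def)
  have "(f u, f w) \<in> r ^^ n \<longleftrightarrow> (u, w) \<in> r ^^ n" if "w \<in> V" for n w using that
  proof (induction n arbitrary: w)
    case 0 then show ?case using inj uv(1) by (auto dest: inj_onD)
  next
    case (Suc n)
    show ?case
    proof
      assume "(f u, f w) \<in> r ^^ Suc n"
      then obtain y where y: "(f u, y) \<in> r ^^ n" "(y, f w) \<in> r" by auto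
      then have "y \<in> f ` V" using adj_V fV by blast
      then obtain z where z: "z \<in> V" "y = f z" by auto
      then have "(u, z) \<in> r ^^ n" "(z, w) \<in> r" using y Suc fr[of z w] by auto
      then show "(u, w) \<in> r ^^ Suc n" by auto
    next
      assume "(u, w) \<in> r ^^ Suc n"
      then obtain z where z: "(u, z) \<in> r ^^ n" "(z, w) \<in> r" by auto
      then have "z \<in> V" using adj_V by blast
      then have "(f u, f z) \<in> r ^^ n" "(f z, f w) \<in> r" using z Suc fr[of z w] by auto
      then show "(f u, f w) \<in> r ^^ Suc n" by auto
    qed
  qed
  then show ?thesis using uv by (simp add: gd_def)
qed

text \<open>Koenig's lemma, applied to the vertices \<open>v\<close> that lie on geodesics from \<open>z\<close> to infinitely many vertices.\<close>

lemma geodesic_ray: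
  assumes o: "z \<in> V"
  shows "\<exists>\<gamma>. \<gamma> 0 = z \<and> (\<forall>n. (\<gamma> n, \<gamma> (Suc n)) \<in> r) \<and> (\<forall>n. gd z (\<gamma> n) = n)"
proof -
  \<comment> \<open>The vertices to which some geodesic from \<open>z\<close> passes through \<open>v\<close>.\<close>
  define desc where "desc v = {w \<in> V. gd z w = gd z v + gd v w}" for v
  have "\<exists>\<gamma>. \<forall>n. (\<gamma> n \<in> V \<and> gd z (\<gamma> n) = n \<and> infinite (desc (\<gamma> n)))
      \<and> ((\<gamma> n, \<gamma> (Suc n)) \<in> r)"
  proof (rule dependent_nat_choice)
    have "desc z = V" by (auto simp: desc_def)
    then show "\<exists>x. x \<in> V \<and> gd z x = 0 \<and> infinite (desc x)" using o inf by (intro exI[of _ z]) auto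
  next
    fix v n assume v: "v \<in> V \<and> gd z v = n \<and> infinite (desc v)"
    let ?N = "{v' \<in> r `` {v}. gd z v' = n + 1}"
    have "desc v \<subseteq> {v} \<union> (\<Union>v'\<in>?N. desc v')"
    proof
      fix w assume w: "w \<in> desc v"
      show "w \<in> {v} \<union> (\<Union>v'\<in>?N. desc v')"
      proof (cases "gd v w")
        case 0
        then show ?thesis using gd_0[of v w] v w by (auto simp: desc_def)
      next
        case (Suc m)
        then obtain v' where v': "v' \<in> V" "gd v v' = 1" "gd v' w = m"
          using gd_split[of v w 1 m] v w by (auto simp: desc_def)
        then have adj: "(v, v') \<in> r" using gd_relpow[of v v'] v by simp
        have "gd z w = n + 1 + m" "w \<in> V" using w v Suc by (auto simp: desc_def)
        moreover have "gd z v' \<le> n + 1" using gd_step[OF o adj] v by simp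
        moreover have "gd z w \<le> gd z v' + m" using gd_triangle[of z v' w] o v' \<open>w \<in> V\<close> by simp
        ultimately have "gd z v' = n + 1" "w \<in> desc v'" using v' by (auto simp: desc_def)
        then show ?thesis using adj by auto
      qed
    qed
    moreover have "finite ?N" by (rule finite_subset[OF _ finite_adj[of v]]) (use v in auto)
    ultimately have "\<exists>v'\<in>?N. infinite (desc v')" using v finite_subset by fastforce
    then show "\<exists>v'. (v' \<in> V \<and> gd z v' = Suc n \<and> infinite (desc v')) \<and> (v, v') \<in> r"
      using adj_V by auto
  qed
  then obtain \<gamma> where \<gamma>: "\<And>n. \<gamma> n \<in> V" "\<And>n. gd z (\<gamma> n) = n" "\<And>n. (\<gamma> n, \<gamma> (Suc n)) \<in> r" by blast
  then have "\<gamma> 0 = z" using gd_0[of z "\<gamma> 0"] o by auto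
  then show ?thesis using \<gamma> by blast
qed

text \<open>A common form for the outer vertex boundary of \<open>S\<close> and for the set of end vertices of the edge cut around \<open>S\<close>.\<close>

definition separator :: "'a set \<Rightarrow> 'a set \<Rightarrow> bool" where
  "separator S Q \<longleftrightarrow> Q \<subseteq> V \<and> (\<forall>x y. (x, y) \<in> r \<longrightarrow> x \<in> S \<longrightarrow> y \<notin> S \<longrightarrow> x \<in> Q \<or> y \<in> Q)"

lemma geodesic_crossing:
  assumes "separator S Q" "u \<in> V" "v \<in> V" "u \<in> S" "v \<notin> S"
  shows "\<exists>q\<in>Q. gd u q + gd q v = gd u v"
proof -
  have "\<exists>i j x y. (u, x) \<in> r ^^ i \<and> (x, y) \<in> r \<and> (y, v) \<in> r ^^ j \<and> x \<in> S \<and> y \<notin> S \<and> i + 1 + j = n"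
    if "(u, v) \<in> r ^^ n" for n using that assms(5)
  proof (induction n arbitrary: v)
    case 0 then show ?case using assms(4) by auto
  next
    case (Suc n)
    then obtain w where w: "(u, w) \<in> r ^^ n" "(w, v) \<in> r" by auto
    show ?case
    proof (cases "w \<in> S")
      case True
      then show ?thesis using w Suc.prems by (intro exI[of _ n] exI[of _ 0] exI[of _ w] exI[of _ v]) auto
    next
      case False
      then obtain i j x y where "(u, x) \<in> r ^^ i" "(x, y) \<in> r" "(y, w) \<in> r ^^ j" "x \<in> S" "y \<notin> S" "i + 1 + j = n"
        using Suc.IH[OF w(1)] by blast
      moreover have "(y, v) \<in> r ^^ Suc j" using \<open>(y, w) \<in> r ^^ j\<close> w(2) by auto
      ultimately show ?thesis
        by (intro exI[of _ i] exI[of _ "Suc j"] exI[of _ x] exI[of _ y]) auto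
    qed
  qed
  from this[OF gd_relpow[OF assms(2,3)]] obtain i j x y where
    xy: "(u, x) \<in> r ^^ i" "(x, y) \<in> r" "(y, v) \<in> r ^^ j" "x \<in> S" "y \<notin> S" "i + 1 + j = gd u v" by blast
  have V: "x \<in> V" "y \<in> V" using adj_V[OF xy(2)] by auto
  have i: "gd u x \<le> i" "gd y v \<le> j" using gd_le xy by auto
  have "gd u y \<le> gd u x + 1" using gd_step[OF assms(2) xy(2)] .
  moreover have "gd x v \<le> 1 + gd y v" using gd_triangle[of x y v] gd_adj[OF xy(2)] V assms(3) by linarith
  moreover have "gd u v \<le> gd u x + gd x v" "gd u v \<le> gd u y + gd y v"
    using gd_triangle V assms(2,3) by auto
  ultimately have "gd u x + gd x v = gd u v" "gd u y + gd y v = gd u v" using i xy(6) by linarith+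
  then show ?thesis using assms(1) xy unfolding separator_def by blast
qed

text \<open>A long geodesic exists somewhere in the graph; an automorphism moves its midpoint to one of the finitely
many orbit representatives.\<close>

lemma long_segments:
  assumes z: "z \<in> V" and T: "finite T" "T \<subseteq> V" "\<And>v. v \<in> V \<Longrightarrow> \<exists>t\<in>T. \<exists>f. site_automorphism f \<and> f t = v"
  shows "\<exists>D. \<forall>N. \<exists>a\<in>V. \<exists>m\<in>V. \<exists>b\<in>V. gd z m \<le> D \<and> gd m a = N \<and> gd m b = N \<and> gd a b = 2 * N"
proof -
  define D where "D = (\<Sum>t\<in>T. gd z t)"
  have "\<exists>a\<in>V. \<exists>m\<in>V. \<exists>b\<in>V. gd z m \<le> D \<and> gd m a = N \<and> gd m b = N \<and> gd a b = 2 * N" for N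
  proof -
    obtain w where w: "w \<in> V" "gd z w = N + N" using gd_attained[OF z] by blast
    then obtain m where m: "m \<in> V" "gd z m = N" "gd m w = N" using gd_split[OF z w(1)] by blast
    obtain t f where t: "t \<in> T" "site_automorphism f" "f t = m" using T(3)[OF m(1)] by blast
    have fV: "f ` V = V" using t by (auto simp: site_automorphism_def bij_betw_def)
    obtain a where a: "a \<in> V" "f a = z" using z fV by (metis imageE)
    obtain b where b: "b \<in> V" "f b = w" using w(1) fV by (metis imageE)
    have tV: "t \<in> V" using t T by auto
    have "gd t a = N" using automorphism_gd[OF t(2) tV a(1)] t(3) a(2) m gd_sym[OF m(1) z] by simp
    moreover have "gd t b = N" using automorphism_gd[OF t(2) tV b(1)] t(3) b(2) m by simp
    moreover have "gd a b = 2 * N" using automorphism_gd[OF t(2) a(1) b(1)] a(2) b(2) w by simp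
    moreover have "gd z t \<le> D" unfolding D_def using t(1) T(1) by (intro member_le_sum) auto
    ultimately show ?thesis using a b tV by blast
  qed
  then show ?thesis by blast
qed

text \<open>Take a geodesic with midpoint \<open>m\<close> near \<open>z\<close> that is so long that its ends lie outside \<open>S\<close>. If \<open>m\<close> is in \<open>S\<close>,
then \<open>Q\<close> meets both halves, and the distance of the two points bounds that of \<open>m\<close> from either. If not, \<open>Q\<close>
already meets a geodesic from \<open>z\<close> to \<open>m\<close>.\<close>

lemma separator_close:
  assumes z: "z \<in> V" and D: "\<forall>N. \<exists>a\<in>V. \<exists>m\<in>V. \<exists>b\<in>V. gd z m \<le> D \<and> gd m a = N \<and> gd m b = N \<and> gd a b = 2 * N"
    and S: "finite S" "z \<in> S" and Q: "separator S Q" "\<And>u v. u \<in> Q \<Longrightarrow> v \<in> Q \<Longrightarrow> gd u v \<le> n"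
    and x: "x \<in> Q"
  shows "gd z x \<le> 2 * n + D"
proof -
  define N where "N = D + Suc (\<Sum>s\<in>S. gd z s)"
  obtain a m b where amb: "a \<in> V" "m \<in> V" "b \<in> V" "gd z m \<le> D" "gd m a = N" "gd m b = N" "gd a b = 2 * N"
    using D[THEN spec, of N] by (elim bexE conjE) (rule that)
  have QV: "Q \<subseteq> V" using Q(1) by (simp add: separator_def)
  have far: "w \<notin> S" if "w \<in> V" "gd m w = N" for w
  proof
    assume "w \<in> S"
    then have "gd z w \<le> (\<Sum>s\<in>S. gd z s)" using S(1) by (intro member_le_sum[of w S "gd z"]) auto
    moreover have "gd m w \<le> gd m z + gd z w" by (rule gd_triangle[OF amb(2) z that(1)])
    ultimately show False using gd_sym[OF amb(2) z] amb(4) that(2) by (simp add: N_def)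
  qed
  show ?thesis
  proof (cases "m \<in> S")
    case False
    then obtain q where q: "q \<in> Q" "gd z q + gd q m = gd z m"
      using geodesic_crossing[OF Q(1) z amb(2) S(2)] by blast
    have "q \<in> V" "x \<in> V" using q(1) x QV by auto
    then have "gd z x \<le> gd z q + gd q x" by (rule gd_triangle[OF z])
    then show ?thesis using Q(2)[OF q(1) x] q(2) amb(4) by linarith
  next
    case True
    obtain q where q: "q \<in> Q" "gd m q + gd q a = N"
      using geodesic_crossing[OF Q(1) amb(2,1) True far[OF amb(1,5)]] amb(5) by auto
    obtain q' where q': "q' \<in> Q" "gd m q' + gd q' b = N"
      using geodesic_crossing[OF Q(1) amb(2,3) True far[OF amb(3,6)]] amb(6) by auto
    have V: "q \<in> V" "q' \<in> V" "x \<in> V" using q q' x QV by auto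
    note gd_triangle[OF amb(1) V(1) amb(3)] gd_triangle[OF V(1,2) amb(3)]
      gd_triangle[OF z amb(2) V(3)] gd_triangle[OF amb(2) V(1,3)] gd_sym[OF amb(1) V(1)]
    moreover have "gd q q' \<le> n" "gd q x \<le> n" using Q(2) q q' x by auto
    ultimately show ?thesis using q(2) q'(2) amb(4,7) by linarith
  qed
qed

text \<open>A function that changes by at most 1 along edges takes all values between 0 and its maximum on a connected
set, so the set has more elements than the maximum.\<close>

lemma connected_diameter:
  fixes f :: "'b \<Rightarrow> nat"
  assumes B: "finite B" "B \<subseteq> cl s {b} B" "b \<in> B" "f b = 0"
    and f: "\<And>x y. (x, y) \<in> s \<Longrightarrow> x \<in> B \<Longrightarrow> y \<in> B \<Longrightarrow> f y \<le> f x + 1" and x: "x \<in> B"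
  shows "f x < card B"
proof -
  have "{..f x} \<subseteq> f ` B" using subsetD[OF B(2) x]
  proof (induction rule: cl_induct)
    case (source y)
    then show ?case using B(3,4) by auto
  next
    case (step z w)
    then have "z \<in> B" using cl_subset[of s "{b}" B] by blast
    then have "f w \<le> f z + 1" using f[of z w] step by blast
    then have "{..f w} \<subseteq> insert (f w) {..f z}" by auto
    moreover have "f w \<in> f ` B" using step by blast
    ultimately show ?case using step by blast
  qed
  then have "card {..f x} \<le> card (f ` B)" using B(1) by (intro card_mono) auto
  also have "\<dots> \<le> card B" using B(1) by (rule card_image_le)
  finally show ?thesis by simp
qed

end

section \<open>Filling the holes of a finite connected set\<close>

locale one_ended_graph = inf_graph +
  assumes one_end: "one_ended V E"
begin

definition conn_set :: "'a set \<Rightarrow> bool" where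
  "conn_set S \<longleftrightarrow> (\<forall>u\<in>S. S \<subseteq> cl r {u} S)"

lemma conn_setI:
  assumes "\<And>v. v \<in> S \<Longrightarrow> v \<in> cl r {c} S" shows "conn_set S"
  unfolding conn_set_def
proof (intro ballI subsetI)
  fix u v assume uv: "u \<in> S" "v \<in> S"
  have "c \<in> cl r {u} S" using cl_sym[OF adj_sym assms[OF uv(1)]] .
  then have "cl r {c} S \<subseteq> cl r {u} S" by (intro cl_trans) auto
  then show "v \<in> cl r {u} S" using assms[OF uv(2)] by blast
qed

lemma cl_eq_component:
  assumes "sym s" "w \<in> cl s {u} \<omega>" shows "cl s {u} \<omega> = cl s {w} \<omega>"
proof
  show "cl s {u} \<omega> \<subseteq> cl s {w} \<omega>" by (rule cl_trans) (use cl_sym[OF assms] in auto)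
  show "cl s {w} \<omega> \<subseteq> cl s {u} \<omega>" by (rule cl_trans) (use assms(2) in auto)
qed

lemma conn_set_component: "x \<in> S \<Longrightarrow> conn_set (cl r {x} S)"
  by (rule conn_setI[of _ x]) (simp add: cl_cl)

text \<open>The induced subgraph on an infinite component is itself infinite, connected and locally finite, so it
contains a geodesic ray.\<close>

lemma ray_in_component:
  assumes x: "x \<in> S" "S \<subseteq> V" and infU: "infinite (cl r {x} S)"
  shows "\<exists>\<gamma>\<in>rays V E. range \<gamma> \<subseteq> cl r {x} S"
proof -
  let ?U = "cl r {x} S"
  have U: "?U \<subseteq> V" using cl_subset[of r "{x}" S] x by auto
  have adj: "adjacency (induced_edges E ?U) = r \<inter> ?U \<times> ?U" by (auto simp: adjacency_def induced_edges_def)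
  interpret U: inf_graph ?U "induced_edges E ?U"
  proof
    show "simple_graph ?U (induced_edges E ?U)"
      using simple by (auto simp: simple_graph_def induced_edges_def)
    show "infinite ?U" by (rule infU)
    show "connected_graph ?U (induced_edges E ?U)"
      using conn_set_component[OF x(1)] unfolding connected_graph_def component_induced conn_set_def by blast
    show "locally_finite_graph ?U (induced_edges E ?U)"
      unfolding locally_finite_graph_def
    proof
      fix v assume "v \<in> ?U"
      then have "finite {e \<in> E. v \<in> e}" using loc_fin U by (auto simp: locally_finite_graph_def)
      then show "finite {e \<in> induced_edges E ?U. v \<in> e}"
        by (rule finite_subset[rotated]) (auto simp: induced_edges_def)
    qed
  qed
  have "x \<in> ?U" using x by (auto intro: cl_source)
  then obtain \<gamma> where \<gamma>: "\<And>n. (\<gamma> n, \<gamma> (Suc n)) \<in> r \<inter> ?U \<times> ?U" "\<And>n. U.gd x (\<gamma> n) = n"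
    using U.geodesic_ray[of x] unfolding adj by blast
  have "inj \<gamma>" by (metis \<gamma>(2) injI)
  then have "\<gamma> \<in> rays V E" "range \<gamma> \<subseteq> ?U" using \<gamma>(1) U by (auto simp: rays_def adjacency_def)
  then show ?thesis by blast
qed

lemma ray_tail:
  assumes \<gamma>: "\<gamma> \<in> rays V E" and S: "finite S"
  shows "\<exists>m. \<forall>n\<ge>m. \<gamma> n \<in> cl r {\<gamma> m} (V - S)"
proof -
  have inj: "inj \<gamma>" and V: "\<And>n. \<gamma> n \<in> V" and adj: "\<And>n. (\<gamma> n, \<gamma> (Suc n)) \<in> r"
    using \<gamma> by (auto simp: rays_def adjacency_def)
  have "finite (\<gamma> -` S)" using finite_vimageI[OF S inj] .
  then obtain m where "\<forall>n\<in>\<gamma> -` S. n < m" using finite_nat_set_iff_bounded[of "\<gamma> -` S"] by blast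
  then have "n < m" if "\<gamma> n \<in> S" for n using that by simp
  then have m: "\<gamma> n \<notin> S" if "m \<le> n" for n using that by (meson not_less)
  have "\<gamma> n \<in> cl r {\<gamma> m} (V - S)" if "m \<le> n" for n using that
  proof (induction rule: dec_induct)
    case base
    show ?case by (rule cl_source) (use V m in auto)
  next
    case (step n)
    have "\<gamma> (Suc n) \<in> V - S" using V m[of "Suc n"] step by simp
    then show ?case by (rule cl_step[OF step.IH adj])
  qed
  then show ?thesis by blast
qed

lemma rays_equivalent:
  assumes "\<gamma> \<in> rays V E" "\<delta> \<in> rays V E"
  shows "(\<gamma>, \<delta>) \<in> ray_equiv V E"
proof -
  have refl: "(\<delta>, \<delta>) \<in> ray_equiv V E"
    unfolding ray_equiv_def component_induced
  proof (simp add: assms, intro allI impI)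
    fix S :: "'a set" assume "finite S \<and> S \<subseteq> V"
    then obtain m where m: "\<And>n. m \<le> n \<Longrightarrow> \<delta> n \<in> cl r {\<delta> m} (V - S)" using ray_tail[OF assms(2), of S] by blast
    then have "\<delta> m \<in> V - S" using cl_subset[of r "{\<delta> m}" "V - S"] by blast
    then show "\<exists>x\<in>V - S. \<exists>m. \<forall>n\<ge>m. \<delta> n \<in> cl r {x} (V - S)" using m by blast
  qed
  obtain X where "graph_ends V E = {X}" using one_end by (auto simp: one_ended_def card_1_singleton_iff)
  then have "ray_equiv V E `` {\<gamma>} = X" "ray_equiv V E `` {\<delta>} = X"
    using quotientI[OF assms(1), of "ray_equiv V E"] quotientI[OF assms(2), of "ray_equiv V E"]
    by (simp_all add: graph_ends_def)
  then have "\<delta> \<in> ray_equiv V E `` {\<gamma>}" using refl by (metis Image_singleton_iff)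
  then show ?thesis by simp
qed

lemma infinite_component_unique:
  assumes C: "finite C" "C \<subseteq> V" and "x \<in> V - C" "y \<in> V - C"
    and "infinite (cl r {x} (V - C))" "infinite (cl r {y} (V - C))"
  shows "cl r {x} (V - C) = cl r {y} (V - C)"
proof -
  obtain \<gamma> \<delta> where g: "\<gamma> \<in> rays V E" "range \<gamma> \<subseteq> cl r {x} (V - C)" "\<delta> \<in> rays V E" "range \<delta> \<subseteq> cl r {y} (V - C)"
    using ray_in_component[of x "V - C"] ray_in_component[of y "V - C"] assms by blast
  then obtain z m where "\<forall>n\<ge>m. \<gamma> n \<in> cl r {z} (V - C) \<and> \<delta> n \<in> cl r {z} (V - C)"
    using rays_equivalent[OF g(1,3)] C unfolding ray_equiv_def component_induced by blast
  then have m: "\<gamma> m \<in> cl r {z} (V - C)" "\<delta> m \<in> cl r {z} (V - C)" by auto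
  have same: "cl r {u} (V - C) = cl r {w} (V - C)" if "w \<in> cl r {u} (V - C)" for u w
    by (rule cl_eq_component[OF adj_sym that])
  have "cl r {x} (V - C) = cl r {\<gamma> m} (V - C)" "cl r {y} (V - C) = cl r {\<delta> m} (V - C)"
    using g by (auto intro!: same)
  then show ?thesis using same[OF m(1)] same[OF m(2)] by simp
qed

lemma component_touches:
  assumes C: "C \<subseteq> V" "c \<in> C" and x: "x \<in> V - C"
  shows "\<exists>w\<in>cl r {x} (V - C). w \<in> r `` C"
proof (rule ccontr)
  assume none: "\<not> ?thesis"
  have "v \<in> cl r {x} (V - C)" if "(x, v) \<in> r\<^sup>*" for v using that
  proof (induction rule: rtrancl_induct)
    case base then show ?case using x by (auto intro: cl_source)
  next
    case (step u v)
    then have "(v, u) \<in> r" using adj_sym by (auto dest: symD)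
    then have "v \<notin> C" using none step.IH by auto
    then show ?case using step adj_V by (auto intro: cl_step)
  qed
  then have "c \<in> cl r {x} (V - C)" using connected_adj[of x c] x C by auto
  then show False using cl_subset[of r "{x}" "V - C"] C by auto
qed

text \<open>\<open>S\<close> is the complement of an infinite component of \<open>V - C\<close>. Every component touches \<open>C\<close>, so there are
finitely many of them, and by one-endedness the others are finite.\<close>

lemma fill:
  assumes C: "finite C" "C \<subseteq> V" "C \<noteq> {}" "conn_set C"
  obtains S where "C \<subseteq> S" "finite S" "S \<subseteq> V" "conn_set S" "conn_set (V - S)"
    "\<And>x y. (x, y) \<in> r \<Longrightarrow> x \<in> S \<Longrightarrow> y \<notin> S \<Longrightarrow> x \<in> C"
proof -
  obtain c where c: "c \<in> C" using C by auto
  let ?K = "\<lambda>x. cl r {x} (V - C)"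
  have same: "?K u = ?K w" if "w \<in> ?K u" for u w
    by (rule cl_eq_component[OF adj_sym that])
  have cover: "V - C \<subseteq> (\<Union>w\<in>r `` C - C. ?K w)"
  proof
    fix x assume x: "x \<in> V - C"
    then obtain w where w: "w \<in> ?K x" "w \<in> r `` C" using component_touches[OF C(2) c] by blast
    then have "w \<notin> C" "x \<in> ?K w" using cl_subset[of r "{x}" "V - C"] same[OF w(1)] x by (auto intro: cl_source)
    then show "x \<in> (\<Union>w\<in>r `` C - C. ?K w)" using w by auto
  qed
  have fin: "finite (r `` C - C)" using finite_nbrs[OF C(1)] by auto
  have "infinite (V - C)" using inf C(1) by simp
  have "\<exists>u\<in>r `` C - C. infinite (?K u)"
  proof (rule ccontr)
    assume "\<not> ?thesis"
    then have "finite (\<Union>w\<in>r `` C - C. ?K w)" using fin by blast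
    then show False using finite_subset[OF cover] \<open>infinite (V - C)\<close> by blast
  qed
  then obtain u where "u \<in> r `` C - C" and uinf: "infinite (?K u)" by blast
  then have "u \<in> V - C" using r_sub by auto
  note u = this uinf
  define S where "S = V - ?K u"
  have KV: "?K x \<subseteq> V - C" for x by (rule cl_subset)
  have VS: "V - S = ?K u" using KV[of u] by (auto simp: S_def)
  have CS: "C \<subseteq> S" using KV[of u] C(2) by (auto simp: S_def)
  have sub: "S \<subseteq> C \<union> (\<Union>w\<in>{w \<in> r `` C - C. finite (?K w)}. ?K w)"
  proof
    fix x assume x: "x \<in> S"
    show "x \<in> C \<union> (\<Union>w\<in>{w \<in> r `` C - C. finite (?K w)}. ?K w)"
    proof (cases "x \<in> C")
      case False
      then have "x \<in> V - C" using x by (auto simp: S_def)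
      then obtain w where w: "w \<in> r `` C - C" "x \<in> ?K w" using cover by blast
      then have "w \<in> V - C" using r_sub by auto
      have "finite (?K w)"
      proof (rule ccontr)
        assume "infinite (?K w)"
        then have "?K w = ?K u" using infinite_component_unique[OF C(1,2) \<open>w \<in> V - C\<close> u(1)] u(2) by blast
        then show False using w x by (auto simp: S_def)
      qed
      then show ?thesis using w by auto
    qed auto
  qed
  have "finite S" by (rule finite_subset[OF sub]) (use fin C(1) in auto)
  moreover have "conn_set S"
  proof (rule conn_setI[of _ c])
    fix s assume s: "s \<in> S"
    have cC: "cl r {c} C \<subseteq> cl r {c} S" by (rule cl_mono) (use CS in auto)
    show "s \<in> cl r {c} S"
    proof (cases "s \<in> C")
      case True
      then show ?thesis using C(4) c cC by (auto simp: conn_set_def)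
    next
      case False
      then have sV: "s \<in> V - C" using s by (auto simp: S_def)
      then obtain w c' where w: "w \<in> ?K s" "c' \<in> C" "(c', w) \<in> r" using component_touches[OF C(2) c] by blast
      have KS: "?K s \<subseteq> S"
      proof
        fix y assume y: "y \<in> ?K s"
        then have "y \<in> V" using KV by auto
        moreover have "y \<notin> ?K u"
        proof
          assume "y \<in> ?K u"
          then have "?K u = ?K s" using same y by metis
          then show False using s sV by (auto simp: S_def intro: cl_source)
        qed
        ultimately show "y \<in> S" by (simp add: S_def)
      qed
      have "c' \<in> cl r {c} S" using w(2) C(4) c cC by (auto simp: conn_set_def)
      then have "w \<in> cl r {c} S" by (rule cl_step[OF _ w(3)]) (use w KS in auto)
      moreover have "s \<in> cl r {w} (?K s)"
      proof -
        have "w \<in> cl r {s} (?K s)" using w(1) by (simp add: cl_cl)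
        then show ?thesis by (rule cl_sym[OF adj_sym])
      qed
      ultimately show ?thesis using cl_trans[of "{w}" "?K s" r "{c}" S] KS by auto
    qed
  qed
  moreover have "conn_set (V - S)" unfolding VS using u(1) by (rule conn_set_component)
  moreover have "x \<in> C" if xy: "(x, y) \<in> r" "x \<in> S" "y \<notin> S" for x y
  proof (rule ccontr)
    assume "x \<notin> C"
    then have "x \<in> V - C" using xy adj_V by auto
    have "y \<in> ?K u" using xy adj_V VS by blast
    then have "x \<in> ?K u" by (rule cl_step) (use xy adj_sym \<open>x \<in> V - C\<close> in \<open>auto dest: symD\<close>)
    then show False using xy by (simp add: S_def)
  qed
  ultimately show ?thesis using CS by (intro that[of S]) (auto simp: S_def)
qed

end

section \<open>Cuts and triangles\<close>

lemma simple_path: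
  assumes "y \<in> cl r {x} S"
  shows "\<exists>vs. vs \<noteq> [] \<and> distinct vs \<and> hd vs = x \<and> last vs = y \<and> set vs \<subseteq> S \<and>
    successively (\<lambda>a b. (a, b) \<in> r) vs"
  using assms
proof (induction rule: cl_induct)
  case (source y)
  then show ?case by (intro exI[of _ "[x]"]) auto
next
  case (step z w)
  then obtain vs where vs: "vs \<noteq> []" "distinct vs" "hd vs = x" "last vs = z" "set vs \<subseteq> S"
    "successively (\<lambda>a b. (a, b) \<in> r) vs" by blast
  show ?case
  proof (cases "w \<in> set vs")
    case True
    then obtain ps qs where split: "vs = ps @ w # qs" by (meson split_list)
    have "successively (\<lambda>a b. (a, b) \<in> r) ((ps @ [w]) @ qs)" using vs(6) by (simp add: split)
    then have "successively (\<lambda>a b. (a, b) \<in> r) (ps @ [w])" by (simp only: successively_append_iff)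
    moreover have "hd (ps @ [w]) = x" using vs(3) by (cases ps) (auto simp: split)
    ultimately show ?thesis using vs(2,5) by (intro exI[of _ "ps @ [w]"]) (auto simp: split)
  next
    case False
    then show ?thesis using vs step
      by (intro exI[of _ "vs @ [w]"]) (auto simp: successively_append_iff)
  qed
qed

lemma lookup_edge_vector:
  assumes "finite F"
  shows "Poly_Mapping.lookup (edge_vector F) e = (if e \<in> F then 1 else 0)"
proof -
  have "Poly_Mapping.lookup (edge_vector F) e = (\<Sum>e'\<in>F. if e' = e then 1 else 0)"
    unfolding edge_vector_def lookup_sum by (simp add: lookup_single when_def)
  then show ?thesis using assms by simp
qed

text \<open>Counting the edges in \<open>G\<close> modulo 2 is a linear functional on the edge space.\<close>

lemma even_on_span:
  fixes G :: "'e set" and X :: "'e set set"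
  assumes "finite G" and fin: "\<And>C. C \<in> X \<Longrightarrow> finite C" and even: "\<And>C. C \<in> X \<Longrightarrow> (of_nat (card (C \<inter> G)) :: bit) = 0"
    and C: "finite C" "edge_vector C \<in> edge_space.span (edge_vector ` X)"
  shows "(of_nat (card (C \<inter> G)) :: bit) = 0"
proof -
  define \<phi> where "\<phi> f = (\<Sum>e\<in>G. Poly_Mapping.lookup f e)" for f :: "'e \<Rightarrow>\<^sub>0 bit"
  have \<phi>_vec: "\<phi> (edge_vector C) = of_nat (card (C \<inter> G))" if "finite C" for C
  proof -
    have "\<phi> (edge_vector C) = (\<Sum>e\<in>G. if e \<in> C then 1 else 0)"
      by (simp add: \<phi>_def lookup_edge_vector[OF that])
    also have "\<dots> = (\<Sum>e\<in>G \<inter> C. 1)" using assms(1) by (rule sum.inter_restrict[symmetric])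
    finally show ?thesis by (simp add: Int_commute)
  qed
  have "edge_space.subspace {f. \<phi> f = 0}"
  proof (rule edge_space.subspaceI)
    show "0 \<in> {f. \<phi> f = 0}" by (simp add: \<phi>_def)
    have "\<phi> (f + g) = \<phi> f + \<phi> g" for f g by (simp only: \<phi>_def lookup_add sum.distrib)
    then show "f + g \<in> {f. \<phi> f = 0}" if "f \<in> {f. \<phi> f = 0}" "g \<in> {f. \<phi> f = 0}" for f g using that by simp
    have "Poly_Mapping.lookup (Poly_Mapping.map ((*) k) f) e = k * Poly_Mapping.lookup f e" for k :: bit and f :: "'e \<Rightarrow>\<^sub>0 bit" and e
      by (simp add: map.rep_eq when_def)
    then have "\<phi> (Poly_Mapping.map ((*) k) f) = k * \<phi> f" for k f by (simp only: \<phi>_def sum_distrib_left)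
    then show "Poly_Mapping.map ((*) k) f \<in> {f. \<phi> f = 0}" if "f \<in> {f. \<phi> f = 0}" for k f using that by simp
  qed
  moreover have "edge_vector ` X \<subseteq> {f. \<phi> f = 0}" using \<phi>_vec fin even by auto
  ultimately have "edge_space.span (edge_vector ` X) \<subseteq> {f. \<phi> f = 0}" by (intro edge_space.span_minimal)
  then have "\<phi> (edge_vector C) = 0" using C(2) by auto
  then show ?thesis using \<phi>_vec[OF C(1)] by simp
qed

lemma finite_closed_walk_edges: "finite (closed_walk_edges vs)"
  by (simp add: closed_walk_edges_def)

text \<open>A cycle of length at least 4 has four distinct edges.\<close>

lemma triangleE:
  assumes "C \<in> triangles V E"
  obtains a b c where "a \<noteq> b" "b \<noteq> c" "a \<noteq> c" "C = {{a, b}, {b, c}, {c, a}}" "{a, b, c} \<subseteq> V" "C \<subseteq> E"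
proof -
  obtain vs where vs: "C = closed_walk_edges vs" "3 \<le> length vs" "distinct vs" "set vs \<subseteq> V" "C \<subseteq> E"
    and C3: "card C = 3" using assms by (auto simp: triangles_def cycles_def)
  obtain a b c ws where abc: "vs = a # b # c # ws"
    using vs(2) by (auto simp: numeral_3_eq_3 Suc_le_length_iff)
  have "ws = []"
  proof (rule ccontr)
    assume "ws \<noteq> []"
    then obtain d zs where ws: "ws = d # zs" by (cases ws) auto
    define w where "w = vs ! (Suc 3 mod length vs)"
    have w: "w \<noteq> b" "w \<noteq> c" "w \<noteq> d"
      using vs(3) by (cases zs; auto simp: w_def abc ws)+
    have mem: "{vs ! i, vs ! (Suc i mod length vs)} \<in> C" if "i < length vs" for i
      using that unfolding vs(1) closed_walk_edges_def by blast
    have "{a, b} \<in> C" using mem[of 0] by (simp add: abc ws)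
    moreover have "{b, c} \<in> C" using mem[of 1] by (simp add: abc ws)
    moreover have "{c, d} \<in> C" using mem[of 2] by (simp add: abc ws)
    moreover have "{d, w} \<in> C" using mem[of 3] unfolding w_def by (simp add: abc ws)
    ultimately have "{{a, b}, {b, c}, {c, d}, {d, w}} \<subseteq> C" by simp
    moreover have "finite C" by (simp add: vs(1) finite_closed_walk_edges)
    moreover have "card {{a, b}, {b, c}, {c, d}, {d, w}} = 4"
      using vs(3) w by (auto simp: abc ws card_insert_if doubleton_eq_iff)
    ultimately have "4 \<le> card C" by (metis card_mono)
    then show False using C3 by simp
  qed
  then have "C = {{a, b}, {b, c}, {c, a}}"
  proof -
    assume "ws = []"
    have "C = (\<lambda>i. {vs ! i, vs ! (Suc i mod length vs)}) ` {..<Suc (Suc (Suc 0))}"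
      unfolding vs(1) closed_walk_edges_def using \<open>ws = []\<close> by (auto simp: abc)
    then show ?thesis using \<open>ws = []\<close> by (simp add: abc lessThan_Suc insert_commute)
  qed
  then show ?thesis using vs that by (auto simp: abc)
qed

context one_ended_graph
begin

definition cut :: "'a set \<Rightarrow> 'a set set" where
  "cut S = {e \<in> E. \<exists>s\<in>S. \<exists>u\<in>V - S. e = {s, u}}"

lemma cut_iff: "s \<in> S \<Longrightarrow> u \<notin> S \<Longrightarrow> {s, u} \<in> E \<Longrightarrow> {s, u} \<in> cut S"
  using simple unfolding cut_def simple_graph_def by blast

lemma not_cut: "e \<subseteq> S \<or> e \<subseteq> V - S \<Longrightarrow> e \<notin> cut S"
  unfolding cut_def by blast

lemma finite_cut:
  assumes "finite S" shows "finite (cut S)"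
proof -
  have "cut S \<subseteq> (\<lambda>(s, u). {s, u}) ` (SIGMA s:S \<inter> V. r `` {s})"
    using adj_V by (fastforce simp: cut_def adjacency_def)
  moreover have "finite (SIGMA s:S \<inter> V. r `` {s})" using assms finite_adj by auto
  ultimately show ?thesis using finite_subset by blast
qed

lemma cycle_through_cut:
  assumes S: "S \<subseteq> V" "conn_set S" "conn_set (V - S)"
    and e1: "s1 \<in> S" "u1 \<in> V - S" "{s1, u1} \<in> E" and e2: "s2 \<in> S" "u2 \<in> V - S" "{s2, u2} \<in> E"
    and ne: "{s1, u1} \<noteq> {s2, u2}"
  shows "\<exists>C\<in>cycles V E. C \<inter> cut S = {{s1, u1}, {s2, u2}}"
proof -
  have "s2 \<in> cl r {s1} S" "u1 \<in> cl r {u2} (V - S)" using S(2,3) e1 e2 by (auto simp: conn_set_def)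
  from simple_path[OF this(1)] simple_path[OF this(2)] obtain as bs where
    as: "as \<noteq> []" "distinct as" "hd as = s1" "last as = s2" "set as \<subseteq> S" "successively (\<lambda>a b. (a, b) \<in> r) as"
    and bs: "bs \<noteq> []" "distinct bs" "hd bs = u2" "last bs = u1" "set bs \<subseteq> V - S" "successively (\<lambda>a b. (a, b) \<in> r) bs"
    by blast
  define vs where "vs = as @ bs"
  define n m where "n = length as" and "m = length bs"
  have nm: "0 < n" "0 < m" "length vs = n + m" using as bs by (auto simp: n_def m_def vs_def)
  have len: "3 \<le> length vs"
  proof (rule ccontr)
    assume "\<not> 3 \<le> length vs"
    then have "n = 1" "m = 1" using nm by auto
    then obtain a b where "as = [a]" "bs = [b]" by (auto simp: n_def m_def length_Suc_conv)
    then show False using as(3,4) bs(3,4) ne by auto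
  qed
  define ed where "ed i = {vs ! i, vs ! (Suc i mod length vs)}" for i
  have ed: "(ed i \<in> E \<and> (ed i \<subseteq> S \<or> ed i \<subseteq> V - S)) \<or> ed i = {s2, u2} \<or> ed i = {s1, u1}"
    if i: "i < n + m" for i
  proof -
    consider "Suc i < n" | "Suc i = n" | "n \<le> i" "Suc i < n + m" | "Suc i = n + m" using i by linarith
    then show ?thesis
    proof cases
      case 1
      then have "ed i = {as ! i, as ! Suc i}" using nm by (simp add: ed_def vs_def nth_append n_def)
      moreover have "(as ! i, as ! Suc i) \<in> r" using successively_nth[OF as(6)] 1 by (simp add: n_def)
      moreover have "as ! i \<in> S" "as ! Suc i \<in> S" using 1 as(5) by (auto simp: n_def)
      ultimately show ?thesis by (auto simp: adjacency_def)
    next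
      case 2
      have "i = length as - 1" using 2 by (simp add: n_def)
      then have "vs ! i = last as" using as(1) by (simp add: vs_def nth_append last_conv_nth)
      moreover have "vs ! (Suc i mod length vs) = hd bs"
        using 2 nm bs(1) by (simp add: vs_def nth_append n_def hd_conv_nth)
      ultimately show ?thesis using as bs by (simp add: ed_def)
    next
      case 3
      define j where "j = i - n"
      have j: "i = n + j" "Suc j < m" using 3 by (auto simp: j_def)
      then have "ed i = {bs ! j, bs ! Suc j}" using nm 3 by (simp add: ed_def vs_def nth_append n_def)
      moreover have "(bs ! j, bs ! Suc j) \<in> r" using successively_nth[OF bs(6)] j by (simp add: m_def)
      moreover have "bs ! j \<in> V - S" "bs ! Suc j \<in> V - S" using j bs(5) by (auto simp: m_def subset_iff)
      ultimately show ?thesis by (auto simp: adjacency_def)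
    next
      case 4
      then have "i = n + (m - 1)" using nm by simp
      then have "vs ! i = last bs" using nm bs(1) by (simp add: vs_def nth_append n_def last_conv_nth m_def)
      moreover have "vs ! (Suc i mod length vs) = hd as"
        using 4 nm as(1) by (simp add: vs_def nth_append n_def hd_conv_nth)
      ultimately show ?thesis using as bs by (simp add: ed_def insert_commute)
    qed
  qed
  have "n - 1 < n + m" "n + m - 1 < n + m" using nm by auto
  have C: "closed_walk_edges vs = ed ` {..<n + m}"
    using nm by (auto simp: closed_walk_edges_def ed_def)
  have e2_in: "{s2, u2} \<in> closed_walk_edges vs"
  proof -
    have "vs ! (n - 1) = s2" using nm as by (simp add: vs_def nth_append n_def last_conv_nth)
    moreover have "vs ! (Suc (n - 1) mod length vs) = u2"
      using nm bs by (simp add: vs_def nth_append n_def hd_conv_nth)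
    ultimately have "ed (n - 1) = {s2, u2}" by (simp add: ed_def)
    then show ?thesis unfolding C using \<open>n - 1 < n + m\<close> by (metis image_eqI lessThan_iff)
  qed
  have e1_in: "{s1, u1} \<in> closed_walk_edges vs"
  proof -
    have "vs \<noteq> []" "last vs = u1" using bs by (auto simp: vs_def)
    then have "vs ! (n + m - 1) = u1" using nm(3) last_conv_nth[of vs] by simp
    moreover have "Suc (n + m - 1) mod length vs = 0" using nm by simp
    moreover have "vs ! 0 = s1" using nm as by (simp add: vs_def nth_append n_def hd_conv_nth)
    ultimately have "ed (n + m - 1) = {s1, u1}" by (simp add: ed_def insert_commute)
    then show ?thesis unfolding C using \<open>n + m - 1 < n + m\<close> by (metis image_eqI lessThan_iff)
  qed
  have "distinct vs" using as(2,5) bs(2,5) by (auto simp: vs_def)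
  moreover have "set vs \<subseteq> V" using as(5) bs(5) S(1) by (auto simp: vs_def)
  moreover have "closed_walk_edges vs \<subseteq> E" unfolding C
  proof (rule image_subsetI)
    fix i assume "i \<in> {..<n + m}"
    then show "ed i \<in> E" using ed[of i] e1(3) e2(3) by fastforce
  qed
  ultimately have "closed_walk_edges vs \<in> cycles V E" using len unfolding cycles_def by blast
  moreover have "closed_walk_edges vs \<inter> cut S = {{s1, u1}, {s2, u2}}"
  proof
    show "closed_walk_edges vs \<inter> cut S \<subseteq> {{s1, u1}, {s2, u2}}"
      unfolding C using ed not_cut by blast
    have "{s1, u1} \<in> cut S" "{s2, u2} \<in> cut S" using e1 e2 by (auto intro: cut_iff)
    then show "{{s1, u1}, {s2, u2}} \<subseteq> closed_walk_edges vs \<inter> cut S" using e1_in e2_in by auto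
  qed
  ultimately show ?thesis by blast
qed

text \<open>A triangle meets the cut in 0 or 2 edges. So if none met both \<open>F1\<close> and the rest, each triangle would meet \<open>F1\<close> in an even number of edges, and then so would each
cycle; a cycle that crosses the cut once in \<open>F1\<close> and once outside contradicts this.\<close>

lemma cut_linked:
  assumes P: "cycle_basis V E P" "P \<subseteq> triangles V E"
    and S: "S \<subseteq> V" "finite S" "conn_set S" "conn_set (V - S)"
    and F1: "F1 \<subseteq> cut S" "F1 \<noteq> {}" "F1 \<noteq> cut S"
  shows "\<exists>T\<in>triangles V E. \<exists>e1\<in>T \<inter> F1. \<exists>e2\<in>T \<inter> (cut S - F1). True"
proof (rule ccontr)
  assume "\<not> ?thesis"
  then have none: "e2 \<in> F1" if "T \<in> triangles V E" "e1 \<in> T" "e1 \<in> F1" "e2 \<in> T" "e2 \<in> cut S" for T e1 e2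
    using that by blast
  have finF: "finite F1" using finite_cut[OF S(2)] F1(1) finite_subset by blast
  have even: "(of_nat (card (T \<inter> F1)) :: bit) = 0" if T: "T \<in> triangles V E" for T
  proof (cases "T \<inter> F1 = {}")
    case False
    then have TF: "T \<inter> F1 = T \<inter> cut S" using none[OF T] F1(1) by blast
    obtain a b c where abc: "a \<noteq> b" "b \<noteq> c" "a \<noteq> c" "T = {{a, b}, {b, c}, {c, a}}" "{a, b, c} \<subseteq> V" "T \<subseteq> E"
      using triangleE[OF T] by metis
    have cut: "{v, w} \<in> cut S \<longleftrightarrow> (v \<in> S) \<noteq> (w \<in> S)" if "{v, w} \<in> E" "v \<in> V" "w \<in> V" for v w
    proof
      assume "{v, w} \<in> cut S"
      then show "(v \<in> S) \<noteq> (w \<in> S)" by (auto simp: cut_def doubleton_eq_iff)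
    next
      assume "(v \<in> S) \<noteq> (w \<in> S)"
      then show "{v, w} \<in> cut S" using cut_iff[of v S w] cut_iff[of w S v] that by (auto simp: insert_commute)
    qed
    have iff: "{a, b} \<in> cut S \<longleftrightarrow> (a \<in> S) \<noteq> (b \<in> S)" "{b, c} \<in> cut S \<longleftrightarrow> (b \<in> S) \<noteq> (c \<in> S)"
      "{c, a} \<in> cut S \<longleftrightarrow> (c \<in> S) \<noteq> (a \<in> S)" using abc cut by auto
    have ne: "{a, b} \<noteq> {b, c}" "{b, c} \<noteq> {c, a}" "{a, b} \<noteq> {c, a}"
      using abc(1-3) by (auto simp: doubleton_eq_iff)
    have "card (T \<inter> cut S) = (if {a, b} \<in> cut S then 1 else 0) + (if {b, c} \<in> cut S then 1 else 0)
      + (if {c, a} \<in> cut S then 1 else 0)"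
      unfolding abc(4) using ne by (simp add: Int_insert_left card_insert_if)
    then have "card (T \<inter> cut S) = 0 \<or> card (T \<inter> cut S) = 2" unfolding iff by auto
    then show ?thesis unfolding TF by auto
  qed simp
  obtain e1 e2 where e: "e1 \<in> F1" "e2 \<in> cut S" "e2 \<notin> F1" using F1 by blast
  obtain s1 u1 where e1: "e1 = {s1, u1}" "s1 \<in> S" "u1 \<in> V - S" "{s1, u1} \<in> E"
    using e(1) F1(1) unfolding cut_def by blast
  obtain s2 u2 where e2: "e2 = {s2, u2}" "s2 \<in> S" "u2 \<in> V - S" "{s2, u2} \<in> E"
    using e(2) unfolding cut_def by blast
  have "{s1, u1} \<noteq> {s2, u2}" using e e1(1) e2(1) by auto
  then obtain C where C: "C \<in> cycles V E" "C \<inter> cut S = {e1, e2}"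
    using cycle_through_cut[OF S(1,3,4) e1(2-4) e2(2-4)] e1(1) e2(1) by blast
  have "edge_vector C \<in> cycle_space V E"
    unfolding cycle_space_def using C(1) by (intro edge_space.span_base) auto
  then have "edge_vector C \<in> edge_space.span (edge_vector ` P)" using P(1) by (simp add: cycle_basis_def)
  then have "(of_nat (card (C \<inter> F1)) :: bit) = 0"
  proof (rule even_on_span[OF finF, rotated -1])
    show "finite C" using C(1) by (auto simp: cycles_def finite_closed_walk_edges)
    fix T assume "T \<in> P"
    then have T: "T \<in> triangles V E" using P(2) by auto
    show "finite T" using T by (auto simp: triangles_def cycles_def finite_closed_walk_edges)
    show "(of_nat (card (T \<inter> F1)) :: bit) = 0" by (rule even[OF T])
  qed
  moreover have "C \<inter> F1 = {e1}" using C(2) e F1(1) by blast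
  ultimately show False by simp
qed

lemma cut_nonempty_on_ray:
  assumes "finite S" "\<gamma> 0 \<in> S" "\<And>n. (\<gamma> n, \<gamma> (Suc n)) \<in> r" "inj \<gamma>"
  shows "\<exists>n. \<gamma> n \<in> S \<and> \<gamma> (Suc n) \<notin> S \<and> {\<gamma> n, \<gamma> (Suc n)} \<in> cut S"
proof -
  have "\<exists>n. \<gamma> n \<notin> S"
  proof (rule ccontr)
    assume "\<not> ?thesis"
    then have "range \<gamma> \<subseteq> S" by auto
    then have "finite (range \<gamma>)" using assms(1) finite_subset by blast
    then show False using range_inj_infinite[OF assms(4)] by blast
  qed
  then obtain m where m: "\<gamma> m \<notin> S" "\<And>k. k < m \<Longrightarrow> \<gamma> k \<in> S" by (meson exists_least_iff)
  then obtain n where n: "m = Suc n" using assms(2) by (cases m) auto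
  then have "\<gamma> n \<in> S" "\<gamma> (Suc n) \<notin> S" using m by auto
  moreover have "{\<gamma> n, \<gamma> (Suc n)} \<in> E" using assms(3)[of n] by (simp add: adjacency_def)
  ultimately show ?thesis using cut_iff by blast
qed

end

section \<open>Contours in graphs with a basis of triangles\<close>

locale triangle_graph = one_ended_graph V E for V :: "'a set" and E +
  fixes P :: "'a set set set" and x :: 'a
  assumes quasi: "quasi_transitive V E" and basis: "cycle_basis V E P" and triangles: "P \<subseteq> triangles V E"
    and x: "x \<in> V"
begin

lemma graph_automorphism_site: "f \<in> graph_automorphisms V E \<Longrightarrow> site_automorphism f"
  unfolding graph_automorphisms_def site_automorphism_def by (simp add: adjacency_def)

lemma orbit_representatives:
  "\<exists>T. finite T \<and> T \<subseteq> V \<and> (\<forall>v\<in>V. \<exists>t\<in>T. \<exists>f. site_automorphism f \<and> f t = v)"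
proof -
  have fin: "finite (vertex_orbit V E ` V)" using quasi by (simp add: quasi_transitive_def)
  obtain T where T: "T \<subseteq> V" "finite T" "vertex_orbit V E ` V = vertex_orbit V E ` T"
    using finite_subset_image[OF fin order_refl] by metis
  have "\<exists>t\<in>T. \<exists>f. site_automorphism f \<and> f t = v" if v: "v \<in> V" for v
  proof -
    obtain t where t: "t \<in> T" "vertex_orbit V E v = vertex_orbit V E t" using T(3) v by (metis imageE imageI)
    have "id \<in> graph_automorphisms V E" by (auto simp: graph_automorphisms_def)
    then have "v \<in> vertex_orbit V E v" unfolding vertex_orbit_def by (metis id_apply imageI)
    then obtain f where "f \<in> graph_automorphisms V E" "f t = v" unfolding t(2) by (auto simp: vertex_orbit_def)
    then show ?thesis using t(1) graph_automorphism_site by blast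
  qed
  then show ?thesis using T by blast
qed

definition reps :: "'a set" where
  "reps = (SOME T. finite T \<and> T \<subseteq> V \<and> (\<forall>v\<in>V. \<exists>t\<in>T. \<exists>f. site_automorphism f \<and> f t = v))"

lemma reps: "finite reps" "reps \<subseteq> V" "\<And>v. v \<in> V \<Longrightarrow> \<exists>t\<in>reps. \<exists>f. site_automorphism f \<and> f t = v"
proof -
  have "finite reps \<and> reps \<subseteq> V \<and> (\<forall>v\<in>V. \<exists>t\<in>reps. \<exists>f. site_automorphism f \<and> f t = v)"
    unfolding reps_def by (rule someI_ex[OF orbit_representatives])
  then show "finite reps" "reps \<subseteq> V" "\<And>v. v \<in> V \<Longrightarrow> \<exists>t\<in>reps. \<exists>f. site_automorphism f \<and> f t = v"
    by simp_all
qed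

text \<open>A fixed geodesic ray from \<open>x\<close>, whose vertices are the sources of the exploration.\<close>

definition \<gamma> :: "nat \<Rightarrow> 'a" where
  "\<gamma> = (SOME \<gamma>. \<gamma> 0 = x \<and> (\<forall>n. (\<gamma> n, \<gamma> (Suc n)) \<in> r) \<and> (\<forall>n. gd x (\<gamma> n) = n))"

lemma \<gamma>: "\<gamma> 0 = x" "(\<gamma> n, \<gamma> (Suc n)) \<in> r" "gd x (\<gamma> n) = n"
proof -
  have "\<gamma> 0 = x \<and> (\<forall>n. (\<gamma> n, \<gamma> (Suc n)) \<in> r) \<and> (\<forall>n. gd x (\<gamma> n) = n)"
    unfolding \<gamma>_def by (rule someI_ex[OF geodesic_ray[OF x]])
  then show "\<gamma> 0 = x" "(\<gamma> n, \<gamma> (Suc n)) \<in> r" "gd x (\<gamma> n) = n" by simp_all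
qed

lemma \<gamma>_V: "\<gamma> n \<in> V"
  using \<gamma>(2)[of n] adj_V by blast

lemma \<gamma>_inj: "inj \<gamma>"
  by (metis \<gamma>(3) injI)

text \<open>A distance from \<open>x\<close> within which midpoints of geodesics of any even length are found.\<close>

definition D :: nat where
  "D = (SOME D. \<forall>N. \<exists>a\<in>V. \<exists>m\<in>V. \<exists>b\<in>V. gd x m \<le> D \<and> gd m a = N \<and> gd m b = N \<and> gd a b = 2 * N)"

lemma contour_distance:
  assumes "finite S" "x \<in> S" "separator S Q" "\<And>u v. u \<in> Q \<Longrightarrow> v \<in> Q \<Longrightarrow> gd u v \<le> n" "\<gamma> j \<in> Q"
  shows "j \<le> 2 * n + D"
proof -
  have "\<forall>N. \<exists>a\<in>V. \<exists>m\<in>V. \<exists>b\<in>V. gd x m \<le> D \<and> gd m a = N \<and> gd m b = N \<and> gd a b = 2 * N"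
    unfolding D_def by (rule someI_ex[OF long_segments[OF x reps]])
  then have "gd x (\<gamma> j) \<le> 2 * n + D" by (rule separator_close[OF x _ assms])
  then show ?thesis by (simp add: \<gamma>(3))
qed

lemma triangle_edges_meet:
  assumes "T \<in> triangles V E" "e1 \<in> T" "e2 \<in> T"
  shows "e1 \<inter> e2 \<noteq> {}" and "\<And>u v. u \<in> e1 \<Longrightarrow> v \<in> e2 \<Longrightarrow> u \<noteq> v \<Longrightarrow> (u, v) \<in> r"
proof -
  obtain a b c where abc: "a \<noteq> b" "b \<noteq> c" "a \<noteq> c" "T = {{a, b}, {b, c}, {c, a}}" "T \<subseteq> E"
    using triangleE[OF assms(1)] by metis
  show "e1 \<inter> e2 \<noteq> {}" using assms(2,3) unfolding abc(4) by auto
  fix u v assume uv: "u \<in> e1" "v \<in> e2" "u \<noteq> v"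
  then have "{u, v} \<in> T" using assms(2,3) unfolding abc(4) by (auto simp: insert_commute)
  then show "(u, v) \<in> r" using abc(5) by (auto simp: adjacency_def)
qed

text \<open>The contour consists of the vertices outside \<open>S\<close> adjacent to \<open>S\<close>, where \<open>S\<close> is the filled cluster. It is
connected because two edges of the cut in a common triangle have equal or adjacent ends outside \<open>S\<close>. If \<open>x\<close>
itself is vacant, the contour is \<open>{x}\<close>.\<close>

lemma site_contour:
  assumes \<kappa>: "\<kappa> \<subseteq> V" and fin: "finite (cl r {x} (V - \<kappa>))"
  shows "\<exists>B\<subseteq>\<kappa>. finite B \<and> (\<forall>b\<in>B. B \<subseteq> cl r {b} B) \<and> finite (cl r {x} (V - B)) \<and>
    (\<exists>j. B \<inter> {\<gamma> j} \<noteq> {}) \<and> (\<forall>j. B \<inter> {\<gamma> j} \<noteq> {} \<longrightarrow> j \<le> 2 * card B + D)"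
proof (cases "x \<in> \<kappa>")
  case True
  have "cl r {x} (V - {x}) = {}" by (auto simp: cl_def)
  moreover have "{x} \<subseteq> cl r {x} {x}" by (auto intro: cl_source)
  moreover have "j = 0" if "\<gamma> j = x" for j using that \<gamma>(3)[of j] by simp
  ultimately show ?thesis using True \<gamma>(1) by (intro exI[of _ "{x}"]) (auto intro!: exI[of _ 0])
next
  case False
  define C where "C = cl r {x} (V - \<kappa>)"
  have xC: "x \<in> C" using False x by (auto simp: C_def intro: cl_source)
  have CV: "C \<subseteq> V" using cl_subset[of r "{x}" "V - \<kappa>"] by (auto simp: C_def)
  have "conn_set C" unfolding C_def by (rule conn_set_component) (use False x in auto)
  then obtain S where S: "C \<subseteq> S" "finite S" "S \<subseteq> V" "conn_set S" "conn_set (V - S)"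
    "\<And>x y. (x, y) \<in> r \<Longrightarrow> x \<in> S \<Longrightarrow> y \<notin> S \<Longrightarrow> x \<in> C"
    using fill[of C] fin CV xC unfolding C_def[symmetric] by blast
  have xS: "x \<in> S" using xC S(1) by auto
  define B where "B = {u \<in> V - S. \<exists>s\<in>S. (s, u) \<in> r}"
  have B\<kappa>: "B \<subseteq> \<kappa>"
  proof
    fix u assume "u \<in> B"
    then obtain s where s: "u \<in> V" "u \<notin> S" "s \<in> S" "(s, u) \<in> r" by (auto simp: B_def)
    then have "s \<in> C" using S(6) by blast
    show "u \<in> \<kappa>"
    proof (rule ccontr)
      assume "u \<notin> \<kappa>"
      then have "u \<in> V - \<kappa>" using s by simp
      then have "u \<in> C" using \<open>s \<in> C\<close> s(4) unfolding C_def by (metis cl_step)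
      then show False using s S(1) by auto
    qed
  qed
  have finB: "finite B" by (rule finite_subset[OF _ finite_nbrs[OF S(2)]]) (auto simp: B_def)
  have sep: "separator S B"
    using adj_V by (auto simp: separator_def B_def)
  have connB: "B \<subseteq> cl r {b} B" if b: "b \<in> B" for b
  proof (rule ccontr)
    define B1 where "B1 = cl r {b} B"
    define F1 where "F1 = {e \<in> cut S. e \<inter> B1 \<noteq> {}}"
    assume "\<not> B \<subseteq> cl r {b} B"
    then obtain b' where b': "b' \<in> B" "b' \<notin> B1" by (auto simp: B1_def)
    have B1: "B1 \<subseteq> B" "b \<in> B1" using b cl_subset[of r "{b}" B] by (auto simp: B1_def intro: cl_source)
    have edge: "\<exists>s\<in>S. {s, u} \<in> cut S" if "u \<in> B" for u
      using that by (auto simp: B_def adjacency_def intro!: cut_iff)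
    obtain s where s: "s \<in> S" "{s, b} \<in> cut S" using edge b by blast
    obtain s' where s': "s' \<in> S" "{s', b'} \<in> cut S" using edge b' by blast
    have "{s, b} \<in> F1" using s B1 by (auto simp: F1_def)
    moreover have "{s', b'} \<notin> F1" using s' b' B1 by (auto simp: F1_def B_def)
    moreover have "F1 \<subseteq> cut S" by (auto simp: F1_def)
    ultimately have "F1 \<subseteq> cut S" "F1 \<noteq> {}" "F1 \<noteq> cut S" using s'(2) by blast+
    then have "\<exists>T\<in>triangles V E. \<exists>e1\<in>T \<inter> F1. \<exists>e2\<in>T \<inter> (cut S - F1). True"
      by (rule cut_linked[OF basis triangles S(3,2,4,5)])
    then obtain T e1 e2 where T: "T \<in> triangles V E" "e1 \<in> T" "e1 \<in> F1" "e2 \<in> T" "e2 \<in> cut S" "e2 \<notin> F1" by blast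
    obtain u where u: "u \<in> e1" "u \<in> B1" using T(3) by (auto simp: F1_def)
    obtain t v where v: "e2 = {t, v}" "t \<in> S" "v \<in> V - S" "{t, v} \<in> E" using T(5) by (auto simp: cut_def)
    have vB: "v \<in> B" using v by (auto simp: B_def adjacency_def)
    have "v \<in> B1"
    proof (cases "u = v")
      case False
      then have "(u, v) \<in> r" using triangle_edges_meet(2)[OF T(1,2,4) u(1)] v(1) by auto
      with u(2) show ?thesis using vB unfolding B1_def by (rule cl_step)
    qed (use u in simp)
    then show False using T(5,6) v(1) by (auto simp: F1_def)
  qed
  have diam: "gd u v \<le> card B" if uv: "u \<in> B" "v \<in> B" for u v
  proof (rule less_imp_le, rule connected_diameter[of B r u "gd u"])
    show "gd u b \<le> gd u a + 1" if "(a, b) \<in> r" for a b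
      using gd_step[OF _ that, of u] uv by (auto simp: B_def)
  qed (use finB connB uv in auto)
  have "cl r {x} (V - B) \<subseteq> S"
    by (rule cl_least) (use xS in \<open>auto simp: B_def\<close>)
  then have "finite (cl r {x} (V - B))" using S(2) finite_subset by blast
  moreover obtain n where n: "\<gamma> n \<in> S" "\<gamma> (Suc n) \<notin> S"
    using cut_nonempty_on_ray[OF S(2) _ \<gamma>(2) \<gamma>_inj] xS by (auto simp: \<gamma>(1))
  then have "\<gamma> (Suc n) \<in> B" using \<gamma>(2) \<gamma>_V by (auto simp: B_def)
  moreover have "j \<le> 2 * card B + D" if "\<gamma> j \<in> B" for j
    by (rule contour_distance[OF S(2) xS sep diam that])
  ultimately show ?thesis using B\<kappa> finB connB by (intro exI[of _ B]) auto
qed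

lemma site_contour_graph: "contour_graph V r {x} (\<lambda>k. {\<gamma> k}) reps 1 2 D"
proof unfold_locales
  show "infinite V" by (rule inf)
  show "finite reps" "reps \<subseteq> V" by (rule reps)+
  show "\<exists>t\<in>reps. \<exists>f. site_automorphism f \<and> f t = v" if "v \<in> V" for v using reps(3)[OF that] .
  show "\<exists>B\<subseteq>\<kappa>. finite B \<and> (\<forall>b\<in>B. B \<subseteq> cl r {b} B) \<and> finite (cl r {x} (V - B)) \<and>
    (\<exists>j. B \<inter> {\<gamma> j} \<noteq> {}) \<and> (\<forall>j. B \<inter> {\<gamma> j} \<noteq> {} \<longrightarrow> j \<le> 2 * card B + D)"
    if "\<kappa> \<subseteq> V" "finite (cl r {x} (V - \<kappa>))" for \<kappa> by (rule site_contour[OF that])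
qed (use x \<gamma>_V in auto)

subsection \<open>Bond percolation as site percolation on the line graph\<close>

text \<open>The line graph of \<open>G\<close>: bond percolation on \<open>G\<close> becomes site percolation for this relation.\<close>

definition rE :: "'a set rel" where
  "rE = {(e, e'). e \<in> E \<and> e' \<in> E \<and> e \<inter> e' \<noteq> {}}"

definition star :: "'a \<Rightarrow> 'a set set" where
  "star v = {e \<in> E. v \<in> e}"

lemma finite_star: "v \<in> V \<Longrightarrow> finite (star v)"
  using loc_fin by (simp add: star_def locally_finite_graph_def)

lemma star_eq: "v \<in> V \<Longrightarrow> star v = (\<lambda>w. {v, w}) ` (r `` {v})"
proof (intro set_eqI iffI)
  fix e assume "e \<in> star v"
  then have e: "e \<in> E" "v \<in> e" by (auto simp: star_def)
  obtain a b where "e = {a, b}" "(a, b) \<in> r" by (rule edgeE[OF e(1)]) blast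
  then show "e \<in> (\<lambda>w. {v, w}) ` (r `` {v})" using e adj_sym by (auto simp: insert_commute dest: symD)
qed (auto simp: star_def adjacency_def)

lemma edge_V: "e \<in> E \<Longrightarrow> e \<subseteq> V"
  using simple by (auto simp: simple_graph_def)

lemma finite_edge: "e \<in> E \<Longrightarrow> finite e"
  using simple by (auto simp: simple_graph_def intro: card_ge_0_finite)

lemma edge_pair:
  assumes "e \<in> E" "u \<in> e" "w \<in> e" "u \<noteq> w" shows "{u, w} = e"
  by (rule edgeE[OF assms(1)]) (use assms(2-4) in auto)

lemma rE_nbrs: "e \<in> E \<Longrightarrow> rE `` {e} = (\<Union>v\<in>e. star v)"
  by (auto simp: rE_def star_def)

lemma line_graph_connected:
  assumes "e \<in> E" "e' \<in> E" shows "(e, e') \<in> rE\<^sup>*"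
proof -
  obtain u where u: "u \<in> e" "u \<in> V" by (rule edgeE[OF assms(1)]) blast
  obtain v where v: "v \<in> e'" "v \<in> V" by (rule edgeE[OF assms(2)]) blast
  have "(u, v) \<in> r\<^sup>*" using connected_adj u v by auto
  then have "\<exists>e''\<in>E. v \<in> e'' \<and> (e, e'') \<in> rE\<^sup>*"
  proof (induction rule: rtrancl_induct)
    case base then show ?case using assms(1) u by blast
  next
    case (step a b)
    then obtain e'' where e'': "e'' \<in> E" "a \<in> e''" "(e, e'') \<in> rE\<^sup>*" by blast
    have "{a, b} \<in> E" using step(2) by (simp add: adjacency_def)
    then have "(e'', {a, b}) \<in> rE" using e'' by (auto simp: rE_def)
    then show ?case using e''(3) \<open>{a, b} \<in> E\<close> by (intro bexI[of _ "{a, b}"]) auto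
  qed
  then obtain e'' where "e'' \<in> E" "v \<in> e''" "(e, e'') \<in> rE\<^sup>*" by blast
  moreover have "(e'', e') \<in> rE" using calculation assms(2) v by (auto simp: rE_def)
  ultimately show ?thesis by auto
qed

lemma star_nonempty: "v \<in> V \<Longrightarrow> star v \<noteq> {}"
proof
  assume v: "v \<in> V" "star v = {}"
  have "V - {v} \<noteq> {}" using infinite_remove[OF inf, of v] by (metis finite.emptyI)
  then obtain w where "w \<in> V" "w \<noteq> v" by blast
  then have "(v, w) \<in> r\<^sup>*" using connected_adj v by auto
  then obtain u where "(v, u) \<in> r" using \<open>w \<noteq> v\<close> by (metis converse_rtranclE)
  then show False using v(2) by (auto simp: star_def adjacency_def)
qed

lemma infinite_edges: "infinite E"
proof
  assume "finite E"
  then have "finite (\<Union>E)" using finite_edge by auto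
  moreover have "V \<subseteq> \<Union>E" using star_nonempty by (fastforce simp: star_def)
  ultimately show False using inf finite_subset by blast
qed

sublocale line: connected_site_graph E rE
proof
  show "rE \<subseteq> E \<times> E" by (auto simp: rE_def)
  show "sym rE" by (auto simp: rE_def sym_def)
  show "finite (rE `` {e})" if "e \<in> E" for e
    unfolding rE_nbrs[OF that] using finite_edge[OF that] edge_V[OF that] finite_star by auto
  show "(e, e') \<in> rE\<^sup>*" if "e \<in> E" "e' \<in> E" for e e' using line_graph_connected[OF that] .
qed

lemma line_automorphism:
  assumes f: "site_automorphism f" shows "line.site_automorphism (image f)"
proof -
  have inj: "inj_on f V" and fV: "f ` V = V"
    and fr: "\<And>i j. i \<in> V \<Longrightarrow> j \<in> V \<Longrightarrow> {f i, f j} \<in> E \<longleftrightarrow> {i, j} \<in> E"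
    using f unfolding site_automorphism_def bij_betw_def by (simp_all add: adjacency_def)
  have sub: "f ` e \<in> E" if e: "e \<in> E" for e
  proof -
    obtain u v where "e = {u, v}" "u \<in> V" "v \<in> V" by (rule edgeE[OF e]) blast
    then show ?thesis using fr[of u v] e by simp
  qed
  have sur: "\<exists>e'\<in>E. e = f ` e'" if e: "e \<in> E" for e
  proof -
    obtain u v where uv: "e = {u, v}" "u \<in> f ` V" "v \<in> f ` V" unfolding fV by (rule edgeE[OF e]) blast
    then obtain u' v' where "u' \<in> V" "v' \<in> V" "u = f u'" "v = f v'" by auto
    then show ?thesis using fr[of u' v'] e uv(1) by (intro bexI[of _ "{u', v'}"]) auto
  qed
  have "inj_on (image f) E"
    by (rule inj_on_subset[OF inj_on_image_Pow[OF inj]]) (use edge_V in auto)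
  moreover have "image f ` E = E" using sub sur by blast
  moreover have "(f ` e, f ` e') \<in> rE \<longleftrightarrow> (e, e') \<in> rE" if "e \<in> E" "e' \<in> E" for e e'
  proof -
    have "f ` e \<inter> f ` e' = f ` (e \<inter> e')"
      by (rule inj_on_image_Int[OF inj edge_V[OF that(1)] edge_V[OF that(2)], symmetric])
    then show ?thesis using sub that by (simp add: rE_def)
  qed
  ultimately show ?thesis by (simp add: line.site_automorphism_def bij_betw_def)
qed

lemma line_reps:
  "\<exists>T. finite T \<and> T \<subseteq> E \<and> (\<forall>e\<in>E. \<exists>t\<in>T. \<exists>f. line.site_automorphism f \<and> f t = e)"
proof (intro exI conjI ballI)
  show "finite (\<Union>t\<in>reps. star t)" using reps finite_star by auto
  show "(\<Union>t\<in>reps. star t) \<subseteq> E" by (auto simp: star_def)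
  fix e assume e: "e \<in> E"
  obtain u v where uv: "e = {u, v}" "u \<in> V" "v \<in> V" by (rule edgeE[OF e]) blast
  obtain t f where t: "t \<in> reps" "site_automorphism f" "f t = u" using reps(3)[OF uv(2)] by blast
  have fV: "f ` V = V" and fr: "\<And>i j. i \<in> V \<Longrightarrow> j \<in> V \<Longrightarrow> {f i, f j} \<in> E \<longleftrightarrow> {i, j} \<in> E"
    using t(2) unfolding site_automorphism_def bij_betw_def by (simp_all add: adjacency_def)
  obtain w where w: "w \<in> V" "f w = v" using uv(3) fV by (metis imageE)
  have "{t, w} \<in> E" using fr[of t w] t w uv e reps(2) by auto
  then have "{t, w} \<in> (\<Union>t\<in>reps. star t)" using t(1) by (auto simp: star_def)
  moreover have "f ` {t, w} = e" using t(3) w(2) uv(1) by simp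
  ultimately show "\<exists>t\<in>\<Union>t\<in>reps. star t. \<exists>f. line.site_automorphism f \<and> f t = e"
    using line_automorphism[OF t(2)] by blast
qed

lemma bond_component:
  assumes G: "G \<subseteq> E"
  shows "component V G x \<subseteq> insert x (\<Union>(cl rE (star x) G))"
    and "cl rE (star x) G \<subseteq> {e \<in> E. e \<inter> component V G x \<noteq> {}}"
    and "component V G x \<subseteq> V"
    and "component V G x = cl r {x} (component V G x)"
proof -
  let ?C = "component V G x" and ?K = "cl rE (star x) G"
  have C: "?C = {v. (x, v) \<in> (adjacency G)\<^sup>*}" using x by (simp add: component_def)
  have GE: "adjacency G \<subseteq> r" using G by (auto simp: adjacency_def)
  show CV: "?C \<subseteq> V"
  proof
    fix v assume "v \<in> ?C"
    then have "(x, v) \<in> (adjacency G)\<^sup>*" by (simp add: C)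
    then show "v \<in> V" by (induction rule: rtrancl_induct) (use x GE adj_V in auto)
  qed
  show "?C \<subseteq> insert x (\<Union>?K)"
  proof
    fix v assume "v \<in> ?C"
    then have "(x, v) \<in> (adjacency G)\<^sup>*" by (simp add: C)
    then show "v \<in> insert x (\<Union>?K)"
    proof (induction rule: rtrancl_induct)
      case (step u w)
      have e: "{u, w} \<in> G" using step(2) by (simp add: adjacency_def)
      have "{u, w} \<in> ?K"
      proof (cases "u = x")
        case True
        then show ?thesis using e G by (auto simp: star_def intro!: cl_source)
      next
        case False
        then obtain e' where "e' \<in> ?K" "u \<in> e'" using step.IH by auto
        moreover have "e' \<in> G" using calculation cl_subset by fast
        moreover have "(e', {u, w}) \<in> rE" using calculation e G by (auto simp: rE_def)
        ultimately show ?thesis using e by (metis cl_step)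
      qed
      then show ?case by auto
    qed auto
  qed
  have extend: "w \<in> ?C" if "e \<in> G" "u \<in> e" "u \<in> ?C" "w \<in> e" for e u w
  proof (cases "u = w")
    case False
    have "e \<in> E" using that(1) G by auto
    then obtain a b where "e = {a, b}" by (rule edgeE) blast
    then have "{u, w} = e" using that False by auto
    then have "(u, w) \<in> adjacency G" using that(1) by (simp add: adjacency_def)
    then show ?thesis using that(3) by (auto simp: C intro: rtrancl_into_rtrancl)
  qed (use that in simp)
  have "?K \<subseteq> {e \<in> E. e \<subseteq> ?C}"
  proof (rule cl_least)
    show "star x \<inter> G \<subseteq> {e \<in> E. e \<subseteq> ?C}"
      using extend[of _ x] by (auto simp: star_def C)
    fix e e' assume "e \<in> {e \<in> E. e \<subseteq> ?C}" "(e, e') \<in> rE" "e' \<in> G"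
    then show "e' \<in> {e \<in> E. e \<subseteq> ?C}" using extend[of e'] by (auto simp: rE_def)
  qed
  moreover have "e \<noteq> {}" if "e \<in> E" for e by (rule edgeE[OF that]) blast
  ultimately show "?K \<subseteq> {e \<in> E. e \<inter> ?C \<noteq> {}}" by blast
  have "v \<in> cl r {x} ?C" if "v \<in> ?C" for v
  proof -
    have "(x, v) \<in> (adjacency G)\<^sup>*" using that by (simp add: C)
    then show ?thesis
    proof (induction rule: rtrancl_induct)
      case base then show ?case by (auto simp: C intro: cl_source)
    next
      case (step u w)
      have "w \<in> ?C" using step by (auto simp: C intro: rtrancl_into_rtrancl)
      then show ?case using step GE by (auto intro: cl_step)
    qed
  qed
  then show "?C = cl r {x} ?C" using cl_subset[of r "{x}" ?C] by auto
qed

lemma finite_bond_component: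
  assumes G: "G \<subseteq> E"
  shows "finite (component V G x) \<longleftrightarrow> finite (cl rE (star x) G)"
proof
  assume C: "finite (component V G x)"
  have "{e \<in> E. e \<inter> component V G x \<noteq> {}} \<subseteq> (\<Union>v\<in>component V G x. star v)" by (auto simp: star_def)
  moreover have "finite (\<Union>v\<in>component V G x. star v)"
    using C bond_component(3)[OF G] finite_star by (intro finite_UN_I) auto
  ultimately show "finite (cl rE (star x) G)" using bond_component(2)[OF G] finite_subset by (metis (no_types, lifting))
next
  assume K: "finite (cl rE (star x) G)"
  have "finite e" if "e \<in> cl rE (star x) G" for e
    using that cl_subset[of rE "star x" G] G finite_edge by blast
  then have "finite (insert x (\<Union>(cl rE (star x) G)))" using K by auto
  then show "finite (component V G x)" using bond_component(1)[OF G] by (rule finite_subset[rotated])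
qed

text \<open>The contour is the edge cut around the filled cluster; two edges in a common triangle share a vertex.\<close>

lemma bond_contour:
  assumes \<kappa>: "\<kappa> \<subseteq> E" and fin: "finite (cl rE (star x) (E - \<kappa>))"
  shows "\<exists>B\<subseteq>\<kappa>. finite B \<and> (\<forall>b\<in>B. B \<subseteq> cl rE {b} B) \<and> finite (cl rE (star x) (E - B)) \<and>
    (\<exists>j. B \<inter> star (\<gamma> j) \<noteq> {}) \<and> (\<forall>j. B \<inter> star (\<gamma> j) \<noteq> {} \<longrightarrow> j \<le> 2 * card B + D)"
proof -
  define G where "G = E - \<kappa>"
  have G: "G \<subseteq> E" by (auto simp: G_def)
  define C where "C = component V G x"
  have xC: "x \<in> C" using x by (simp add: C_def component_def)
  have finC: "finite C" using finite_bond_component[OF G] fin by (simp add: C_def G_def)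
  have CV: "C \<subseteq> V" using bond_component(3)[OF G] by (simp add: C_def)
  have "conn_set C" using bond_component(4)[OF G] unfolding C_def[symmetric] by (intro conn_setI[of _ x]) blast
  then obtain S where S: "C \<subseteq> S" "finite S" "S \<subseteq> V" "conn_set S" "conn_set (V - S)"
    "\<And>x y. (x, y) \<in> r \<Longrightarrow> x \<in> S \<Longrightarrow> y \<notin> S \<Longrightarrow> x \<in> C"
    using fill[of C] finC CV xC by blast
  have xS: "x \<in> S" using xC S(1) by auto
  define B where "B = cut S"
  have BE: "B \<subseteq> E" by (auto simp: B_def cut_def)
  have B\<kappa>: "B \<subseteq> \<kappa>"
  proof
    fix e assume "e \<in> B"
    then obtain s u where e: "e = {s, u}" "s \<in> S" "u \<in> V - S" "{s, u} \<in> E" by (auto simp: B_def cut_def)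
    then have "s \<in> C" using S(6)[of s u] by (auto simp: adjacency_def)
    show "e \<in> \<kappa>"
    proof (rule ccontr)
      assume "e \<notin> \<kappa>"
      then have "(s, u) \<in> adjacency G" using e by (auto simp: G_def adjacency_def)
      then have "u \<in> C" using \<open>s \<in> C\<close> x by (auto simp: C_def component_def intro: rtrancl_into_rtrancl)
      then show False using e S(1) by auto
    qed
  qed
  have finB: "finite B" unfolding B_def by (rule finite_cut[OF S(2)])
  have connB: "B \<subseteq> cl rE {b} B" if b: "b \<in> B" for b
  proof (rule ccontr)
    define F1 where "F1 = cl rE {b} B"
    assume "\<not> B \<subseteq> cl rE {b} B"
    then have "F1 \<noteq> cut S" by (auto simp: F1_def B_def)
    moreover have "F1 \<subseteq> cut S" "F1 \<noteq> {}"
      using b cl_subset[of rE "{b}" B] cl_source[of b "{b}" B rE] by (auto simp: F1_def B_def)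
    ultimately have "\<exists>T\<in>triangles V E. \<exists>e1\<in>T \<inter> F1. \<exists>e2\<in>T \<inter> (cut S - F1). True"
      by (intro cut_linked[OF basis triangles S(3,2,4,5)])
    then obtain T e1 e2 where T: "T \<in> triangles V E" "e1 \<in> T" "e1 \<in> F1" "e2 \<in> T" "e2 \<in> cut S" "e2 \<notin> F1" by blast
    have "e1 \<in> B" using T(3) cl_subset[of rE "{b}" B] by (auto simp: F1_def)
    then have "(e1, e2) \<in> rE" using triangle_edges_meet(1)[OF T(1,2,4)] T(5) BE by (auto simp: rE_def B_def)
    with T(3) have "e2 \<in> F1" using T(5) unfolding F1_def B_def[symmetric] by (rule cl_step)
    then show False using T(6) by simp
  qed
  have sep: "separator S (\<Union>B)"
    unfolding separator_def
  proof (intro conjI allI impI)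
    show "\<Union>B \<subseteq> V" using BE edge_V by blast
    fix a b assume "(a, b) \<in> r" "a \<in> S" "b \<notin> S"
    then have "{a, b} \<in> B" unfolding B_def by (intro cut_iff) (auto simp: adjacency_def)
    then show "a \<in> \<Union>B \<or> b \<in> \<Union>B" by auto
  qed
  have diam: "gd u v \<le> card B" if uv: "u \<in> \<Union>B" "v \<in> \<Union>B" for u v
  proof -
    have uV: "u \<in> V" using uv(1) BE edge_V by blast
    have along: "gd u w \<le> gd u w' + 1" if "e \<in> E" "w \<in> e" "w' \<in> e" for e w w'
    proof (cases "w = w'")
      case False
      then have "{w', w} = e" using edge_pair[OF that(1,3,2)] by simp
      then have "(w', w) \<in> r" using that(1) by (simp add: adjacency_def)
      then show ?thesis by (rule gd_step[OF uV])
    qed simp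
    define f where "f e = Min (gd u ` e)" for e
    have f_le: "f e \<le> gd u w" if "e \<in> E" "w \<in> e" for e w
      unfolding f_def using finite_edge[OF that(1)] that(2) by (intro Min_le) auto
    have f_ge: "gd u w \<le> f e + 1" if "e \<in> E" "w \<in> e" for e w
    proof -
      have "f e \<in> gd u ` e" unfolding f_def using finite_edge[OF that(1)] that(2) by (intro Min_in) auto
      then obtain w' where "w' \<in> e" "f e = gd u w'" by auto
      then show ?thesis using along[OF that] by simp
    qed
    obtain e0 e1 where e: "e0 \<in> B" "u \<in> e0" "e1 \<in> B" "v \<in> e1" using uv by auto
    have "f e1 < card B"
    proof (rule connected_diameter[of B rE e0 f])
      show "f e0 = 0" using f_le[of e0 u] e BE by auto
      fix e e' assume "(e, e') \<in> rE"
      then obtain w where "e \<in> E" "e' \<in> E" "w \<in> e" "w \<in> e'" by (auto simp: rE_def)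
      then show "f e' \<le> f e + 1" using f_le[of e' w] f_ge[of e w] by simp
    qed (use finB connB e in auto)
    then show ?thesis using f_ge[of e1 v] e BE by auto
  qed
  have "cl rE (star x) (E - B) \<subseteq> {e \<in> E. e \<subseteq> S}"
  proof (rule cl_least)
    have in_S: "e \<subseteq> S" if "e \<in> E - B" "s \<in> e" "s \<in> S" for e s
    proof
      fix w assume w: "w \<in> e"
      show "w \<in> S"
      proof (rule ccontr)
        assume "w \<notin> S"
        then have "{s, w} = e" using edge_pair[of e s w] that w by auto
        then have "e \<in> B" unfolding B_def using cut_iff[of s S w] that \<open>w \<notin> S\<close> by auto
        then show False using that by auto
      qed
    qed
    show "star x \<inter> (E - B) \<subseteq> {e \<in> E. e \<subseteq> S}" using in_S[of _ x] xS by (auto simp: star_def)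
    fix e e' assume "e \<in> {e \<in> E. e \<subseteq> S}" "(e, e') \<in> rE" "e' \<in> E - B"
    then show "e' \<in> {e \<in> E. e \<subseteq> S}" using in_S[of e'] by (auto simp: rE_def)
  qed
  moreover have "finite {e \<in> E. e \<subseteq> S}" by (rule finite_subset[of _ "Pow S"]) (use S(2) in auto)
  ultimately have "finite (cl rE (star x) (E - B))" by (rule finite_subset)
  moreover obtain n where "{\<gamma> n, \<gamma> (Suc n)} \<in> cut S"
    using cut_nonempty_on_ray[OF S(2) _ \<gamma>(2) \<gamma>_inj] xS by (auto simp: \<gamma>(1))
  then have "B \<inter> star (\<gamma> n) \<noteq> {}" using BE by (auto simp: B_def star_def)
  moreover have "j \<le> 2 * card B + D" if "B \<inter> star (\<gamma> j) \<noteq> {}" for j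
    by (rule contour_distance[OF S(2) xS sep diam]) (use that in \<open>auto simp: star_def\<close>)
  ultimately show ?thesis using B\<kappa> finB connB by (intro exI[of _ B]) auto
qed

lemma bond_contour_graph: "\<exists>T d. contour_graph E rE (star x) (\<lambda>k. star (\<gamma> k)) T d 2 D"
proof -
  obtain T where "finite T \<and> T \<subseteq> E \<and> (\<forall>e\<in>E. \<exists>t\<in>T. \<exists>f. line.site_automorphism f \<and> f t = e)"
    using line_reps by (rule exE)
  then have T: "finite T" "T \<subseteq> E" "\<And>e. e \<in> E \<Longrightarrow> \<exists>t\<in>T. \<exists>f. line.site_automorphism f \<and> f t = e" by simp_all
  obtain \<Delta> where "\<forall>v\<in>V. card (r `` {v}) \<le> \<Delta>" using bounded_degree[OF reps] by (rule exE)
  then have \<Delta>: "\<And>v. v \<in> V \<Longrightarrow> card (r `` {v}) \<le> \<Delta>" by simp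
  have "contour_graph E rE (star x) (\<lambda>k. star (\<gamma> k)) T \<Delta> 2 D"
  proof
    show "infinite E" by (rule infinite_edges)
    show "finite T" "T \<subseteq> E" by (rule T)+
    show "\<exists>t\<in>T. \<exists>f. line.site_automorphism f \<and> f t = e" if "e \<in> E" for e using T(3)[OF that] .
    show "finite (star x)" "star x \<subseteq> E" "star x \<noteq> {}"
      using x finite_star star_nonempty by (auto simp: star_def)
    show "finite (star (\<gamma> k))" "star (\<gamma> k) \<subseteq> E" for k
      using \<gamma>_V finite_star by (auto simp: star_def)
    show "card (star (\<gamma> k)) \<le> \<Delta>" for k
      using card_image_le[OF finite_adj[OF \<gamma>_V]] \<Delta>[OF \<gamma>_V] unfolding star_eq[OF \<gamma>_V] by (rule order_trans)
    show "\<exists>B\<subseteq>\<kappa>. finite B \<and> (\<forall>b\<in>B. B \<subseteq> cl rE {b} B) \<and> finite (cl rE (star x) (E - B)) \<and>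
        (\<exists>j. B \<inter> star (\<gamma> j) \<noteq> {}) \<and> (\<forall>j. B \<inter> star (\<gamma> j) \<noteq> {} \<longrightarrow> j \<le> 2 * card B + D)"
      if "\<kappa> \<subseteq> E" "finite (cl rE (star x) (E - \<kappa>))" for \<kappa> by (rule bond_contour[OF that])
  qed
  then show ?thesis by blast
qed

end

theorem theorem10p15:
  fixes V :: "'a set" and E :: "'a set set" and P :: "'a set set set" and x :: 'a
  assumes "simple_graph V E"
    and "infinite V"
    and "connected_graph V E"
    and "locally_finite_graph V E"
    and "one_ended V E"
    and "quasi_transitive V E"
    and "cycle_basis V E P"
    and "P \<subseteq> triangles V E"
    and "x \<in> V"
  shows "site_p_analytic V E x \<le> 1 - site_pc V E x \<and> bond_p_analytic V E x \<le> 1 - bond_pc V E x \<and>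
         site_pc V E x \<le> 1 / 2 \<and> bond_pc V E x \<le> 1 / 2"
proof -
  interpret triangle_graph V E P x by unfold_locales (use assms in auto)
  interpret site: contour_graph V r "{x}" "\<lambda>k. {\<gamma> k}" reps 1 2 D by (rule site_contour_graph)
  obtain T d where "contour_graph E rE (star x) (\<lambda>k. star (\<gamma> k)) T d 2 D" using bond_contour_graph by blast
  then interpret bond: contour_graph E rE "star x" "\<lambda>k. star (\<gamma> k)" T d 2 D .
  have site: "site_theta V E x p = 1 - prob_finite {x} p" if "0 \<le> p" "p \<le> 1" for p
  proof -
    have "site_cluster V E x \<omega> = cl r {x} (occupied V \<omega>)" for \<omega>
      unfolding site_cluster_def component_induced by (simp add: occupied_def)
    then show ?thesis using prob_infinite[of "{x}" p] x that by (simp add: site_theta_def)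
  qed
  have bond: "bond_theta V E x p = 1 - line.prob_finite (star x) p" if "0 \<le> p" "p \<le> 1" for p
  proof -
    have "finite (bond_cluster V E x \<omega>) \<longleftrightarrow> finite (cl rE (star x) (occupied E \<omega>))" for \<omega>
      unfolding bond_cluster_def occupied_def by (rule finite_bond_component) auto
    then show ?thesis using line.prob_infinite[OF bond.seed(1,2) that] by (simp add: bond_theta_def)
  qed
  show ?thesis
    using site.threshold_duality[OF site] bond.threshold_duality[OF bond]
    by (simp add: site_p_analytic_def site_pc_def bond_p_analytic_def bond_pc_def)
qed

end
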